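(* Let $D\ge 4$. Let $X_{ij}$, $1\le i,j\le D$, $X_{ij}=-X_{ji}$, be the standard basis of the Lie algebra $\mathfrak{so}(D)$, satisfying $[X_{ij},X_{kl}]=\delta_{ik}X_{jl}-\delta_{il}X_{jk}-\delta_{jk}X_{il}+\delta_{jl}X_{ik}$. Call a finite-dimensional complex representation $V$ of $\mathrm{SO}(D)$ simple if $X_{[ij}X_{kl]}$ acts as zero on $V$ for all $i,j,k,l\in\{1,\dots,D\}$, where $[ijkl]$ denotes total antisymmetrization over the four indices. Then an irreducible representation $V$ of $\mathrm{SO}(D)$ is simple if and only if $V$ is equivalent to $\mathcal{H}^{(D)}_N$ for some integer $N\ge 0$.
   Context: $\mathcal{H}^{(D)}_N$ denotes the space of complex-valued harmonic homogeneous polynomials of degree $N$ on $\mathbb{R}^D$, with $\mathrm{SO}(D)$ acting by $(g\cdot P)(x)=P(g^{-1}x)$; the induced Lie algebra action is $X_{ij}\cdot P=x_i\,\partial P/\partial x_j-x_j\,\partial P/\partial x_i$. It is the irreducible representation of highest weight $Ne_1$. *)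

theory Defs
  imports "HOL-Analysis.Analysis" "HOL-Combinatorics.Permutations"
begin

definition SO :: "(real^'n^'n) set" where
  "SO = {g. orthogonal_matrix g \<and> det g = 1}"

definition so_rep :: "(real^'n^'n \<Rightarrow> complex^'m^'m) \<Rightarrow> bool" where
  "so_rep \<rho> \<longleftrightarrow> (\<forall>g\<in>SO. \<forall>h\<in>SO. \<rho> (g ** h) = \<rho> g ** \<rho> h) \<and> \<rho> (mat 1) = mat 1
      \<and> continuous_on SO \<rho>"

definition irreducible_rep :: "(real^'n^'n \<Rightarrow> complex^'m^'m) \<Rightarrow> bool" where
  "irreducible_rep \<rho> \<longleftrightarrow>
     (\<forall>W :: (complex^'m) set. vec.subspace W \<and> (\<forall>g\<in>SO. \<forall>w\<in>W. \<rho> g *v w \<in> W)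
        \<longrightarrow> W = {0} \<or> W = UNIV)"

text \<open>One-parameter subgroup of rotations in the (i,j)-plane; its generator is
  the matrix E_ji - E_ij, i.e. the basis element X_ij of so(D) (zero if i = j).\<close>
definition rot :: "'n \<Rightarrow> 'n \<Rightarrow> real \<Rightarrow> real^'n^'n" where
  "rot i j t = (\<chi> a b.
     if i = j then (if a = b then 1 else 0)
     else if (a = i \<and> b = i) \<or> (a = j \<and> b = j) then cos t
     else if a = i \<and> b = j then - sin t
     else if a = j \<and> b = i then sin t
     else if a = b then 1 else 0)"

definition lie_act :: "(real^'n^'n \<Rightarrow> complex^'m^'m) \<Rightarrow> 'n \<Rightarrow> 'n \<Rightarrow> complex^'m^'m" where
  "lie_act \<rho> i j = vector_derivative (\<lambda>t. \<rho> (rot i j t)) (at 0)"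

text \<open>Simple: the total antisymmetrization X_[ij X_kl] acts as zero (up to the factor 1/24).\<close>
definition simple_rep :: "(real^'n^'n \<Rightarrow> complex^'m^'m) \<Rightarrow> bool" where
  "simple_rep \<rho> \<longleftrightarrow> (\<forall>i j k l :: 'n.
     let idx = (\<lambda>n::nat. [i, j, k, l] ! n) in
     (\<Sum>p\<in>{p. p permutes {0..<4::nat}}.
        of_int (sign p) *\<^sub>R (lie_act \<rho> (idx (p 0)) (idx (p 1)) ** lie_act \<rho> (idx (p 2)) (idx (p 3))))
     = 0)"

definition monomial :: "('n \<Rightarrow> nat) \<Rightarrow> real^'n \<Rightarrow> complex" where
  "monomial \<alpha> x = (\<Prod>i\<in>UNIV. complex_of_real (x $ i) ^ \<alpha> i)"

definition pdiff :: "'n \<Rightarrow> (real^'n \<Rightarrow> complex) \<Rightarrow> real^'n \<Rightarrow> complex" where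
  "pdiff i f x = vector_derivative (\<lambda>t. f (x + t *\<^sub>R axis i 1)) (at 0)"

definition laplacian :: "(real^'n \<Rightarrow> complex) \<Rightarrow> real^'n \<Rightarrow> complex" where
  "laplacian f x = (\<Sum>i\<in>UNIV. pdiff i (pdiff i f) x)"

definition harmonic_hom :: "nat \<Rightarrow> (real^'n \<Rightarrow> complex) set" where
  "harmonic_hom N = {f. (\<exists>c :: ('n \<Rightarrow> nat) \<Rightarrow> complex.
       f = (\<lambda>x. \<Sum>\<alpha>\<in>{\<alpha>. sum \<alpha> UNIV = N}. c \<alpha> * monomial \<alpha> x))
     \<and> (\<forall>x. laplacian f x = 0)}"

definition equiv_harmonic :: "(real^'n^'n \<Rightarrow> complex^'m^'m) \<Rightarrow> nat \<Rightarrow> bool" where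
  "equiv_harmonic \<rho> N \<longleftrightarrow> (\<exists>T :: complex^'m \<Rightarrow> (real^'n \<Rightarrow> complex).
      inj T \<and> range T = harmonic_hom N
      \<and> (\<forall>u v. T (u + v) = (\<lambda>x. T u x + T v x))
      \<and> (\<forall>a u. T (a *s u) = (\<lambda>x. a * T u x))
      \<and> (\<forall>g\<in>SO. \<forall>u. T (\<rho> g *v u) = (\<lambda>x. T u (matrix_inv g *v x))))"

end

theory Submission
  imports Defs "HOL-Library.Function_Algebras"
    "HOL-Computational_Algebra.Fundamental_Theorem_Algebra"
begin

text \<open>
  Fix two axes \<open>a\<close>, \<open>b\<close> and let \<open>E = - \<i> X\<^sub>a\<^sub>b\<close>; then \<open>X\<^sub>a\<^sub>k \<plusminus> \<i> X\<^sub>b\<^sub>k\<close>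
  lower and raise the eigenvalues of \<open>E\<close> by one.  If \<open>v\<close> is an eigenvector of \<open>E\<close> killed by all lowering
  operators, then simplicity forces \<open>X\<^sub>k\<^sub>l v = 0\<close> for \<open>k, l\<close> outside \<open>{a, b}\<close>,
  and the eigenvalue is an integer \<open>- N \<le> 0\<close> because the rotation by \<open>2\<pi>\<close> is trivial.
  The polynomial \<open>z\<^sup>N\<close>, \<open>z = x\<^sub>a + \<i> x\<^sub>b\<close>, behaves in the same way, and up to scalars it is
  the only lowest vector in any invariant subspace of the harmonic polynomials of degree \<open>N\<close>.  The submodule
  generated by \<open>(v, z\<^sup>N)\<close> meets its lowest weight space in multiples of this vector only,
  so it is the graph of an isomorphism.

  Conversely, the antisymmetrized product of two operators \<open>x\<^sub>i \<partial>\<^sub>j - x\<^sub>j \<partial>\<^sub>i\<close> vanishes because coordinates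
  commute with each other and so do partial derivatives.
\<close>

section \<open>Eigenvectors in complex vector spaces\<close>

text \<open>\<open>\<rho>\<close> is only assumed continuous and multiplicative, so the passage
  between group and Lie algebra has to be built in both directions: differentiability and brackets
  going down; generation of \<open>SO\<close> by plane rotations and uniqueness for linear
  differential equations going up. No root system enters. A single plane supplies one weight
  operator \<open>E\<close>, and the lowest weight space is in general a representation of the so(D
  - 2) formed by the X_kl outside the plane. Simplicity, applied to the indices a, b, k, l and a
  lowest vector of weight -n with n \<ge> 0, gives (n + 1) X_kl v = 0, which makes this so(D - 2)
  act as zero on such vectors. A map prescribed on iterated raisings of \<open>v\<close> would have
  to be shown compatible with all relations among them; for a subspace of the direct sum it is
  enough to determine two kernels and two images.\<close>

lemma (in vector_space) nontrivial_relation: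
  fixes f :: "nat \<Rightarrow> 'b"
  assumes "finite F" "range f \<subseteq> span F"
  shows "\<exists>c. (\<exists>n\<le>card F. c n \<noteq> 0) \<and> (\<Sum>n\<le>card F. scale (c n) (f n)) = 0"
\<comment> \<open>Linear dependence is a property of sets, the claim concerns a family: a repetition
  is a relation by itself, and otherwise \<open>card F + 1\<close> distinct vectors lie in the span
  of \<open>F\<close>.\<close>
proof (cases "inj_on f {..card F}")
  case True
  have "dependent (f ` {..card F})"
  proof (rule ccontr)
    assume "independent (f ` {..card F})"
    then have "card (f ` {..card F}) \<le> card F"
      using independent_span_bound[OF assms(1)] assms(2) by blast
    then show False using card_image[OF True] by simp
  qed
  then obtain u where u: "\<exists>v\<in>f ` {..card F}. u v \<noteq> 0" "(\<Sum>v\<in>f ` {..card F}. scale (u v) v) = 0"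
    using dependent_finite[of "f ` {..card F}"] by auto
  then show ?thesis
    by (intro exI[of _ "u \<circ> f"]) (auto simp: sum.reindex[OF True])
next
  case False
  then obtain i j where ij: "i \<le> card F" "j \<le> card F" "i \<noteq> j" "f i = f j"
    by (auto simp: inj_on_def)
  let ?c = "\<lambda>n. if n = i then 1 else if n = j then -1 else 0"
  have "(\<Sum>n\<le>card F. scale (?c n) (f n)) = (\<Sum>n\<in>{i,j}. scale (?c n) (f n))"
    by (rule sum.mono_neutral_right) (use ij in auto)
  also have "\<dots> = 0" using ij by simp
  finally show ?thesis using ij by (intro exI[of _ ?c]) auto
qed

locale linear_op = vector_space scale
  for scale :: "complex \<Rightarrow> 'v::ab_group_add \<Rightarrow> 'v" +
  fixes E :: "'v \<Rightarrow> 'v"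
  assumes E_add: "E (u + v) = E u + E v"
    and E_scale: "E (scale c u) = scale c (E u)"
begin

lemma E_zero [simp]: "E 0 = 0"
  using E_scale[of 0 0] by simp

lemma E_diff: "E (u - v) = E u - E v"
  using E_add[of "u - v" v] by (simp add: algebra_simps)

lemma E_sum: "E (sum f A) = (\<Sum>x\<in>A. E (f x))"
  by (induction A rule: infinite_finite_induct) (auto simp: E_add)

lemma eigenvectors_independent:
  assumes "finite S" "\<And>n. n \<in> S \<Longrightarrow> E (w n) = scale (ev n) (w n)" "inj_on ev S"
    and "(\<Sum>n\<in>S. w n) = 0" and "n \<in> S"
  shows "w n = 0"
  using assms
proof (induction S arbitrary: w n rule: finite_induct)
  case (insert m S)
  define w' where "w' = (\<lambda>k. scale (ev k - ev m) (w k))"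
  have s0: "w m + (\<Sum>k\<in>S. w k) = 0" using insert by simp
  have "E (w m + (\<Sum>k\<in>S. w k)) - scale (ev m) (w m + (\<Sum>k\<in>S. w k)) = 0"
    unfolding s0 by simp
  moreover have "E (w m + (\<Sum>k\<in>S. w k)) = scale (ev m) (w m) + (\<Sum>k\<in>S. scale (ev k) (w k))"
    using insert.prems(1) by (simp add: E_add E_sum)
  ultimately have "(\<Sum>k\<in>S. w' k) = 0"
    by (simp add: w'_def scale_right_distrib scale_sum_right scale_left_diff_distrib sum_subtractf)
  have z: "w k = 0" if "k \<in> S" for k
  proof -
    have "w' k = 0"
      by (rule insert.IH[OF _ _ \<open>(\<Sum>k\<in>S. w' k) = 0\<close> that])
         (use insert.prems(1,2) in \<open>auto simp: w'_def E_scale mult.commute inj_on_def\<close>)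
    moreover have "ev k \<noteq> ev m" using insert.prems(2) insert.hyps(2) that by (auto simp: inj_on_def)
    ultimately show ?thesis by (simp add: w'_def)
  qed
  then have "w m = 0" using s0 by simp
  then show ?case using z insert.prems(4) by auto
qed simp

text \<open>Stops both processes used later: an endless descent of eigenvalues and an endless
  raising string would give infinitely many eigenvalues in finite dimension.\<close>

lemma no_infinite_spectrum:
  fixes w :: "nat \<Rightarrow> 'v"
  assumes "finite F" "range w \<subseteq> span F" "\<And>n. E (w n) = scale (ev n) (w n)" "inj ev"
  shows "\<exists>n. w n = 0"
proof -
  obtain c n where c: "n \<le> card F" "c n \<noteq> 0" "(\<Sum>n\<le>card F. scale (c n) (w n)) = 0"
    using nontrivial_relation[OF assms(1,2)] by blast
  have "scale (c n) (w n) = 0"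
    by (rule eigenvectors_independent[where ev = ev, OF _ _ _ c(3)])
       (use c assms(3) inj_on_subset[OF assms(4)] in \<open>auto simp: E_scale mult.commute\<close>)
  then show ?thesis using c by auto
qed

definition poly_op :: "complex poly \<Rightarrow> 'v \<Rightarrow> 'v" where
  "poly_op p u = (\<Sum>n\<le>degree p. scale (coeff p n) ((E ^^ n) u))"

lemma poly_op_eq:
  assumes "degree p \<le> d"
  shows "poly_op p u = (\<Sum>n\<le>d. scale (coeff p n) ((E ^^ n) u))"
  unfolding poly_op_def
  by (rule sum.mono_neutral_left) (use assms in \<open>auto simp: coeff_eq_0\<close>)

lemma poly_op_linear_factor:
  "poly_op ([:-r, 1:] * q) u = E (poly_op q u) - scale r (poly_op q u)"
proof -
  let ?d = "degree q"
  have d: "degree ([:-r, 1:] * q) \<le> Suc ?d"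
    using degree_mult_le[of "[:-r, 1:]" q] by simp
  have c: "coeff ([:-r, 1:] * q) n = (case n of 0 \<Rightarrow> 0 | Suc k \<Rightarrow> coeff q k) - r * coeff q n" for n
    by (simp add: coeff_pCons split: nat.split)
  have "poly_op ([:-r, 1:] * q) u
      = (\<Sum>n\<le>Suc ?d. scale (case n of 0 \<Rightarrow> 0 | Suc k \<Rightarrow> coeff q k) ((E ^^ n) u))
        - (\<Sum>n\<le>Suc ?d. scale (r * coeff q n) ((E ^^ n) u))"
    unfolding poly_op_eq[OF d] c by (simp only: scale_left_diff_distrib sum_subtractf)
  also have "(\<Sum>n\<le>Suc ?d. scale (case n of 0 \<Rightarrow> 0 | Suc k \<Rightarrow> coeff q k) ((E ^^ n) u)) = E (poly_op q u)"
    by (subst sum.atMost_Suc_shift) (simp add: poly_op_def E_sum E_scale)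
  also have "(\<Sum>n\<le>Suc ?d. scale (r * coeff q n) ((E ^^ n) u)) = scale r (poly_op q u)"
    unfolding poly_op_eq[OF le_SucI[OF order_refl]] by (simp only: scale_sum_right scale_scale)
  finally show ?thesis .
qed

lemma poly_op_in:
  assumes "subspace W" "\<And>v. v \<in> W \<Longrightarrow> E v \<in> W" "u \<in> W"
  shows "poly_op p u \<in> W"
proof -
  have "(E ^^ n) u \<in> W" for n
    by (induction n) (use assms in auto)
  then show ?thesis
    unfolding poly_op_def using assms(1) by (intro subspace_sum subspace_scale) auto
qed

text \<open>With p = (x - r) q, the vector q(E) u is either an eigenvector for r or zero; in the
  latter case q annihilates \<open>u\<close> and has smaller degree.\<close>

lemma eigenvector_of_poly:
  assumes "subspace W" "\<And>v. v \<in> W \<Longrightarrow> E v \<in> W" "u \<in> W" "u \<noteq> 0" "p \<noteq> 0" "poly_op p u = 0"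
  shows "\<exists>v\<in>W. v \<noteq> 0 \<and> (\<exists>r. E v = scale r v)"
  using assms(5,6)
proof (induction "degree p" arbitrary: p rule: less_induct)
  case less
  show ?case
  proof (cases "degree p = 0")
    case True
    then have "scale (coeff p 0) u = 0" "coeff p 0 \<noteq> 0"
      using less.prems leading_coeff_neq_0[of p] by (auto simp: poly_op_def)
    then show ?thesis using assms(4) by simp
  next
    case False
    then have "\<exists>r. poly p r = 0"
      by (intro fundamental_theorem_of_algebra) (simp add: constant_degree)
    then obtain r where "poly p r = 0" ..
    then obtain q where q: "p = [:-r, 1:] * q"
      unfolding poly_eq_0_iff_dvd by blast
    with less.prems have "q \<noteq> 0" by auto
    then have deg: "degree q < degree p"
      unfolding q by (subst degree_mult_eq) auto
    show ?thesis
    proof (cases "poly_op q u = 0")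
      case True
      then show ?thesis using less.hyps[OF deg \<open>q \<noteq> 0\<close>] by blast
    next
      case nz: False
      have "E (poly_op q u) = scale r (poly_op q u)"
        using less.prems(2) unfolding q poly_op_linear_factor by simp
      then show ?thesis using nz poly_op_in[OF assms(1-3)] by blast
    qed
  qed
qed

text \<open>The space of coefficient functions is infinite-dimensional, so finiteness is expressed
  by a finite spanning set for \<open>W\<close>. It makes the vectors u, E u, E (E u), ...
  dependent, which yields an annihilating polynomial.\<close>

lemma eigenvector_exists:
  assumes W: "subspace W" "\<And>v. v \<in> W \<Longrightarrow> E v \<in> W" and "W \<noteq> {0}"
    and F: "finite F" "W \<subseteq> span F"
  shows "\<exists>v\<in>W. v \<noteq> 0 \<and> (\<exists>r. E v = scale r v)"
proof -
  obtain u where u: "u \<in> W" "u \<noteq> 0"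
    using \<open>W \<noteq> {0}\<close> subspace_0[OF W(1)] by blast
  have "(E ^^ n) u \<in> W" for n
    by (induction n) (use W u in auto)
  then obtain c m where c: "m \<le> card F" "c m \<noteq> 0" "(\<Sum>n\<le>card F. scale (c n) ((E ^^ n) u)) = 0"
    using nontrivial_relation[OF F(1), of "\<lambda>n. (E ^^ n) u"] F(2) by blast
  define p where "p = (\<Sum>n\<le>card F. monom (c n) n)"
  have cf: "coeff p n = (if n \<le> card F then c n else 0)" for n
    by (simp add: p_def coeff_sum sum.If_cases)
  have "degree p \<le> card F" by (rule degree_le) (simp add: cf)
  then have "poly_op p u = 0" using c(3) by (simp add: poly_op_eq cf)
  moreover have "p \<noteq> 0" using c(1,2) cf[of m] by auto
  ultimately show ?thesis using eigenvector_of_poly[OF W u] by blast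
qed

end

section \<open>Lowest weight vectors and the submodules they generate\<close>

text \<open>Serves three actions: the representation, the coefficient functions and their direct
  sum. With antisymmetry in the indices, the two bracket rules determine all brackets.\<close>

locale so_action = vector_space scale
  for scale :: "complex \<Rightarrow> 'v::ab_group_add \<Rightarrow> 'v" +
  fixes X :: "'n \<Rightarrow> 'n \<Rightarrow> 'v \<Rightarrow> 'v"
  assumes X_add: "X i j (u + v) = X i j u + X i j v"
    and X_scale: "X i j (scale c u) = scale c (X i j u)"
    and X_swap: "X j i u = - X i j u"
    and X_bracket: "distinct [i, j, k] \<Longrightarrow> X i j (X i k u) = X i k (X i j u) + X j k u"
    and X_commute: "distinct [i, j, k, l] \<Longrightarrow> X i j (X k l u) = X k l (X i j u)"
begin

lemma X_zero [simp]: "X i j 0 = 0"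
  using X_scale[of i j 0 0] by simp

lemma X_diff: "X i j (u - v) = X i j u - X i j v"
  using X_add[of i j "u - v" v] by (simp add: algebra_simps)

lemma X_minus: "X i j (- u) = - X i j u"
  using X_diff[of i j 0 u] by simp

lemma X_diag [simp]: "X i i u = 0"
proof -
  have "X i i u + X i i u = 0" using X_swap[of i i u] by (simp add: eq_neg_iff_add_eq_0)
  then have "scale 2 (X i i u) = 0" by (metis one_add_one scale_left_distrib scale_one)
  then show ?thesis by simp
qed

definition invariant :: "'v set \<Rightarrow> bool" where
  "invariant W \<longleftrightarrow> subspace W \<and> (\<forall>i j. \<forall>v\<in>W. X i j v \<in> W)"

end

locale so_plane = so_action +
  fixes a b :: 'b
  assumes ab: "a \<noteq> b"
begin

definition E :: "'a \<Rightarrow> 'a" where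
  "E u = scale (- \<i>) (X a b u)"

definition lower :: "'b \<Rightarrow> 'a \<Rightarrow> 'a" where
  "lower k u = X a k u + scale \<i> (X b k u)"

definition raise :: "'b \<Rightarrow> 'a \<Rightarrow> 'a" where
  "raise k u = X a k u - scale \<i> (X b k u)"

lemmas X_linear = X_add X_scale X_diff X_minus
lemmas scale_simps = scale_right_distrib scale_right_diff_distrib scale_left_distrib scale_left_diff_distrib

sublocale linear_op scale E
  by unfold_locales (auto simp: E_def X_linear scale_simps mult.commute)

lemma lower_add: "lower k (u + v) = lower k u + lower k v"
  and raise_add: "raise k (u + v) = raise k u + raise k v"
  and lower_scale: "lower k (scale c u) = scale c (lower k u)"
  and raise_scale: "raise k (scale c u) = scale c (raise k u)"
  by (auto simp: lower_def raise_def X_linear scale_simps mult.commute)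

lemma X_ab: "X a b u = scale \<i> (E u)"
  by (simp add: E_def)

lemma bracket_ab:
  assumes "k \<noteq> a" "k \<noteq> b"
  shows "X a b (X a k u) = X a k (X a b u) + X b k u"
    and "X a b (X b k u) = X b k (X a b u) - X a k u"
    and "X a k (X b k u) = X b k (X a k u) + X a b u"
proof -
  show "X a b (X a k u) = X a k (X a b u) + X b k u"
    using X_bracket[of a b k u] ab assms by auto
  show "X a b (X b k u) = X b k (X a b u) - X a k u"
    using X_bracket[of b a k u] ab assms X_swap[of b a] by (auto simp: X_linear algebra_simps)
  show "X a k (X b k u) = X b k (X a k u) + X a b u"
    using X_bracket[of k a b u] ab assms X_swap[of k a] X_swap[of k b]
    by (auto simp: X_linear algebra_simps)
qed

lemma bracket_side:
  assumes "k \<notin> {a, b}" "l \<notin> {a, b}" "k \<noteq> l" "c = a \<or> c = b"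
  shows "X c k (X c l u) = X c l (X c k u) + X k l u"
    and "X k l (X c k u) = X c k (X k l u) + X c l u"
    and "X k l (X c l u) = X c l (X k l u) - X c k u"
proof -
  have d: "c \<noteq> k" "c \<noteq> l" using assms by auto
  show "X c k (X c l u) = X c l (X c k u) + X k l u"
    using X_bracket[of c k l u] d assms by auto
  show "X k l (X c k u) = X c k (X k l u) + X c l u"
    using X_bracket[of k l c u] d assms X_swap[of k c] X_swap[of l c]
    by (auto simp: X_linear algebra_simps)
  show "X k l (X c l u) = X c l (X k l u) - X c k u"
    using X_bracket[of l k c u] d assms X_swap[of l c] X_swap[of l k] X_swap[of k c]
    by (auto simp: X_linear algebra_simps)
qed

lemma E_lower: "k \<notin> {a, b} \<Longrightarrow> E (lower k u) = lower k (E u) - lower k u"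
  by (simp add: E_def lower_def X_linear bracket_ab scale_simps algebra_simps)

lemma E_raise: "k \<notin> {a, b} \<Longrightarrow> E (raise k u) = raise k (E u) + raise k u"
  by (simp add: E_def raise_def X_linear bracket_ab scale_simps algebra_simps)

text \<open>Together with the rules for \<open>E\<close>, this makes \<open>lower k\<close>,
  \<open>E\<close> and \<open>raise k\<close> a copy of sl(2) for each k outside the plane.\<close>

lemma lower_raise_same:
  assumes "k \<notin> {a, b}"
  shows "lower k (raise k u) = raise k (lower k u) + scale 2 (E u)"
proof -
  have "scale 2 (E u) = - scale \<i> (X a b u) - scale \<i> (X a b u)"
    unfolding one_add_one[symmetric] scale_left_distrib by (simp add: E_def)
  then show ?thesis using assms
    by (simp add: lower_def raise_def X_linear bracket_ab scale_simps algebra_simps)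
qed

text \<open>For different indices the commutator is a rotation outside the plane. This is why the
  control of iterated raisings below also asks for X_kl v = 0.\<close>

lemma lower_raise: 
  assumes "k \<notin> {a, b}" "l \<notin> {a, b}" "k \<noteq> l"
  shows "lower k (raise l u) = raise l (lower k u) + scale 2 (X k l u)"
proof -
  have "X a k (X b l u) = X b l (X a k u)" "X b k (X a l u) = X a l (X b k u)"
    using assms ab by (auto intro!: X_commute)
  moreover have "scale 2 (X k l u) = X k l u + X k l u"
    by (metis one_add_one scale_left_distrib scale_one)
  moreover have "X a k (X a l u) = X a l (X a k u) + X k l u"
    "X b k (X b l u) = X b l (X b k u) + X k l u"
    using assms by (auto intro!: bracket_side)
  ultimately show ?thesis
    by (simp add: lower_def raise_def X_linear scale_simps algebra_simps)
qed

lemma X_raise: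
  assumes "k \<notin> {a, b}" "l \<notin> {a, b}" "k \<noteq> l" "m \<notin> {a, b}"
  shows "X k l (raise m u) = raise m (X k l u)
    + (if m = k then raise l u else if m = l then - raise k u else 0)"
proof (cases "m = k \<or> m = l")
  case True
  then show ?thesis using assms
    by (auto simp: raise_def X_linear bracket_side scale_simps algebra_simps)
next
  case False
  then have "X k l (X a m u) = X a m (X k l u)" "X k l (X b m u) = X b m (X k l u)"
    using assms by (auto intro!: X_commute)
  then show ?thesis using False by (simp add: raise_def X_linear)
qed

lemma lowest_vector:
  assumes W: "invariant W" "W \<noteq> {0}" and F: "finite F" "W \<subseteq> span F" and k0: "k0 \<notin> {a, b}"
  shows "\<exists>w\<in>W. w \<noteq> 0 \<and> (\<forall>k. k \<notin> {a, b} \<longrightarrow> lower k w = 0)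
    \<and> (\<exists>j::nat. E w = scale (- (of_nat j / 2)) w)"
proof -
  have sub: "subspace W" and X_in: "\<And>i j v. v \<in> W \<Longrightarrow> X i j v \<in> W"
    using W unfolding invariant_def by auto
  have E_in: "E v \<in> W" if "v \<in> W" for v
    unfolding E_def using sub X_in that by (simp add: subspace_neg subspace_scale)
  have lower_in: "lower k v \<in> W" and raise_in: "raise k v \<in> W" if "v \<in> W" for k v
    unfolding lower_def raise_def
    by (auto intro!: subspace_add subspace_diff subspace_scale sub X_in that)
  define R where "R = {r. \<exists>v\<in>W. v \<noteq> 0 \<and> E v = scale r v}"
  obtain r0 where "r0 \<in> R"
    unfolding R_def using eigenvector_exists[OF sub E_in W(2) F] by blast
  \<comment> \<open>Otherwise r0, r0 - 1, r0 - 2, ... would all be eigenvalues. Where r - 1 is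
    missing, every lowering operator kills the eigenvectors for r.\<close>
  have "\<exists>r\<in>R. r - 1 \<notin> R"
  proof (rule ccontr)
    assume "\<not> (\<exists>r\<in>R. r - 1 \<notin> R)"
    then have step: "r \<in> R \<Longrightarrow> r - 1 \<in> R" for r by blast
    have "r0 - of_nat n \<in> R" for n
    proof (induction n)
      case (Suc n)
      then show ?case using step[of "r0 - of_nat n"] by (simp add: algebra_simps)
    qed (use \<open>r0 \<in> R\<close> in simp)
    then have "\<forall>n. \<exists>v. v \<in> W \<and> v \<noteq> 0 \<and> E v = scale (r0 - of_nat n) v"
      unfolding R_def by blast
    then obtain w where w: "\<And>n. w n \<in> W" "\<And>n. w n \<noteq> 0" "\<And>n::nat. E (w n) = scale (r0 - of_nat n) (w n)"
      by metis
    have "\<exists>n. w n = 0"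
      by (rule no_infinite_spectrum[OF F(1) _ w(3)]) (use w F in \<open>auto simp: inj_def\<close>)
    then show False using w(2) by auto
  qed
  then obtain r where r: "r \<in> R" "r - 1 \<notin> R" by blast
  then obtain w where w: "w \<in> W" "w \<noteq> 0" "E w = scale r w" unfolding R_def by blast
  have low: "lower k w = 0" if "k \<notin> {a, b}" for k
  proof (rule ccontr)
    assume "lower k w \<noteq> 0"
    moreover have "E (lower k w) = scale (r - 1) (lower k w)"
      using that w(3) by (simp add: E_lower lower_scale scale_simps)
    ultimately show False using r(2) lower_in[OF w(1)] unfolding R_def by blast
  qed
  define y where "y n = (raise k0 ^^ n) w" for n
  have y_in: "y n \<in> W" for n
    unfolding y_def by (induction n) (use w raise_in in auto)
  have yE: "E (y n) = scale (r + of_nat n) (y n)" for n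
    by (induction n) (use k0 w in \<open>auto simp: y_def E_raise raise_scale raise_add scale_simps algebra_simps\<close>)
  have "\<exists>n. y n = 0"
    by (rule no_infinite_spectrum[OF F(1) _ yE]) (use y_in F in \<open>auto simp: inj_def\<close>)
  then have n0: "y (LEAST n. y n = 0) = 0" by (rule LeastI_ex)
  moreover have "y 0 \<noteq> 0" using w by (simp add: y_def)
  ultimately obtain j where j: "(LEAST n. y n = 0) = Suc j" by (metis not0_implies_Suc)
  then have yj: "y j \<noteq> 0" "y (Suc j) = 0"
    using n0 not_less_Least[of j "\<lambda>n. y n = 0"] by auto
  \<comment> \<open>The coefficient (n + 1)(2 r + n) is the sum of 2 (r + i) over i \<le> n,
    collected while \<open>lower k0\<close> passes the raisings.\<close>
  have chain: "lower k0 (y (Suc n)) = scale (of_nat (Suc n) * (2 * r + of_nat n)) (y n)" for n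
  proof (induction n)
    case 0
    have "raise k0 0 = 0" by (simp add: raise_def)
    then show ?case using k0 w low by (simp add: y_def lower_raise_same)
  next
    case (Suc n)
    have "lower k0 (y (Suc (Suc n))) = lower k0 (raise k0 (y (Suc n)))" by (simp add: y_def)
    also have "\<dots> = raise k0 (lower k0 (y (Suc n))) + scale 2 (E (y (Suc n)))"
      using k0 by (rule lower_raise_same)
    also have "raise k0 (lower k0 (y (Suc n))) = scale (of_nat (Suc n) * (2 * r + of_nat n)) (y (Suc n))"
      unfolding Suc by (simp add: y_def raise_scale)
    also have "\<dots> + scale 2 (E (y (Suc n)))
        = scale (of_nat (Suc n) * (2 * r + of_nat n) + 2 * (r + of_nat (Suc n))) (y (Suc n))"
      unfolding yE by (simp add: scale_left_distrib scale_right_distrib)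
    also have "of_nat (Suc n) * (2 * r + of_nat n) + 2 * (r + of_nat (Suc n))
        = of_nat (Suc (Suc n)) * (2 * r + of_nat (Suc n))" by (simp add: algebra_simps)
    finally show ?case .
  qed
  \<comment> \<open>At the top of the string the next vector is zero but \<open>y j\<close> is not.
    The Lie algebra alone gives half-integers; odd \<open>j\<close> will be excluded by the
    group.\<close>
  have "of_nat (Suc j) * (2 * r + of_nat j) = 0"
    using chain[of j] yj by (simp add: lower_def del: of_nat_Suc)
  then have "2 * r + of_nat j = 0" by (simp del: of_nat_Suc)
  then have "r = - (of_nat j / 2)" by (simp add: field_simps add_eq_0_iff)
  then show ?thesis using w low by blast
qed

text \<open>Grading by the number of raisings. Taking spans at each level means that no ordering of
  the raising operators has to be chosen.\<close>

fun layer :: "'a \<Rightarrow> nat \<Rightarrow> 'a set" where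
  "layer v 0 = span {v}"
| "layer v (Suc r) = span (\<Union>k\<in>- {a, b}. raise k ` layer v r)"

text \<open>Built from raisings alone; for a lowest weight vector killed by all X_kl it turns out to
  be the full submodule generated by \<open>v\<close>.\<close>

definition generated :: "'a \<Rightarrow> 'a set" where
  "generated v = span (\<Union>r. layer v r)"

lemma subspace_layer: "subspace (layer v r)"
  by (cases r) auto

lemma span_image_subset:
  assumes "\<And>u v. f (u + v) = f u + f v" "\<And>c u. f (scale c u) = scale c (f u)"
    and "subspace T" "\<And>s. s \<in> S \<Longrightarrow> f s \<in> T" "s \<in> span S"
  shows "f s \<in> T"
  using assms(5)
proof (induction rule: span_induct_alt)
  case base
  have "f 0 = 0" using assms(2)[of 0 0] by simp
  then show ?case using assms(3) by (simp add: subspace_0)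
next
  case (step c x y)
  then show ?case using assms(1-4) by (simp add: subspace_add subspace_scale)
qed

context
  fixes v :: 'a and N :: complex
  assumes low: "\<And>k. k \<notin> {a, b} \<Longrightarrow> lower k v = 0"
    and side: "\<And>k l. k \<notin> {a, b} \<Longrightarrow> l \<notin> {a, b} \<Longrightarrow> X k l v = 0"
    and weight: "E v = scale (- N) v"
begin

lemma raise_layer: "k \<notin> {a, b} \<Longrightarrow> s \<in> layer v r \<Longrightarrow> raise k s \<in> layer v (Suc r)"
  by (auto intro: span_base)

lemma E_layer: "s \<in> layer v r \<Longrightarrow> E s = scale (of_nat r - N) s"
proof (induction r arbitrary: s)
  case 0
  then show ?case using weight by (auto simp: span_singleton E_scale mult.commute)
next
  case (Suc r)
  have "E s - scale (of_nat (Suc r) - N) s \<in> {0}"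
  proof (rule span_image_subset[OF _ _ _ _ Suc.prems[unfolded layer.simps]])
    fix s' assume "s' \<in> (\<Union>m\<in>- {a, b}. raise m ` layer v r)"
    then obtain m s where m: "m \<notin> {a, b}" "s \<in> layer v r" "s' = raise m s" by blast
    have "E s' = scale (of_nat r - N) s' + s'"
      unfolding m(3) E_raise[OF m(1)] Suc.IH[OF m(2)] raise_scale ..
    then show "E s' - scale (of_nat (Suc r) - N) s' \<in> {0}"
      by (simp add: scale_simps algebra_simps)
  qed (auto simp: E_add E_scale scale_simps algebra_simps)
  then show ?case by simp
qed

lemma X_layer:
  assumes "k \<notin> {a, b}" "l \<notin> {a, b}" "s \<in> layer v r"
  shows "X k l s \<in> layer v r"
  using assms(3)
proof (induction r arbitrary: s)
  case 0
  then show ?case using side assms by (auto simp: span_singleton X_scale)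
next
  case (Suc r)
  show ?case
  proof (cases "k = l")
    case True
    then show ?thesis using subspace_0[OF subspace_layer[of v "Suc r"]] by (simp del: layer.simps)
  next
    case False
    show ?thesis
    proof (rule span_image_subset[OF X_add X_scale subspace_layer _ Suc.prems[unfolded layer.simps]])
      fix s' assume "s' \<in> (\<Union>m\<in>- {a, b}. raise m ` layer v r)"
      then obtain m s where m: "m \<notin> {a, b}" "s \<in> layer v r" "s' = raise m s" by blast
      have "raise m (X k l s) \<in> layer v (Suc r)" "raise k s \<in> layer v (Suc r)" "raise l s \<in> layer v (Suc r)"
        using raise_layer m assms Suc.IH by blast+
      then show "X k l s' \<in> layer v (Suc r)"
        using subspace_layer unfolding m(3) X_raise[OF assms(1,2) False m(1)]
        by (intro subspace_add) (auto simp: subspace_neg subspace_0 simp del: layer.simps)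
    qed
  qed
qed

text \<open>Commute the lowering operator past the last raising: the commutator is 2 E or 2 X_km,
  and both preserve the layer reached before that raising. Nothing lies below layer 0, hence the
  value {0}.\<close>

lemma lower_layer:
  assumes "k \<notin> {a, b}" "s \<in> layer v r"
  shows "lower k s \<in> (case r of 0 \<Rightarrow> {0} | Suc q \<Rightarrow> layer v q)"
  using assms(2)
proof (induction r arbitrary: s)
  case 0
  then show ?case using low assms by (auto simp: span_singleton lower_scale)
next
  case (Suc r)
  have "lower k s \<in> layer v r"
  proof (rule span_image_subset[OF lower_add lower_scale subspace_layer _ Suc.prems[unfolded layer.simps]])
    fix s' assume "s' \<in> (\<Union>m\<in>- {a, b}. raise m ` layer v r)"
    then obtain m s where m: "m \<notin> {a, b}" "s \<in> layer v r" "s' = raise m s" by blast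
    have 1: "raise m (lower k s) \<in> layer v r"
    proof (cases r)
      case 0
      then have "lower k s = 0" using Suc.IH[OF m(2)] by simp
      then show ?thesis using subspace_0[OF subspace_layer] raise_scale[of m 0 0] by simp
    next
      case (Suc q)
      then show ?thesis using Suc.IH[OF m(2)] raise_layer[OF m(1)] by simp
    qed
    have 2: "scale 2 (if k = m then E s else X k m s) \<in> layer v r"
      using X_layer[OF assms(1) m(1,2)] E_layer[OF m(2)] m(2) subspace_layer
      by (auto simp: subspace_scale)
    show "lower k s' \<in> layer v r"
      using subspace_add[OF subspace_layer 1 2] lower_raise_same[OF assms(1)]
        lower_raise[OF assms(1) m(1)] unfolding m(3) by (cases "k = m") auto
  qed
  then show ?case by simp
qed

lemma layer_subset_generated: "layer v r \<subseteq> generated v"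
  unfolding generated_def by (rule order_trans[OF UN_upper[OF UNIV_I] span_superset])

lemma subspace_generated: "subspace (generated v)"
  by (simp add: generated_def)

lemma generated_closed:
  assumes "\<And>u v. f (u + v) = f u + f v" "\<And>c u. f (scale c u) = scale c (f u)"
    and "\<And>r s. s \<in> layer v r \<Longrightarrow> f s \<in> generated v" "u \<in> generated v"
  shows "f u \<in> generated v"
  by (rule span_image_subset[OF assms(1,2) subspace_generated _ assms(4)[unfolded generated_def]])
     (use assms(3) in auto)

text \<open>\<open>E\<close>, the X_kl outside the plane and the raising and lowering operators span
  the Lie algebra, so closure under these is enough.\<close>

lemma invariant_generated: "invariant (generated v)"
proof -
  have E: "E u \<in> generated v" if "u \<in> generated v" for u
    by (rule generated_closed[OF E_add E_scale _ that])
       (use layer_subset_generated in \<open>auto simp: E_layer intro!: subspace_scale[OF subspace_generated]\<close>)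
  have side': "X k l u \<in> generated v" if "k \<notin> {a, b}" "l \<notin> {a, b}" "u \<in> generated v" for k l u
    by (rule generated_closed[OF X_add X_scale _ that(3)])
       (use X_layer[OF that(1,2)] layer_subset_generated in auto)
  have up: "raise k u \<in> generated v" if "k \<notin> {a, b}" "u \<in> generated v" for k u
    by (rule generated_closed[OF raise_add raise_scale _ that(2)])
       (use raise_layer[OF that(1)] layer_subset_generated in blast)
  have down: "lower k u \<in> generated v" if "k \<notin> {a, b}" "u \<in> generated v" for k u
  proof (rule generated_closed[OF lower_add lower_scale _ that(2)])
    fix r s assume "s \<in> layer v r"
    then show "lower k s \<in> generated v"
      using lower_layer[OF that(1)] layer_subset_generated subspace_0[OF subspace_generated]
      by (cases r) fastforce+
  qed
  have ab': "X a b u \<in> generated v" if "u \<in> generated v" for u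
    unfolding X_ab using E[OF that] subspace_generated by (simp add: subspace_scale)
  have ak: "X a k u \<in> generated v" if "k \<notin> {a, b}" "u \<in> generated v" for k u
  proof -
    have "X a k u = scale (1/2) (lower k u + raise k u)"
      using scale_left_distrib[of "1/2" "1/2" "X a k u"]
      by (simp add: lower_def raise_def scale_right_distrib)
    then show ?thesis using up down that subspace_generated
      by (simp add: subspace_scale subspace_add)
  qed
  have bk: "X b k u \<in> generated v" if "k \<notin> {a, b}" "u \<in> generated v" for k u
  proof -
    have "X b k u = scale (- \<i>) (lower k u - X a k u)"
      by (simp add: lower_def)
    then show ?thesis using down ak that subspace_generated
      by (metis subspace_scale subspace_diff)
  qed
  have neg: "X j i u \<in> generated v" if "X i j u \<in> generated v" for i j u
    using that X_swap[of j i u] subspace_generated by (simp add: subspace_neg)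
  have "X i j u \<in> generated v" if "u \<in> generated v" for i j u
  proof -
    consider "i = j" | "i = a" "j = b" | "i = b" "j = a" | "i = a" "j \<notin> {a, b}" | "i = b" "j \<notin> {a, b}"
      | "j = a" "i \<notin> {a, b}" | "j = b" "i \<notin> {a, b}" | "i \<notin> {a, b}" "j \<notin> {a, b}" by blast
    then show ?thesis
    proof cases
      case 1
      then show ?thesis using subspace_0[OF subspace_generated] by simp
    qed (simp_all add: that ab' ak bk side' neg[OF ab'] neg[OF ak] neg[OF bk])
  qed
  then show ?thesis using subspace_generated by (simp add: invariant_def)
qed

text \<open>Summands are collected into one per layer, so that their eigenvalues under
  \<open>E\<close> are distinct.\<close>

lemma generated_decomp:
  assumes "u \<in> generated v"
  shows "\<exists>S s. finite S \<and> (\<forall>r. s r \<in> layer v r) \<and> (\<forall>r. r \<notin> S \<longrightarrow> s r = 0) \<and> u = (\<Sum>r\<in>S. s r)"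
  using assms[unfolded generated_def]
proof (induction rule: span_induct_alt)
  case base
  show ?case
    by (rule exI[of _ "{}"], rule exI[of _ "\<lambda>_. 0"]) (simp add: subspace_0[OF subspace_layer])
next
  case (step c x y)
  then obtain q S s where q: "x \<in> layer v q"
    and s: "finite S" "\<forall>r. s r \<in> layer v r" "\<forall>r. r \<notin> S \<longrightarrow> s r = 0" "y = (\<Sum>r\<in>S. s r)" by blast
  let ?s = "s(q := scale c x + s q)"
  have "(\<Sum>r\<in>insert q S. ?s r) = ?s q + (\<Sum>r\<in>S - {q}. ?s r)"
    using s(1) by (simp add: sum.insert_remove)
  also have "(\<Sum>r\<in>S - {q}. ?s r) = (\<Sum>r\<in>S - {q}. s r)" by (rule sum.cong) auto
  also have "?s q + \<dots> = scale c x + y"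
    using s by (cases "q \<in> S") (auto simp: sum.remove[of S q] add.assoc)
  finally have "scale c x + y = (\<Sum>r\<in>insert q S. ?s r)" by simp
  moreover have "\<forall>r. ?s r \<in> layer v r"
    using s(2) q by (auto intro!: subspace_add[OF subspace_layer] subspace_scale[OF subspace_layer])
  ultimately show ?case using s(1,3)
    by (intro exI[of _ "insert q S"] exI[of _ ?s]) auto
qed

lemma generated_lowest:
  assumes "u \<in> generated v" "E u = scale (- N) u"
  shows "\<exists>c. u = scale c v"
proof -
  obtain S s where s: "finite S" "\<And>r. s r \<in> layer v r" "\<And>r. r \<notin> S \<Longrightarrow> s r = 0" "u = (\<Sum>r\<in>S. s r)"
    using generated_decomp[OF assms(1)] by blast
  \<comment> \<open>Moving \<open>u\<close> into component 0 gives a vanishing sum of eigenvectors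
    with distinct eigenvalues r - N. Component 0 then places \<open>u\<close> on the line of
    \<open>v\<close>.\<close>
  let ?w = "s(0 := s 0 - u)"
  have "(\<Sum>r\<in>insert 0 S. ?w r) = ?w 0 + (\<Sum>r\<in>S - {0}. ?w r)"
    using s(1) by (simp add: sum.insert_remove)
  also have "(\<Sum>r\<in>S - {0}. ?w r) = (\<Sum>r\<in>S - {0}. s r)" by (rule sum.cong) auto
  also have "?w 0 + \<dots> = 0"
    using s by (cases "0 \<in> S") (auto simp: sum.remove[of S 0])
  finally have "(\<Sum>r\<in>insert 0 S. ?w r) = 0" .
  moreover have "E (?w r) = scale (of_nat r - N) (?w r)" for r
    using E_layer[OF s(2), of r] assms(2) by (auto simp: E_diff scale_simps)
  ultimately have "?w 0 = 0"
    by (intro eigenvectors_independent[of "insert 0 S" ?w "\<lambda>r. of_nat r - N"])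
       (use s(1) in \<open>auto simp: inj_on_def\<close>)
  then have "u = s 0" by simp
  then show ?thesis using s(2)[of 0] by (auto simp: span_singleton)
qed

end

end

section \<open>Polynomials as coefficient functions\<close>

definition cscale :: "complex \<Rightarrow> ('a \<Rightarrow> complex) \<Rightarrow> 'a \<Rightarrow> complex" where
  "cscale a f = (\<lambda>x. a * f x)"

lemma cscale_apply [simp]: "cscale a f x = a * f x"
  by (simp add: cscale_def)

global_interpretation cfun: vector_space cscale
  by unfold_locales (auto simp: cscale_def fun_eq_iff algebra_simps)

lemma sum_fun_apply: "(\<Sum>i\<in>A. f i) x = (\<Sum>i\<in>A. f i x)"
  by (induction A rule: infinite_finite_induct) auto

text \<open>
  A polynomial is given by its coefficients, indexed by exponent vectors.  Finite support is not
  required, so multiplication by \<open>x\<^sub>i\<close> and \<open>\<partial>/\<partial>x\<^sub>i\<close> are total linear operators.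
\<close>

definition mulx :: "'n \<Rightarrow> (('n \<Rightarrow> nat) \<Rightarrow> complex) \<Rightarrow> ('n \<Rightarrow> nat) \<Rightarrow> complex" where
  "mulx i c = (\<lambda>\<alpha>. if \<alpha> i = 0 then 0 else c (\<alpha>(i := \<alpha> i - 1)))"

definition dd :: "'n \<Rightarrow> (('n \<Rightarrow> nat) \<Rightarrow> complex) \<Rightarrow> ('n \<Rightarrow> nat) \<Rightarrow> complex" where
  "dd i c = (\<lambda>\<alpha>. of_nat (Suc (\<alpha> i)) * c (\<alpha>(i := Suc (\<alpha> i))))"

text \<open>
  Since \<open>(g \<cdot> P)(x) = P (g\<^sup>-\<^sup>1 x)\<close> and \<open>rot i j\<close> has generator \<open>E\<^sub>j\<^sub>i - E\<^sub>i\<^sub>j\<close>, the derivative of the action is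
  \<open>x\<^sub>j \<partial>\<^sub>i - x\<^sub>i \<partial>\<^sub>j\<close>, the negative of the operator in the informal statement.
\<close>

definition L :: "'n \<Rightarrow> 'n \<Rightarrow> (('n \<Rightarrow> nat) \<Rightarrow> complex) \<Rightarrow> ('n \<Rightarrow> nat) \<Rightarrow> complex" where
  "L i j c = mulx j (dd i c) - mulx i (dd j c)"

lemma mulx_linear:
  "mulx i (c + d) = mulx i c + mulx i d"
  "mulx i (c - d) = mulx i c - mulx i d"
  "mulx i (- c) = - mulx i c"
  "mulx i (cscale r c) = cscale r (mulx i c)"
  "mulx i 0 = 0"
  by (auto simp: mulx_def fun_eq_iff)

lemma dd_linear:
  "dd i (c + d) = dd i c + dd i d"
  "dd i (c - d) = dd i c - dd i d"
  "dd i (- c) = - dd i c"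
  "dd i (cscale r c) = cscale r (dd i c)"
  "dd i 0 = 0"
  by (auto simp: dd_def fun_eq_iff algebra_simps)

lemma dd_sum: "dd i (sum f A) = (\<Sum>x\<in>A. dd i (f x))"
  by (rule ext) (simp add: dd_def sum_fun_apply sum_distrib_left)

lemma mulx_sum: "mulx i (sum f A) = (\<Sum>x\<in>A. mulx i (f x))"
  by (rule ext) (simp add: mulx_def sum_fun_apply)

lemma mulx_commute: "mulx i (mulx j c) = mulx j (mulx i c)"
  by (cases "i = j") (auto simp: mulx_def fun_eq_iff fun_upd_twist)

lemma dd_commute: "dd i (dd j c) = dd j (dd i c)"
  by (cases "i = j") (auto simp: dd_def fun_eq_iff fun_upd_twist)

lemma dd_mulx: "dd i (mulx j c) = mulx j (dd i c) + (if i = j then c else 0)"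
  by (cases "i = j") (auto simp: dd_def mulx_def fun_eq_iff fun_upd_twist algebra_simps)

lemmas weyl_simps = mulx_linear dd_linear dd_mulx

global_interpretation coeffs: so_action cscale "L :: 'n \<Rightarrow> 'n \<Rightarrow> (('n \<Rightarrow> nat) \<Rightarrow> complex) \<Rightarrow> _"
proof
  fix i j k l :: 'n and u v :: "('n \<Rightarrow> nat) \<Rightarrow> complex" and c :: complex
  show "L i j (u + v) = L i j u + L i j v" by (simp add: L_def weyl_simps)
  show "L i j (cscale c u) = cscale c (L i j u)"
    by (simp add: L_def weyl_simps cfun.scale_right_diff_distrib)
  show "L j i u = - L i j u" by (simp add: L_def)
  show "L i j (L i k u) = L i k (L i j u) + L j k u" if "distinct [i, j, k]"
  proof -
    have "i \<noteq> j" "i \<noteq> k" "j \<noteq> k" "j \<noteq> i" "k \<noteq> i" "k \<noteq> j" using that by auto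
    then show ?thesis
      by (simp add: L_def weyl_simps algebra_simps mulx_commute dd_commute)
  qed
  show "L i j (L k l u) = L k l (L i j u)" if "distinct [i, j, k, l]"
  proof -
    have "i \<noteq> k" "i \<noteq> l" "j \<noteq> k" "j \<noteq> l" "k \<noteq> i" "l \<noteq> i" "k \<noteq> j" "l \<noteq> j" using that by auto
    then show ?thesis
      by (simp add: L_def weyl_simps algebra_simps mulx_commute dd_commute)
  qed
qed

definition homog :: "nat \<Rightarrow> (('n::finite \<Rightarrow> nat) \<Rightarrow> complex) \<Rightarrow> bool" where
  "homog N c \<longleftrightarrow> (\<forall>\<alpha>. c \<alpha> \<noteq> 0 \<longrightarrow> sum \<alpha> UNIV = N)"

definition lap :: "(('n::finite \<Rightarrow> nat) \<Rightarrow> complex) \<Rightarrow> ('n \<Rightarrow> nat) \<Rightarrow> complex" where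
  "lap c = (\<Sum>i\<in>UNIV. dd i (dd i c))"

definition harm :: "nat \<Rightarrow> (('n::finite \<Rightarrow> nat) \<Rightarrow> complex) set" where
  "harm N = {c. homog N c \<and> lap c = 0}"

lemma sum_fun_upd_Suc:
  fixes \<alpha> :: "'n::finite \<Rightarrow> nat"
  shows "sum (\<alpha>(i := Suc (\<alpha> i))) UNIV = Suc (sum \<alpha> UNIV)"
proof -
  have "sum (\<alpha>(i := Suc (\<alpha> i))) (UNIV - {i}) = sum \<alpha> (UNIV - {i})"
    by (rule sum.cong) auto
  then show ?thesis
    by (simp add: sum.remove[of UNIV i])
qed

lemma sum_fun_upd_pred:
  fixes \<alpha> :: "'n::finite \<Rightarrow> nat"
  assumes "\<alpha> i \<noteq> 0"
  shows "Suc (sum (\<alpha>(i := \<alpha> i - 1)) UNIV) = sum \<alpha> UNIV"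
  using sum_fun_upd_Suc[of "\<alpha>(i := \<alpha> i - 1)" i] assms by simp

lemma homog_mulx: "homog N c \<Longrightarrow> homog (Suc N) (mulx i c)"
  unfolding homog_def mulx_def by (metis sum_fun_upd_pred)

lemma homog_dd: "homog (Suc N) c \<Longrightarrow> homog N (dd i c)"
  unfolding homog_def dd_def by (metis mult_eq_0_iff nat.inject sum_fun_upd_Suc)

lemma dd_homog_0: "homog 0 c \<Longrightarrow> dd i c = 0"
  unfolding homog_def dd_def by (auto simp: fun_eq_iff) (metis fun_upd_same nat.distinct(1))

lemma homog_linear:
  "homog N c \<Longrightarrow> homog N d \<Longrightarrow> homog N (c + d)"
  "homog N c \<Longrightarrow> homog N d \<Longrightarrow> homog N (c - d)"
  "homog N c \<Longrightarrow> homog N (cscale r c)"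
  "homog N 0"
  unfolding homog_def by (auto, force+)

lemma homog_mulx_dd: "homog N c \<Longrightarrow> homog N (mulx i (dd j c))"
  by (cases N) (auto simp: dd_homog_0 mulx_linear homog_linear intro: homog_mulx homog_dd)

lemma euler: "homog N c \<Longrightarrow> (\<Sum>i\<in>UNIV. mulx i (dd i c)) = cscale (of_nat N) c"
proof
  fix \<alpha> assume "homog N c"
  have "mulx i (dd i c) \<alpha> = of_nat (\<alpha> i) * c \<alpha>" for i
    by (auto simp: mulx_def dd_def)
  then have "(\<Sum>i\<in>UNIV. mulx i (dd i c)) \<alpha> = of_nat (sum \<alpha> UNIV) * c \<alpha>"
    by (simp add: sum_fun_apply sum_distrib_right)
  then show "(\<Sum>i\<in>UNIV. mulx i (dd i c)) \<alpha> = cscale (of_nat N) c \<alpha>"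
    using \<open>homog N c\<close> by (cases "c \<alpha> = 0") (auto simp: homog_def)
qed

lemma lap_linear:
  "lap (c + d) = lap c + lap d"
  "lap (c - d) = lap c - lap d"
  "lap (cscale r c) = cscale r (lap c)"
  "lap 0 = 0"
  by (simp_all add: lap_def dd_linear sum.distrib sum_subtractf cfun.scale_sum_right)

lemma lap_mulx: "lap (mulx j c) = mulx j (lap c) + cscale 2 (dd j c)"
proof -
  have "lap (mulx j c) = (\<Sum>i\<in>UNIV. mulx j (dd i (dd i c)) + (if i = j then cscale 2 (dd j c) else 0))"
    unfolding lap_def
    by (rule sum.cong[OF refl]) (auto simp: weyl_simps fun_eq_iff)
  also have "\<dots> = mulx j (lap c) + cscale 2 (dd j c)"
    by (simp add: sum.distrib lap_def mulx_sum)
  finally show ?thesis .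
qed

lemma lap_dd: "lap (dd j c) = dd j (lap c)"
  by (simp add: lap_def dd_sum dd_commute)

text \<open>The commutators of the Laplacian with x_j and x_i contribute 2
  \<open>dd j (dd i c)\<close> and -2 \<open>dd i (dd j c)\<close>, which cancel.\<close>

lemma invariant_harm: "coeffs.invariant (harm N)"
proof -
  have "L i j c \<in> harm N" if "c \<in> harm N" for i j and c :: "('a \<Rightarrow> nat) \<Rightarrow> complex"
    using that
    by (auto simp: harm_def L_def lap_linear lap_mulx lap_dd dd_linear mulx_linear dd_commute
        intro!: homog_linear homog_mulx_dd)
  then show ?thesis
    unfolding coeffs.invariant_def
    by (auto simp: harm_def cfun.subspace_def lap_linear homog_linear)
qed

lemma finite_exponents: "finite {\<alpha> :: 'n::finite \<Rightarrow> nat. sum \<alpha> UNIV = N}"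
proof (rule finite_subset)
  show "{\<alpha> :: 'n \<Rightarrow> nat. sum \<alpha> UNIV = N} \<subseteq> Pi\<^sub>E UNIV (\<lambda>_. {..N})"
    by (auto intro: member_le_sum)
qed (simp add: finite_PiE)

definition basis_coeff :: "('n \<Rightarrow> nat) \<Rightarrow> ('n \<Rightarrow> nat) \<Rightarrow> complex" where
  "basis_coeff \<alpha> = (\<lambda>\<beta>. if \<beta> = \<alpha> then 1 else 0)"

lemma homog_span:
  fixes c :: "('n::finite \<Rightarrow> nat) \<Rightarrow> complex"
  assumes "homog N c"
  shows "c \<in> cfun.span (basis_coeff ` {\<alpha>. sum \<alpha> UNIV = N})"
proof -
  have "c = (\<Sum>\<alpha>\<in>{\<alpha>. sum \<alpha> UNIV = N}. cscale (c \<alpha>) (basis_coeff \<alpha>))"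
  proof
    fix \<beta>
    have "(\<Sum>\<alpha>\<in>{\<alpha>. sum \<alpha> UNIV = N}. cscale (c \<alpha>) (basis_coeff \<alpha>)) \<beta>
        = (\<Sum>\<alpha>\<in>{\<alpha>. sum \<alpha> UNIV = N}. if \<beta> = \<alpha> then c \<alpha> else 0)"
      unfolding sum_fun_apply by (rule sum.cong) (auto simp: basis_coeff_def)
    then show "c \<beta> = (\<Sum>\<alpha>\<in>{\<alpha>. sum \<alpha> UNIV = N}. cscale (c \<alpha>) (basis_coeff \<alpha>)) \<beta>"
      using assms by (auto simp: finite_exponents homog_def)
  qed
  also have "\<dots> \<in> cfun.span (basis_coeff ` {\<alpha>. sum \<alpha> UNIV = N})"
    by (intro cfun.span_sum cfun.span_scale cfun.span_base) auto
  finally show ?thesis .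
qed

lemma harm_span: "harm N \<subseteq> cfun.span (basis_coeff ` {\<alpha> :: 'n::finite \<Rightarrow> nat. sum \<alpha> UNIV = N})"
  using homog_span by (auto simp: harm_def)

section \<open>Irreducibility of the harmonic polynomials\<close>

locale harmonic_plane =
  fixes a b :: "'n::finite"
  assumes a_neq_b: "a \<noteq> b"
begin

sublocale hp: so_plane cscale L a b
  by unfold_locales (rule a_neq_b)

definition zmul :: "(('n \<Rightarrow> nat) \<Rightarrow> complex) \<Rightarrow> ('n \<Rightarrow> nat) \<Rightarrow> complex" where
  "zmul c = mulx a c + cscale \<i> (mulx b c)"

text \<open>Twice the Wirtinger derivative with respect to the conjugate of z = x_a + i x_b.\<close>

definition dzbar :: "(('n \<Rightarrow> nat) \<Rightarrow> complex) \<Rightarrow> ('n \<Rightarrow> nat) \<Rightarrow> complex" where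
  "dzbar c = dd a c + cscale \<i> (dd b c)"

definition zpow :: "nat \<Rightarrow> ('n \<Rightarrow> nat) \<Rightarrow> complex" where
  "zpow N = (zmul ^^ N) (basis_coeff (\<lambda>_. 0))"

lemma zpow_Suc: "zpow (Suc N) = zmul (zpow N)"
  by (simp add: zpow_def)

lemma zmul_linear:
  "zmul (c + d) = zmul c + zmul d"
  "zmul (c - d) = zmul c - zmul d"
  "zmul (- c) = - zmul c"
  "zmul (cscale r c) = cscale r (zmul c)"
  "zmul 0 = 0"
  by (simp_all add: zmul_def mulx_linear fun_eq_iff algebra_simps)

lemma dd_zmul: "dd k (zmul c) = zmul (dd k c) + (if k = a then c else if k = b then cscale \<i> c else 0)"
  using a_neq_b by (auto simp: zmul_def weyl_simps fun_eq_iff algebra_simps)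

lemma homog_zpow: "homog N (zpow N)"
proof (induction N)
  case 0
  show ?case by (auto simp: zpow_def homog_def basis_coeff_def)
next
  case (Suc N)
  then show ?case unfolding zpow_Suc zmul_def by (intro homog_linear homog_mulx)
qed

lemma dd_one: "dd k (basis_coeff (\<lambda>_. 0)) = 0"
  by (auto simp: dd_def basis_coeff_def fun_eq_iff)

lemma dd_zpow:
  "dd k (zpow N) = cscale (of_nat N * (if k = a then 1 else if k = b then \<i> else 0)) (zpow (N - 1))"
proof (induction N)
  case 0
  then show ?case by (simp add: zpow_def dd_one)
next
  case (Suc N)
  have "dd k (zpow (Suc N)) = zmul (dd k (zpow N)) + (if k = a then zpow N else if k = b then cscale \<i> (zpow N) else 0)"
    by (simp add: zpow_Suc dd_zmul)
  also have "zmul (dd k (zpow N)) = cscale (of_nat N * (if k = a then 1 else if k = b then \<i> else 0)) (zpow N)"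
  proof (cases N)
    case 0
    then have "dd k (zpow N) = 0" by (simp add: zpow_def dd_one)
    then show ?thesis using 0 by (simp only: zmul_linear) simp
  next
    case (Suc M)
    then show ?thesis unfolding Suc.IH by (simp add: zmul_linear zpow_Suc)
  qed
  finally show ?case by (auto simp: fun_eq_iff algebra_simps)
qed

lemma zpow_neq_0: "zpow N \<noteq> 0"
proof (induction N)
  case 0
  show ?case by (auto simp: zpow_def basis_coeff_def fun_eq_iff)
next
  case (Suc N)
  show ?case
  proof
    assume "zpow (Suc N) = 0"
    then have "0 = cscale (of_nat (Suc N)) (zpow N)"
      using dd_zpow[of a "Suc N"] by (simp add: dd_linear)
    then have "zpow N = 0" by (simp only: cfun.scale_eq_0_iff of_nat_eq_0_iff eq_commute[of 0]) simp
    then show False using Suc by contradiction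
  qed
qed

lemma zpow_harm: "zpow N \<in> harm N"
proof -
  have "lap (zpow N) = (\<Sum>i\<in>{a, b}. dd i (dd i (zpow N)))"
    unfolding lap_def by (rule sum.mono_neutral_right) (auto simp: dd_zpow dd_linear)
  also have "\<dots> = 0"
    using a_neq_b by (simp add: dd_zpow dd_linear fun_eq_iff algebra_simps)
  finally show ?thesis using homog_zpow by (simp add: harm_def)
qed

lemma lower_eq: "hp.lower k c = mulx k (dzbar c) - zmul (dd k c)"
  by (simp add: hp.lower_def L_def dzbar_def zmul_def mulx_linear fun_eq_iff algebra_simps)

lemma dzbar_zpow: "dzbar (zpow N) = 0"
  using a_neq_b by (simp add: dzbar_def dd_zpow fun_eq_iff algebra_simps)

lemma lower_zpow: "k \<notin> {a, b} \<Longrightarrow> hp.lower k (zpow N) = 0"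
  by (simp add: lower_eq dzbar_zpow dd_zpow mulx_linear zmul_linear)

lemma L_zpow: "k \<notin> {a, b} \<Longrightarrow> l \<notin> {a, b} \<Longrightarrow> L k l (zpow N) = 0"
  by (simp add: L_def dd_zpow mulx_linear)

lemma E_zpow: "hp.E (zpow N) = cscale (- of_nat N) (zpow N)"
proof (cases N)
  case 0
  then show ?thesis by (simp add: hp.E_def L_def dd_zpow mulx_linear)
next
  case (Suc M)
  have z: "zpow N = mulx a (zpow M) + cscale \<i> (mulx b (zpow M))"
    by (simp add: Suc zpow_Suc zmul_def)
  have d: "dd a (zpow N) = cscale (of_nat N) (zpow M)" "dd b (zpow N) = cscale (of_nat N * \<i>) (zpow M)"
    using a_neq_b by (simp_all add: dd_zpow Suc)
  show ?thesis unfolding hp.E_def L_def d unfolding z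
    by (simp add: mulx_linear fun_eq_iff algebra_simps)
qed

text \<open>The coefficient of x_a x^\<alpha> in z c expresses \<open>c \<alpha>\<close> through a
  coefficient with smaller exponent of x_b. Induction on that exponent also works for infinite
  support.\<close>

lemma zmul_eq_0:
  assumes "zmul c = 0"
  shows "c = 0"
proof
  fix \<alpha>
  show "c \<alpha> = 0 \<alpha>"
  proof (induction "\<alpha> b" arbitrary: \<alpha> rule: less_induct)
    case less
    let ?\<beta> = "\<alpha>(a := Suc (\<alpha> a))"
    have "zmul c ?\<beta> = 0" using assms by simp
    then have "c \<alpha> + \<i> * (if \<alpha> b = 0 then 0 else c (?\<beta>(b := \<alpha> b - 1))) = 0"
      using a_neq_b by (cases "\<alpha> b = 0") (simp_all add: zmul_def mulx_def)
    moreover have "c (?\<beta>(b := \<alpha> b - 1)) = 0" if "\<alpha> b \<noteq> 0"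
      using less[of "?\<beta>(b := \<alpha> b - 1)"] that by simp
    ultimately show ?case by (cases "\<alpha> b = 0") auto
  qed
qed

text \<open>Since \<open>dd b c\<close> is i times \<open>dd a c\<close> and the other derivatives
  vanish, Euler's identity reads N c = z \<open>dd a c\<close>; and \<open>dd a c\<close> satisfies
  the same assumptions one degree lower.\<close>

lemma zpow_unique:
  assumes "homog N c" "dzbar c = 0" "\<And>k. k \<notin> {a, b} \<Longrightarrow> dd k c = 0"
  shows "\<exists>s. c = cscale s (zpow N)"
  using assms
proof (induction N arbitrary: c)
  case 0
  have "c = cscale (c (\<lambda>_. 0)) (zpow 0)"
  proof
    fix \<alpha>
    show "c \<alpha> = cscale (c (\<lambda>_. 0)) (zpow 0) \<alpha>"
    proof (cases "\<alpha> = (\<lambda>_. 0)")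
      case False
      then have "sum \<alpha> UNIV \<noteq> 0" by (auto simp: fun_eq_iff)
      then have "c \<alpha> = 0" using "0.prems"(1) by (auto simp: homog_def)
      then show ?thesis using False by (simp add: zpow_def basis_coeff_def)
    qed (simp add: zpow_def basis_coeff_def)
  qed
  then show ?case ..
next
  case (Suc N)
  have db: "dd b c = cscale \<i> (dd a c)"
  proof -
    have "cscale \<i> (dd a c + cscale \<i> (dd b c)) = 0"
      unfolding dzbar_def[symmetric] Suc.prems(2) by simp
    then show ?thesis by (auto simp: fun_eq_iff algebra_simps)
  qed
  have "dzbar (dd a c) = dd a (dzbar c)"
    by (simp add: dzbar_def dd_linear dd_commute)
  then have "dzbar (dd a c) = 0" by (simp only: Suc.prems(2) dd_linear)
  moreover have "dd k (dd a c) = 0" if "k \<notin> {a, b}" for k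
    unfolding dd_commute[of k] Suc.prems(3)[OF that] by (rule dd_linear)
  ultimately have "\<exists>s. dd a c = cscale s (zpow N)"
    using homog_dd[OF Suc.prems(1)] by (intro Suc.IH)
  then obtain s where s: "dd a c = cscale s (zpow N)" ..
  have "cscale (of_nat (Suc N)) c = (\<Sum>i\<in>UNIV. mulx i (dd i c))"
    using euler[OF Suc.prems(1)] by simp
  also have "\<dots> = (\<Sum>i\<in>{a, b}. mulx i (dd i c))"
  proof (rule sum.mono_neutral_right)
    have "mulx i (dd i c) = 0" if "i \<notin> {a, b}" for i
      unfolding Suc.prems(3)[OF that] by (rule mulx_linear)
    then show "\<forall>i\<in>UNIV - {a, b}. mulx i (dd i c) = 0" by blast
  qed simp_all
  also have "\<dots> = zmul (dd a c)"
    using a_neq_b by (simp add: db zmul_def mulx_linear)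
  also have "\<dots> = cscale s (zpow (Suc N))"
    by (simp add: s zpow_Suc zmul_linear)
  finally have "cscale (1 / of_nat (Suc N)) (cscale (of_nat (Suc N)) c)
      = cscale (1 / of_nat (Suc N)) (cscale s (zpow (Suc N)))" by simp
  then have "c = cscale (s / of_nat (Suc N)) (zpow (Suc N))"
    by (simp del: of_nat_Suc)
  then show ?case ..
qed

text \<open>
  With \<open>q = (\<partial>\<^sub>a + \<i> \<partial>\<^sub>b) c\<close> the lowering equations read \<open>z \<partial>\<^sub>k c = x\<^sub>k q\<close>.  Applying \<open>\<partial>\<^sub>k\<close>, summing
  over \<open>k\<close> and using harmonicity and Euler's identity gives \<open>E q = (D + N - 3) q\<close>, whereas \<open>E q\<close> is a
  negative multiple of \<open>q\<close>; hence \<open>q = 0\<close>.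
\<close>

lemma lowest_harmonic:
  assumes "c \<in> harm N" and low: "\<And>k. k \<notin> {a, b} \<Longrightarrow> hp.lower k c = 0"
    and weight: "hp.E c = cscale (- (of_nat j / 2)) c" and D: "CARD('n) \<ge> 3"
  shows "\<exists>s. c = cscale s (zpow N)"
proof -
  have hom: "homog N c" and lap: "lap c = 0" using assms(1) by (auto simp: harm_def)
  define q where "q = dzbar c"
  let ?I = "UNIV - {a, b}"
  have card: "card ?I = CARD('n) - 2" using a_neq_b by (simp add: card_Diff_subset)
  have split: "(\<Sum>i\<in>UNIV. f i) = f a + f b + (\<Sum>i\<in>?I. f i)" for f :: "'n \<Rightarrow> ('n \<Rightarrow> nat) \<Rightarrow> complex"
    using a_neq_b sum.subset_diff[of "{a, b}" UNIV f] by (simp add: add.commute)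
  have 1: "zmul (dd k c) = mulx k q" if "k \<in> ?I" for k
    using low[of k] that by (simp add: lower_eq q_def)
  have 2: "zmul (dd k (dd k c)) = q + mulx k (dd k q)" if "k \<in> ?I" for k
  proof -
    have "zmul (dd k (dd k c)) = dd k (zmul (dd k c))" using that by (simp add: dd_zmul)
    then show ?thesis using that by (simp add: 1 dd_mulx add.commute)
  qed
  have zsum: "zmul (sum f A) = (\<Sum>k\<in>A. zmul (f k))" for f :: "'n \<Rightarrow> ('n \<Rightarrow> nat) \<Rightarrow> complex" and A
    by (simp add: zmul_def mulx_sum sum.distrib cfun.scale_sum_right)
  have "zmul (\<Sum>k\<in>?I. dd k (dd k c)) = (\<Sum>k\<in>?I. q + mulx k (dd k q))"
    unfolding zsum by (rule sum.cong[OF refl 2])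
  also have "\<dots> = cscale (of_nat (CARD('n) - 2)) q + (\<Sum>k\<in>?I. mulx k (dd k q))"
    using card by (simp add: sum.distrib fun_eq_iff sum_fun_apply)
  finally have 3: "zmul (\<Sum>k\<in>?I. dd k (dd k c))
    = cscale (of_nat (CARD('n) - 2)) q + (\<Sum>k\<in>?I. mulx k (dd k q))" .
  have 4: "(\<Sum>k\<in>?I. dd k (dd k c)) = - (dd a (dd a c) + dd b (dd b c))"
    using lap unfolding lap_def split add_eq_0_iff .
  \<comment> \<open>Euler's identity for \<open>c\<close>, differentiated. The subtraction in
    \<open>of_nat N - 1\<close> is complex, so N = 0 needs no separate case.\<close>
  have "(\<Sum>k\<in>UNIV. mulx k (dd k (dd i c))) = cscale (of_nat N - 1) (dd i c)" for i
  proof -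
    have "dd i (\<Sum>k\<in>UNIV. mulx k (dd k c)) = (\<Sum>k\<in>UNIV. mulx k (dd k (dd i c)) + (if i = k then dd i c else 0))"
      unfolding dd_sum by (rule sum.cong[OF refl]) (auto simp: dd_mulx dd_commute)
    also have "\<dots> = (\<Sum>k\<in>UNIV. mulx k (dd k (dd i c))) + dd i c"
      by (simp add: sum.distrib)
    finally show ?thesis
      unfolding euler[OF hom] by (simp add: dd_linear fun_eq_iff algebra_simps)
  qed
  then have 5: "(\<Sum>k\<in>UNIV. mulx k (dd k q)) = cscale (of_nat N - 1) q"
    unfolding q_def dzbar_def
    by (simp add: dd_linear mulx_linear sum.distrib cfun.scale_right_distrib mult.commute
        flip: cfun.scale_sum_right)
  have 6: "zmul (dd a (dd a c) + dd b (dd b c)) = mulx a (dd a q) + mulx b (dd b q) - hp.E q"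
    unfolding q_def
    by (simp add: zmul_def dzbar_def hp.E_def L_def weyl_simps dd_commute fun_eq_iff algebra_simps)
  have 7: "hp.E q = cscale (of_nat (CARD('n) - 2) + (of_nat N - 1)) q"
    using 3 5 unfolding 4 zmul_linear(3) 6 split
    by (simp add: fun_eq_iff algebra_simps)
  \<comment> \<open>\<open>dzbar\<close> lowers the weight by one, so \<open>q\<close> has the
    negative weight -j/2 - 1, while 7 gives the nonnegative value D + N - 3. Their difference is the
    coefficient D - 2 + N + j/2 below.\<close>
  have "hp.E q = dzbar (hp.E c) - q"
    using a_neq_b unfolding q_def
    by (simp add: dzbar_def hp.E_def L_def weyl_simps dd_commute fun_eq_iff algebra_simps)
  also have "dzbar (hp.E c) = cscale (- (of_nat j / 2)) q"
    unfolding weight q_def by (simp add: dzbar_def dd_linear fun_eq_iff algebra_simps)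
  finally have 8: "hp.E q = cscale (- (of_nat j / 2)) q - q" .
  have "cscale (of_nat (CARD('n) - 2 + N) + of_nat j / 2) q
      = hp.E q - (cscale (- (of_nat j / 2)) q - q)"
    unfolding 7 by (simp add: fun_eq_iff algebra_simps)
  also have "\<dots> = 0" unfolding 8 by (rule diff_self)
  finally have "cscale (of_nat (CARD('n) - 2 + N) + of_nat j / 2) q = 0" .
  moreover have "(of_nat (CARD('n) - 2 + N) + of_nat j / 2 :: complex) \<noteq> 0"
  proof
    assume "(of_nat (CARD('n) - 2 + N) + of_nat j / 2 :: complex) = 0"
    then have "(of_nat (2 * (CARD('n) - 2 + N) + j) :: complex) = 0"
      by (simp add: field_simps)
    then have "2 * (CARD('n) - 2 + N) + j = 0" unfolding of_nat_eq_0_iff .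
    then show False using D by simp
  qed
  ultimately have "q = 0" by simp
  moreover have "dd k c = 0" if "k \<notin> {a, b}" for k
    by (rule zmul_eq_0) (use 1[of k] that \<open>q = 0\<close> in \<open>simp add: mulx_linear\<close>)
  ultimately show ?thesis
    using zpow_unique[OF hom] by (simp add: q_def)
qed

lemma zpow_in_invariant:
  assumes W: "coeffs.invariant W" "W \<subseteq> harm N" "W \<noteq> {0}" and D: "CARD('n) \<ge> 3"
  shows "zpow N \<in> W"
proof -
  have "card {a, b} < CARD('n)" using D a_neq_b by simp
  then obtain k0 where k0: "k0 \<notin> {a, b}"
    by (metis UNIV_eq_I less_irrefl)
  have "W \<subseteq> cfun.span (basis_coeff ` {\<alpha>. sum \<alpha> UNIV = N})"
    using W(2) harm_span by blast
  then obtain w j where w: "w \<in> W" "w \<noteq> 0" "\<And>k. k \<notin> {a, b} \<Longrightarrow> hp.lower k w = 0"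
    "hp.E w = cscale (- (of_nat j / 2)) w"
    using hp.lowest_vector[OF W(1,3) _ _ k0] finite_exponents by (metis finite_imageI)
  then obtain s where s: "w = cscale s (zpow N)"
    using lowest_harmonic[OF _ w(3,4) D] W(2) by blast
  then have "zpow N = cscale (1 / s) w" using w(2) by auto
  then show ?thesis using w(1) W(1) unfolding coeffs.invariant_def
    by (simp add: cfun.subspace_scale)
qed

end

text \<open>The Fischer inner product, for which \<open>x\<^sub>i\<close> and \<open>\<partial>\<^sub>i\<close> are adjoint, so that each \<open>L i j\<close> is skew.\<close>

definition weight_fact :: "('n::finite \<Rightarrow> nat) \<Rightarrow> complex" where
  "weight_fact \<alpha> = (\<Prod>i\<in>UNIV. fact (\<alpha> i))"

definition fischer :: "nat \<Rightarrow> (('n::finite \<Rightarrow> nat) \<Rightarrow> complex) \<Rightarrow> (('n \<Rightarrow> nat) \<Rightarrow> complex) \<Rightarrow> complex" where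
  "fischer N c d = (\<Sum>\<alpha>\<in>{\<alpha>. sum \<alpha> UNIV = N}. weight_fact \<alpha> * c \<alpha> * cnj (d \<alpha>))"

lemma weight_fact_Suc: "weight_fact (\<alpha>(i := Suc (\<alpha> i))) = of_nat (Suc (\<alpha> i)) * weight_fact \<alpha>"
proof -
  have "(\<Prod>k\<in>UNIV - {i}. fact ((\<alpha>(i := Suc (\<alpha> i))) k)) = (\<Prod>k\<in>UNIV - {i}. fact (\<alpha> k) :: complex)"
    by (rule prod.cong) auto
  then show ?thesis
    unfolding weight_fact_def by (simp add: prod.remove[of UNIV i] algebra_simps)
qed

lemma cnj_weight_fact: "cnj (weight_fact \<alpha>) = weight_fact \<alpha>"
  by (simp add: weight_fact_def)

lemma fischer_cnj: "fischer N d c = cnj (fischer N c d)"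
  by (simp add: fischer_def cnj_weight_fact algebra_simps)

lemma fischer_linear:
  "fischer N (c + d) e = fischer N c e + fischer N d e"
  "fischer N (c - d) e = fischer N c e - fischer N d e"
  "fischer N (cscale r c) e = r * fischer N c e"
  "fischer N 0 e = 0"
  "fischer N e (c + d) = fischer N e c + fischer N e d"
  "fischer N e (c - d) = fischer N e c - fischer N e d"
  "fischer N e (cscale r c) = cnj r * fischer N e c"
  "fischer N e 0 = 0"
  by (simp_all add: fischer_def sum.distrib sum_subtractf sum_distrib_left algebra_simps)

text \<open>The factorial weights are made for this: raising the exponent of x_j multiplies
  \<alpha>! by exactly the factor that differentiation produces.\<close>

lemma fischer_mulx: "fischer (Suc N) (mulx j c) d = fischer N c (dd j d)"
proof -
  have "fischer (Suc N) (mulx j c) d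
      = (\<Sum>\<alpha>\<in>{\<alpha>. sum \<alpha> UNIV = Suc N \<and> \<alpha> j \<noteq> 0}. weight_fact \<alpha> * mulx j c \<alpha> * cnj (d \<alpha>))"
    unfolding fischer_def
    by (rule sum.mono_neutral_right) (auto simp: finite_exponents mulx_def)
  also have "\<dots> = fischer N c (dd j d)"
    unfolding fischer_def
  proof (rule sum.reindex_bij_witness[of _ "\<lambda>\<alpha>. \<alpha>(j := Suc (\<alpha> j))" "\<lambda>\<alpha>. \<alpha>(j := \<alpha> j - 1)"])
    fix \<alpha> :: "'a \<Rightarrow> nat" assume "\<alpha> \<in> {\<alpha>. sum \<alpha> UNIV = Suc N \<and> \<alpha> j \<noteq> 0}"
    then show "\<alpha>(j := \<alpha> j - 1) \<in> {\<alpha>. sum \<alpha> UNIV = N}"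
      using sum_fun_upd_pred[of \<alpha> j] by simp
  next
    fix \<alpha> :: "'a \<Rightarrow> nat" assume \<alpha>: "\<alpha> \<in> {\<alpha>. sum \<alpha> UNIV = Suc N \<and> \<alpha> j \<noteq> 0}"
    define \<beta> where "\<beta> = \<alpha>(j := \<alpha> j - 1)"
    have "\<alpha> = \<beta>(j := Suc (\<beta> j))" using \<alpha> by (auto simp: \<beta>_def)
    then show "weight_fact (\<alpha>(j := \<alpha> j - 1)) * c (\<alpha>(j := \<alpha> j - 1)) * cnj (dd j d (\<alpha>(j := \<alpha> j - 1)))
        = weight_fact \<alpha> * mulx j c \<alpha> * cnj (d \<alpha>)"
      unfolding \<beta>_def[symmetric] by (simp add: weight_fact_Suc dd_def mulx_def)
  next
    fix \<alpha> :: "'a \<Rightarrow> nat" assume "\<alpha> \<in> {\<alpha>. sum \<alpha> UNIV = N}"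
    then show "\<alpha>(j := Suc (\<alpha> j)) \<in> {\<alpha>. sum \<alpha> UNIV = Suc N \<and> \<alpha> j \<noteq> 0}"
      using sum_fun_upd_Suc[of \<alpha> j] by simp
  qed auto
  finally show ?thesis .
qed

lemma fischer_mulx_dd:
  assumes "homog N c" "homog N d"
  shows "fischer N (mulx j (dd i c)) d = fischer N c (mulx i (dd j d))"
proof (cases N)
  case 0
  then show ?thesis using assms by (simp add: dd_homog_0 mulx_linear fischer_linear)
next
  case (Suc M)
  then show ?thesis
    using fischer_mulx[of M j "dd i c" d] fischer_mulx[of M i "dd j d" c]
      fischer_cnj[of N "mulx i (dd j d)" c] fischer_cnj[of M "dd i c" "dd j d"] by simp
qed

lemma fischer_L: "homog N c \<Longrightarrow> homog N d \<Longrightarrow> fischer N (L i j c) d = - fischer N c (L i j d)"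
  by (simp add: L_def fischer_linear fischer_mulx_dd)

lemma fischer_eq_0:
  assumes "homog N c" "fischer N c c = 0"
  shows "c = 0"
proof
  fix \<beta>
  define g :: "('a \<Rightarrow> nat) \<Rightarrow> real" where "g \<alpha> = (\<Prod>i\<in>UNIV. fact (\<alpha> i)) * (cmod (c \<alpha>))\<^sup>2" for \<alpha>
  have "fischer N c c = of_real (\<Sum>\<alpha>\<in>{\<alpha>. sum \<alpha> UNIV = N}. g \<alpha>)"
    unfolding fischer_def of_real_sum
    by (rule sum.cong[OF refl])
       (simp add: g_def weight_fact_def mult.assoc complex_norm_square[symmetric])
  then have "(\<Sum>\<alpha>\<in>{\<alpha>. sum \<alpha> UNIV = N}. g \<alpha>) = 0" using assms(2) by (metis of_real_eq_0_iff)
  moreover have "g \<alpha> \<ge> 0" for \<alpha> unfolding g_def by (intro mult_nonneg_nonneg prod_nonneg) auto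
  ultimately have "sum \<beta> UNIV = N \<Longrightarrow> g \<beta> = 0"
    using sum_nonneg_eq_0_iff[OF finite_exponents[of N], of g] by auto
  then show "c \<beta> = 0 \<beta>"
    using assms(1) unfolding homog_def g_def by (cases "c \<beta> = 0") (auto simp: prod_eq_1_iff)
qed

lemma fischer_eq_0_span:
  assumes "\<forall>q\<in>F. fischer N g q = 0" "u \<in> cfun.span F"
  shows "fischer N g u = 0"
  using assms(2)
proof (induction rule: cfun.span_induct_alt)
  case (step c x y)
  then show ?case using assms(1) by (simp only: fischer_linear) simp
qed (rule fischer_linear)

text \<open>Gram-Schmidt, one vector at a time. If \<open>q0\<close> depends on \<open>F\<close>,
  the residual \<open>r\<close> has norm zero, hence vanishes, and orthogonality to it is
  trivial.\<close>

lemma fischer_projection: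
  assumes "finite F" "\<And>q. q \<in> F \<Longrightarrow> homog N q"
  shows "\<exists>p\<in>cfun.span F. \<forall>q\<in>F. fischer N (f - p) q = 0"
  using assms
proof (induction F arbitrary: f rule: finite_induct)
  case empty
  show ?case using cfun.span_zero by blast
next
  case (insert q0 F)
  obtain p1 where p1: "p1 \<in> cfun.span F" "\<forall>q\<in>F. fischer N (q0 - p1) q = 0"
    using insert.IH[of q0] insert.prems by blast
  obtain p2 where p2: "p2 \<in> cfun.span F" "\<forall>q\<in>F. fischer N (f - p2) q = 0"
    using insert.IH[of f] insert.prems by blast
  define r where "r = q0 - p1"
  define t where "t = fischer N (f - p2) r / fischer N r r"
  define p where "p = p2 + cscale t r"
  have mono: "cfun.span F \<subseteq> cfun.span (insert q0 F)" by (rule cfun.span_mono) auto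
  have "p \<in> cfun.span (insert q0 F)"
    unfolding p_def r_def using p1 p2 mono
    by (intro cfun.span_add cfun.span_scale cfun.span_diff) (auto intro: cfun.span_base)
  have hom_span: "homog N u" if "u \<in> cfun.span F" for u
    using that
  proof (induction rule: cfun.span_induct_alt)
    case (step c x y)
    then show ?case using insert.prems[of x] by (intro homog_linear) auto
  qed (rule homog_linear)
  have F0: "fischer N (f - p) q = 0" if "q \<in> F" for q
    using p1 p2 that by (simp add: p_def r_def fischer_linear algebra_simps)
  have "fischer N (f - p) r = 0"
  proof (cases "fischer N r r = 0")
    case True
    have "homog N r" unfolding r_def using hom_span[OF p1(1)] insert.prems by (intro homog_linear) auto
    then have "r = 0" using True by (rule fischer_eq_0)
    then show ?thesis by (simp add: fischer_linear)
  next
    case False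
    then show ?thesis by (simp add: p_def t_def fischer_linear)
  qed
  moreover have "fischer N (f - p) p1 = 0" using F0 p1(1) by (intro fischer_eq_0_span) auto
  ultimately have "fischer N (f - p) q0 = 0"
    by (simp add: r_def fischer_linear)
  then show ?case using F0 \<open>p \<in> cfun.span (insert q0 F)\<close> by blast
qed

text \<open>The Fischer complement of \<open>W\<close> is invariant because each
  \<open>L i j\<close> is skew. It omits z^N, whose norm is nonzero, whereas every nonzero invariant
  subspace contains z^N; so the complement is zero.\<close>

lemma (in harmonic_plane) invariant_eq_harm:
  assumes W: "coeffs.invariant W" "W \<subseteq> harm N" "zpow N \<in> W" and D: "CARD('n) \<ge> 3"
  shows "W = harm N"
proof -
  have subW: "cfun.subspace W" and LW: "\<And>i j w. w \<in> W \<Longrightarrow> L i j w \<in> W"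
    using W(1) by (auto simp: coeffs.invariant_def)
  have subH: "cfun.subspace (harm N :: (('n \<Rightarrow> nat) \<Rightarrow> complex) set)"
    and LH: "\<And>i j w. w \<in> (harm N :: (('n \<Rightarrow> nat) \<Rightarrow> complex) set) \<Longrightarrow> L i j w \<in> harm N"
    using invariant_harm[of N, where 'a = 'n] by (auto simp: coeffs.invariant_def)
  have hom: "homog N c" if "c \<in> harm N" for c :: "('n \<Rightarrow> nat) \<Rightarrow> complex"
    using that by (simp add: harm_def)
  define C where "C = {c \<in> harm N. \<forall>w\<in>W. fischer N c w = 0}"
  have "coeffs.invariant C"
    unfolding coeffs.invariant_def
  proof (intro conjI allI ballI)
    show "cfun.subspace C"
      using subH unfolding C_def cfun.subspace_def by (auto simp: fischer_linear)
    fix i j c assume c: "c \<in> C"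
    have "fischer N (L i j c) w = 0" if "w \<in> W" for w
    proof -
      have "fischer N (L i j c) w = - fischer N c (L i j w)"
        using c that W(2) by (intro fischer_L hom) (auto simp: C_def)
      then show ?thesis using c LW[OF that] by (simp add: C_def)
    qed
    then show "L i j c \<in> C" using c LH by (simp add: C_def)
  qed
  moreover have "C \<subseteq> harm N" by (auto simp: C_def)
  moreover have "zpow N \<notin> C"
    using W(3) zpow_neq_0 fischer_eq_0[OF homog_zpow] by (auto simp: C_def)
  ultimately have C0: "C = {0}" using zpow_in_invariant[OF _ _ _ D] by blast
  obtain B where B: "B \<subseteq> W" "cfun.independent B" "W \<subseteq> cfun.span B"
    using cfun.basis_exists[of W] by metis
  have "B \<subseteq> cfun.span (basis_coeff ` {\<alpha>. sum \<alpha> UNIV = N})"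
    using B(1) W(2) harm_span by blast
  then have finB: "finite B"
    using cfun.independent_span_bound[OF _ B(2)] finite_exponents by blast
  have "harm N \<subseteq> W"
  proof
    fix f :: "('n \<Rightarrow> nat) \<Rightarrow> complex" assume f: "f \<in> harm N"
    obtain p where p: "p \<in> cfun.span B" "\<forall>q\<in>B. fischer N (f - p) q = 0"
      using fischer_projection[OF finB] B(1) W(2) hom by blast
    have pW: "p \<in> W" using p(1) B(1) subW cfun.span_minimal by blast
    have "fischer N (f - p) u = 0" if "u \<in> cfun.span B" for u
      using p(2) that by (rule fischer_eq_0_span)
    then have "f - p \<in> C"
      using f pW W(2) subH B(3) unfolding C_def by (auto intro!: cfun.subspace_diff)
    then show "f \<in> W" using C0 pW by auto
  qed
  then show ?thesis using W(2) by blast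
qed

section \<open>Infinitesimal action of a continuous representation\<close>

lemma bounded_bilinear_matrix_mult:
  "bounded_bilinear ((**) :: complex^'b^'a \<Rightarrow> complex^'c^'b \<Rightarrow> complex^'c^'a)"
  unfolding bilinear_conv_bounded_bilinear[symmetric] bilinear_def
  by (auto intro!: linearI simp: vec_eq_iff matrix_matrix_mult_def sum.distrib
      scaleR_sum_right algebra_simps)

lemma bounded_bilinear_matrix_vector_mult:
  "bounded_bilinear ((*v) :: complex^'b^'a \<Rightarrow> complex^'b \<Rightarrow> complex^'a)"
  unfolding bilinear_conv_bounded_bilinear[symmetric] bilinear_def
  by (auto intro!: linearI simp: vec_eq_iff matrix_vector_mult_def sum.distrib
      scaleR_sum_right algebra_simps)

lemmas has_vector_derivative_matrix_mult =
  bounded_bilinear.has_vector_derivative[OF bounded_bilinear_matrix_mult]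
lemmas matrix_mult_linear =
  bounded_bilinear.add_left[OF bounded_bilinear_matrix_mult]
  bounded_bilinear.add_right[OF bounded_bilinear_matrix_mult]
  bounded_bilinear.minus_left[OF bounded_bilinear_matrix_mult]
  bounded_bilinear.minus_right[OF bounded_bilinear_matrix_mult]
  bounded_bilinear.diff_left[OF bounded_bilinear_matrix_mult]
  bounded_bilinear.diff_right[OF bounded_bilinear_matrix_mult]
  bounded_bilinear.zero_left[OF bounded_bilinear_matrix_mult]
  bounded_bilinear.zero_right[OF bounded_bilinear_matrix_mult]
  bounded_bilinear.scaleR_left[OF bounded_bilinear_matrix_mult]
  bounded_bilinear.scaleR_right[OF bounded_bilinear_matrix_mult]
lemmas has_vector_derivative_mult_left =
  bounded_linear.has_vector_derivative[OF bounded_bilinear.bounded_linear_left[OF bounded_bilinear_matrix_mult]]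
lemmas has_vector_derivative_mult_right =
  bounded_linear.has_vector_derivative[OF bounded_bilinear.bounded_linear_right[OF bounded_bilinear_matrix_mult]]

section \<open>Plane rotations and their Euler angle factorization\<close>

lemma rot_diag [simp]: "rot i i t = mat 1"
  by (simp add: rot_def mat_def)

lemma rot_mult_vec:
  fixes x :: "real^'n"
  assumes "i \<noteq> j"
  shows "(rot i j t *v x) $ a = (if a = i then cos t * x $ i - sin t * x $ j
    else if a = j then sin t * x $ i + cos t * x $ j else x $ a)"
proof -
  have delta: "(\<Sum>b\<in>UNIV. (if b = c then r else 0) * x $ b) = r * x $ c" for c r
    by (simp add: if_distrib[where f = "\<lambda>r. r * _"] cong: if_cong)
  have "rot i j t $ a $ b = (if a = i then (if b = i then cos t else 0) + (if b = j then - sin t else 0)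
      else if a = j then (if b = i then sin t else 0) + (if b = j then cos t else 0)
      else if b = a then 1 else 0)" for b
    using assms by (simp add: rot_def)
  then show ?thesis
    unfolding matrix_vector_mult_def vec_lambda_beta
    by (simp add: distrib_right sum.distrib delta)
qed

lemma rot_0 [simp]: "rot i j 0 = mat 1"
  by (cases "i = j") (simp_all add: matrix_eq vec_eq_iff rot_mult_vec)

lemma rot_add: "rot i j (s + t) = rot i j s ** rot i j t"
proof (cases "i = j")
  case False
  then show ?thesis
    unfolding matrix_eq
    by (simp add: vec_eq_iff rot_mult_vec cos_add sin_add algebra_simps flip: matrix_vector_mul_assoc)
qed simp

lemma rot_swap: "rot j i t = rot i j (- t)"
proof (cases "i = j")
  case False
  then have "j \<noteq> i" by auto
  with False show ?thesis by (auto simp: matrix_eq vec_eq_iff rot_mult_vec)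
qed simp

lemma transpose_rot: "transpose (rot i j t) = rot i j (- t)"
proof -
  have "rot i j t $ b $ a = rot i j (- t) $ a $ b" for a b
    by (cases "i = j"; cases "a = i"; cases "a = j"; cases "b = i"; cases "b = j") (simp_all add: rot_def mat_def)
  then show ?thesis by (simp add: transpose_def vec_eq_iff)
qed

lemma orthogonal_rot: "orthogonal_matrix (rot i j t)"
  by (simp add: orthogonal_matrix transpose_rot flip: rot_add)

text \<open>The rotation is the square of the rotation by half the angle, whose determinant is 1 or
  -1.\<close>

lemma det_rot: "det (rot i j t) = 1"
proof -
  have "det (rot i j t) = det (rot i j (t / 2)) * det (rot i j (t / 2))"
    unfolding det_mul[symmetric] rot_add[symmetric] by simp
  then show ?thesis using det_orthogonal_matrix[OF orthogonal_rot, of i j "t / 2"] by auto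
qed

lemma rot_in_SO: "rot i j t \<in> SO"
  by (simp add: SO_def orthogonal_rot det_rot)

lemma SO_mult: "g \<in> SO \<Longrightarrow> h \<in> SO \<Longrightarrow> g ** h \<in> SO"
  by (simp add: SO_def orthogonal_matrix_mul det_mul)

lemma SO_one: "mat 1 \<in> SO"
  by (simp add: SO_def orthogonal_matrix_id)

lemma rot_2pi: "rot i j (2 * pi) = mat 1"
  by (cases "i = j") (simp_all add: matrix_eq vec_eq_iff rot_mult_vec)

lemma rot_commute:
  assumes "distinct [i, j, k, l]"
  shows "rot i j s ** rot k l t = rot k l t ** rot i j s"
  unfolding matrix_eq using assms
  by (auto simp: vec_eq_iff rot_mult_vec simp flip: matrix_vector_mul_assoc)

lemma arctan_polar:
  assumes "p > 0" "p\<^sup>2 + q\<^sup>2 = c\<^sup>2" "c > 0"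
  shows "c * cos (arctan (q / p)) = p" "c * sin (arctan (q / p)) = q"
proof -
  have "1 + (q / p)\<^sup>2 = (c / p)\<^sup>2"
    using assms by (simp add: field_simps power2_eq_square)
  then have "sqrt (1 + (q / p)\<^sup>2) = c / p" using assms by simp
  then show "c * cos (arctan (q / p)) = p" "c * sin (arctan (q / p)) = q"
    using assms by (simp_all add: cos_arctan sin_arctan)
qed

text \<open>
  Differentiating this Euler angle factorization at \<open>t = 0\<close> and then at \<open>s = 0\<close> yields the bracket
  relations without knowing beforehand that \<open>\<rho>\<close> is smooth or that its derivative is linear.
\<close>

lemma rot_euler:
  assumes ijk: "distinct [i, j, k]" and s: "\<bar>s\<bar> < pi / 2" and t: "\<bar>t\<bar> < pi / 2"
  shows "rot i j s ** rot i k t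
    = rot i k (arctan (tan t * cos s)) ** (rot j k (arcsin (sin t * sin s)) ** rot i j (arctan (tan s * cos t)))"
proof -
  define \<alpha> where "\<alpha> = arctan (tan t * cos s)"
  define \<beta> where "\<beta> = arcsin (sin t * sin s)"
  define \<gamma> where "\<gamma> = arctan (tan s * cos t)"
  have ct: "cos t > 0" and cs: "cos s > 0" using s t by (auto intro: cos_gt_zero_pi)
  have sct: "(sin t)\<^sup>2 = 1 - (cos t)\<^sup>2" and scs: "(sin s)\<^sup>2 = 1 - (cos s)\<^sup>2" by (simp_all add: sin_squared_eq)
  have "\<bar>sin t * sin s\<bar> \<le> 1" unfolding abs_mult by (rule mult_le_one) auto
  then have bd: "-1 \<le> sin t * sin s" "sin t * sin s \<le> 1" by auto
  have sb: "sin \<beta> = sin t * sin s" unfolding \<beta>_def using bd by simp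
  have cb2: "(cos \<beta>)\<^sup>2 = 1 - (sin t * sin s)\<^sup>2" by (simp add: cos_squared_eq sb)
  have "(sin t)\<^sup>2 * (sin s)\<^sup>2 < 1"
  proof -
    have "(sin t)\<^sup>2 * (sin s)\<^sup>2 \<le> (sin t)\<^sup>2 * 1" by (rule mult_left_mono) (auto simp: scs)
    also have "\<dots> < 1" using ct by (simp add: sct)
    finally show ?thesis .
  qed
  then have "(cos \<beta>)\<^sup>2 > 0" by (simp add: cb2 power_mult_distrib)
  moreover have "cos \<beta> \<ge> 0" unfolding \<beta>_def using bd by (intro cos_ge_zero arcsin_lbound arcsin_ubound)
  ultimately have cb: "cos \<beta> > 0" by (auto simp: less_le)
  have pa: "(cos t)\<^sup>2 + (sin t * cos s)\<^sup>2 = (cos \<beta>)\<^sup>2" and pc: "(cos s)\<^sup>2 + (sin s * cos t)\<^sup>2 = (cos \<beta>)\<^sup>2"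
    unfolding cb2 power_mult_distrib sct scs by algebra+
  have \<alpha>: "cos \<beta> * cos \<alpha> = cos t" "cos \<beta> * sin \<alpha> = sin t * cos s"
    using arctan_polar[OF ct pa cb] by (simp_all add: \<alpha>_def tan_def)
  have \<gamma>: "cos \<beta> * cos \<gamma> = cos s" "cos \<beta> * sin \<gamma> = sin s * cos t"
    using arctan_polar[OF cs pc cb] by (simp_all add: \<gamma>_def tan_def)
  \<comment> \<open>After multiplication by the square of cos \<beta>, the angles \<alpha> and
    \<gamma> occur only in products of their sine or cosine with cos \<beta>, which are already
    expressed through s and t.\<close>
  have cancel: "x = y" if "(cos \<beta>)\<^sup>2 * x = (cos \<beta>)\<^sup>2 * y" for x y using that cb by simp
  have 1: "cos \<alpha> * cos \<gamma> - sin \<alpha> * sin \<beta> * sin \<gamma> = cos t * cos s"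
  proof (rule cancel)
    have "(cos \<beta>)\<^sup>2 * (cos \<alpha> * cos \<gamma> - sin \<alpha> * sin \<beta> * sin \<gamma>)
      = (cos \<beta> * cos \<alpha>) * (cos \<beta> * cos \<gamma>) - (cos \<beta> * sin \<alpha>) * sin \<beta> * (cos \<beta> * sin \<gamma>)"
      by (simp add: power2_eq_square algebra_simps)
    then show "(cos \<beta>)\<^sup>2 * (cos \<alpha> * cos \<gamma> - sin \<alpha> * sin \<beta> * sin \<gamma>) = (cos \<beta>)\<^sup>2 * (cos t * cos s)"
      unfolding \<alpha> \<gamma> sb cb2 by (simp add: power2_eq_square algebra_simps)
  qed
  have 2: "cos \<alpha> * sin \<gamma> + sin \<alpha> * sin \<beta> * cos \<gamma> = sin s"
  proof (rule cancel)
    have "(cos \<beta>)\<^sup>2 * (cos \<alpha> * sin \<gamma> + sin \<alpha> * sin \<beta> * cos \<gamma>)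
      = (cos \<beta> * cos \<alpha>) * (cos \<beta> * sin \<gamma>) + (cos \<beta> * sin \<alpha>) * sin \<beta> * (cos \<beta> * cos \<gamma>)"
      by (simp add: power2_eq_square algebra_simps)
    then show "(cos \<beta>)\<^sup>2 * (cos \<alpha> * sin \<gamma> + sin \<alpha> * sin \<beta> * cos \<gamma>) = (cos \<beta>)\<^sup>2 * sin s"
      unfolding \<alpha> \<gamma> sb pa[symmetric] by (simp add: power2_eq_square algebra_simps)
  qed
  have 3: "sin \<alpha> * cos \<gamma> + cos \<alpha> * sin \<beta> * sin \<gamma> = sin t"
  proof (rule cancel)
    have "(cos \<beta>)\<^sup>2 * (sin \<alpha> * cos \<gamma> + cos \<alpha> * sin \<beta> * sin \<gamma>)
      = (cos \<beta> * sin \<alpha>) * (cos \<beta> * cos \<gamma>) + (cos \<beta> * cos \<alpha>) * sin \<beta> * (cos \<beta> * sin \<gamma>)"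
      by (simp add: power2_eq_square algebra_simps)
    then show "(cos \<beta>)\<^sup>2 * (sin \<alpha> * cos \<gamma> + cos \<alpha> * sin \<beta> * sin \<gamma>) = (cos \<beta>)\<^sup>2 * sin t"
      unfolding \<alpha> \<gamma> sb pc[symmetric] by (simp add: power2_eq_square algebra_simps)
  qed
  have 4: "cos \<alpha> * sin \<beta> * cos \<gamma> = sin \<alpha> * sin \<gamma>"
  proof (rule cancel)
    have "(cos \<beta>)\<^sup>2 * (cos \<alpha> * sin \<beta> * cos \<gamma>) = (cos \<beta> * cos \<alpha>) * sin \<beta> * (cos \<beta> * cos \<gamma>)"
      "(cos \<beta>)\<^sup>2 * (sin \<alpha> * sin \<gamma>) = (cos \<beta> * sin \<alpha>) * (cos \<beta> * sin \<gamma>)"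
      by (simp_all add: power2_eq_square algebra_simps)
    then show "(cos \<beta>)\<^sup>2 * (cos \<alpha> * sin \<beta> * cos \<gamma>) = (cos \<beta>)\<^sup>2 * (sin \<alpha> * sin \<gamma>)"
      unfolding \<alpha> \<gamma> sb by (simp add: algebra_simps)
  qed
  have ne: "i \<noteq> j" "i \<noteq> k" "j \<noteq> k" "j \<noteq> i" "k \<noteq> i" "k \<noteq> j" using ijk by auto
  have "rot i j s *v (rot i k t *v x) = rot i k \<alpha> *v (rot j k \<beta> *v (rot i j \<gamma> *v x))" for x
  proof -
    have i: "cos s * (cos t * x $ i - sin t * x $ k) - sin s * x $ j
      = cos \<alpha> * (cos \<gamma> * x $ i - sin \<gamma> * x $ j) - sin \<alpha> * (sin \<beta> * (sin \<gamma> * x $ i + cos \<gamma> * x $ j) + cos \<beta> * x $ k)"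
      using 1 2 \<alpha>(2) by algebra
    have j: "sin s * (cos t * x $ i - sin t * x $ k) + cos s * x $ j
      = cos \<beta> * (sin \<gamma> * x $ i + cos \<gamma> * x $ j) - sin \<beta> * x $ k"
    proof -
      have "cos \<beta> * (sin \<gamma> * x $ i + cos \<gamma> * x $ j) = (cos \<beta> * sin \<gamma>) * x $ i + (cos \<beta> * cos \<gamma>) * x $ j"
        by (simp add: algebra_simps)
      then show ?thesis unfolding \<gamma> sb by (simp add: algebra_simps)
    qed
    have k: "sin t * x $ i + cos t * x $ k
      = sin \<alpha> * (cos \<gamma> * x $ i - sin \<gamma> * x $ j) + cos \<alpha> * (sin \<beta> * (sin \<gamma> * x $ i + cos \<gamma> * x $ j) + cos \<beta> * x $ k)"
    proof -
      have "sin \<alpha> * (cos \<gamma> * x $ i - sin \<gamma> * x $ j) + cos \<alpha> * (sin \<beta> * (sin \<gamma> * x $ i + cos \<gamma> * x $ j) + cos \<beta> * x $ k)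
        = (sin \<alpha> * cos \<gamma> + cos \<alpha> * sin \<beta> * sin \<gamma>) * x $ i
          + (cos \<alpha> * sin \<beta> * cos \<gamma> - sin \<alpha> * sin \<gamma>) * x $ j + (cos \<beta> * cos \<alpha>) * x $ k"
        by (simp add: algebra_simps)
      then show ?thesis unfolding 3 4 \<alpha> by simp
    qed
    show ?thesis
      using ne i j k by (simp add: vec_eq_iff rot_mult_vec)
  qed
  then show ?thesis
    unfolding matrix_eq \<alpha>_def \<beta>_def \<gamma>_def by (simp flip: matrix_vector_mul_assoc)
qed

section \<open>Differentiability of continuous one-parameter groups\<close>

lemma tendsto_det:
  fixes f :: "'a \<Rightarrow> complex^'n^'n"
  shows "(f \<longlongrightarrow> A) F \<Longrightarrow> ((\<lambda>x. det (f x)) \<longlongrightarrow> det A) F"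
  unfolding det_def by (intro tendsto_intros)

text \<open>
  For small \<open>h > 0\<close> the matrix \<open>J = 1/h \<integral>\<^sub>0\<^sup>h \<phi>\<close> is invertible, and \<open>\<phi> t J\<close> is the mean of \<open>\<phi>\<close> over
  \<open>[t, t + h]\<close>, which is differentiable in \<open>t\<close>.
\<close>

lemma one_parameter_group_derivative:
  fixes \<phi> :: "real \<Rightarrow> complex^'m^'m"
  assumes cont: "continuous_on UNIV \<phi>" and add: "\<And>s t. \<phi> (s + t) = \<phi> s ** \<phi> t" and zero: "\<phi> 0 = mat 1"
  shows "\<exists>X. \<forall>t. (\<phi> has_vector_derivative X ** \<phi> t) (at t)"
proof -
  \<comment> \<open>The base point -1 makes 0 an interior point, so that \<open>G\<close> has a
    two-sided derivative there.\<close>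
  define G where "G u = integral {-1..u} \<phi>" for u
  have cont': "continuous_on A \<phi>" for A using cont continuous_on_subset by blast
  have int: "\<phi> integrable_on {a..b}" for a b by (rule integrable_continuous_real[OF cont'])
  have G: "(G has_vector_derivative \<phi> u) (at u)" if "u > -1" for u
  proof -
    have "(G has_vector_derivative \<phi> u) (at u within {-1..u + 1})"
      unfolding G_def using that by (intro integral_has_vector_derivative cont') auto
    then have "(G has_vector_derivative \<phi> u) (at u within {-1<..<u + 1})"
      by (rule has_vector_derivative_within_subset) auto
    then show ?thesis using that by (simp add: at_within_open[of u "{-1<..<u + 1}"])
  qed
  have Gdiff: "integral {a..b} \<phi> = G b - G a" if "-1 \<le> a" "a \<le> b" for a b
    unfolding G_def using Henstock_Kurzweil_Integration.integral_combine[OF that int] by (simp add: algebra_simps)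
  have "((\<lambda>h. norm ((G h - G 0) /\<^sub>R h - mat 1)) \<longlongrightarrow> 0) (at 0)"
  proof (rule Lim_transform_eventually)
    show "((\<lambda>h. norm (G h - G 0 - (h - 0) *\<^sub>R \<phi> 0) / norm (h - 0)) \<longlongrightarrow> 0) (at 0)"
      using G[of 0] unfolding has_vector_derivative_def has_derivative_iff_norm by simp
    have "norm (G h - G 0 - (h - 0) *\<^sub>R \<phi> 0) / norm (h - 0) = norm ((G h - G 0) /\<^sub>R h - mat 1)" if "h \<noteq> 0" for h
    proof -
      have "(G h - G 0) /\<^sub>R h - mat 1 = (G h - G 0 - h *\<^sub>R mat 1) /\<^sub>R h"
        using that by (simp add: scaleR_diff_right)
      then show ?thesis by (simp add: zero divide_inverse mult.commute)
    qed
    then show "\<forall>\<^sub>F h in at 0. norm (G h - G 0 - (h - 0) *\<^sub>R \<phi> 0) / norm (h - 0) = norm ((G h - G 0) /\<^sub>R h - mat 1)"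
      by (auto simp: eventually_at_filter)
  qed
  then have lim: "((\<lambda>h. (G h - G 0) /\<^sub>R h) \<longlongrightarrow> mat 1) (at 0)"
    by (simp only: tendsto_norm_zero_iff Lim_null[symmetric])
  have "((\<lambda>h. det ((G h - G 0) /\<^sub>R h)) \<longlongrightarrow> 1) (at_right 0)"
    using tendsto_det[OF filterlim_mono[OF lim order_refl at_le[OF subset_UNIV]]] by simp
  then have "eventually (\<lambda>h. det ((G h - G 0) /\<^sub>R h) \<noteq> 0) (at_right 0)"
    by (rule tendsto_imp_eventually_ne) simp
  then obtain b where "b > 0" "\<forall>h>0. h < b \<longrightarrow> det ((G h - G 0) /\<^sub>R h) \<noteq> 0"
    unfolding eventually_at_right_field by blast
  then obtain h where h: "h > 0" "det ((G h - G 0) /\<^sub>R h) \<noteq> 0"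
    using dense by blast
  define J where "J = (G h - G 0) /\<^sub>R h"
  obtain K where K: "J ** K = mat 1"
    using h(2) unfolding J_def[symmetric] invertible_det_nz[symmetric] invertible_def by blast
  have shift: "\<phi> t ** J = (G (t + h) - G t) /\<^sub>R h" if "t > -1" for t
  proof -
    have "\<phi> t ** (G h - G 0) = \<phi> t ** integral {0..h} \<phi>" using Gdiff[of 0 h] h by simp
    also have "\<dots> = integral {0..h} (\<lambda>s. \<phi> t ** \<phi> s)"
      using integral_linear[OF int bounded_bilinear.bounded_linear_right[OF bounded_bilinear_matrix_mult], of 0 h "\<phi> t"]
      by (simp add: o_def)
    also have "\<dots> = integral {0..h} (\<phi> \<circ> (\<lambda>s. s + t))"
      by (simp add: o_def add[symmetric] add.commute)
    also have "\<dots> = integral {0 + t..h + t} \<phi>" by (rule integral_shift[OF cont'])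
    also have "\<dots> = G (t + h) - G t" using Gdiff[of t "t + h"] that h by (simp add: add.commute)
    finally show ?thesis by (simp add: J_def matrix_mult_linear)
  qed
  define F where "F t = ((G (t + h) - G t) /\<^sub>R h) ** K" for t
  have \<phi>F: "\<phi> t = F t" if "t > -1" for t
    unfolding F_def shift[OF that, symmetric] matrix_mul_assoc[symmetric] K by simp
  define X where "X = ((\<phi> h - \<phi> 0) /\<^sub>R h) ** K"
  have Gh: "((\<lambda>t. G (t + h)) has_vector_derivative \<phi> h) (at 0)"
  proof -
    have "((G \<circ> (\<lambda>t. t + h)) has_vector_derivative 1 *\<^sub>R \<phi> h) (at 0)"
      using G[of h] h by (intro vector_diff_chain_at) (auto intro!: derivative_eq_intros)
    then show ?thesis by (simp add: o_def)
  qed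
  have "(F has_vector_derivative X) (at 0)"
    unfolding F_def X_def
    by (intro has_vector_derivative_mult_left bounded_linear.has_vector_derivative[OF bounded_linear_scaleR_right]
        has_vector_derivative_diff Gh G) simp
  then have d0: "(\<phi> has_vector_derivative X) (at 0)"
    by (rule has_vector_derivative_transform_within_open[of _ _ _ "{-1<..}"]) (use \<phi>F in auto)
  \<comment> \<open>The group law \<phi> u = \<phi> (u - t) \<phi> t carries the derivative from 0
    to t.\<close>
  have "(\<phi> has_vector_derivative X ** \<phi> t) (at t)" for t
  proof -
    have "((\<phi> \<circ> (\<lambda>u. u - t)) has_vector_derivative 1 *\<^sub>R X) (at t)"
      using d0 by (intro vector_diff_chain_at) (auto intro!: derivative_eq_intros)
    then have "((\<lambda>u. \<phi> (u - t) ** \<phi> t) has_vector_derivative X ** \<phi> t) (at t)"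
      by (intro has_vector_derivative_mult_left) (simp add: o_def)
    then show ?thesis by (simp flip: add)
  qed
  then show ?thesis by blast
qed

section \<open>Bracket relations of the infinitesimal action\<close>

locale so_representation =
  fixes \<rho> :: "real^'n^'n \<Rightarrow> complex^'m^'m"
  assumes rep: "so_rep \<rho>"
begin

lemma rho_mult: "g \<in> SO \<Longrightarrow> h \<in> SO \<Longrightarrow> \<rho> (g ** h) = \<rho> g ** \<rho> h"
  and rho_one: "\<rho> (mat 1) = mat 1"
  and rho_continuous: "continuous_on SO \<rho>"
  using rep by (auto simp: so_rep_def)

lemma continuous_rot: "continuous_on UNIV (\<lambda>t. \<rho> (rot i j t))"
proof (rule continuous_on_compose2[OF rho_continuous])
  show "continuous_on UNIV (rot i j)"
    unfolding rot_def
  proof (intro continuous_on_vec_lambda)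
    fix a b
    show "continuous_on UNIV (\<lambda>t. if i = j then (if a = b then 1 else 0)
      else if (a = i \<and> b = i) \<or> (a = j \<and> b = j) then cos t
      else if a = i \<and> b = j then - sin t else if a = j \<and> b = i then sin t
      else if a = b then 1 else 0 :: real)"
      by (cases "i = j"; cases "a = i"; cases "a = j"; cases "b = i"; cases "b = j"; cases "a = b")
         (simp_all add: continuous_intros)
  qed
qed (auto simp: rot_in_SO)

text \<open>\<open>lie_act\<close> is defined by the total operator
  \<open>vector_derivative\<close>; here it becomes a genuine derivative, and the curve solves a
  linear differential equation at every t.\<close>

lemma rho_rot_derivative:
  "((\<lambda>t. \<rho> (rot i j t)) has_vector_derivative lie_act \<rho> i j ** \<rho> (rot i j t)) (at t)"
proof -
  obtain X where X: "\<And>t. ((\<lambda>t. \<rho> (rot i j t)) has_vector_derivative X ** \<rho> (rot i j t)) (at t)"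
    using one_parameter_group_derivative[OF continuous_rot[of i j]]
    by (auto simp: rot_add rho_mult rot_in_SO rho_one)
  have "lie_act \<rho> i j = X"
    unfolding lie_act_def using X[of 0] by (simp add: vector_derivative_at rho_one)
  then show ?thesis using X by simp
qed

lemma rho_rot_derivative_0: "((\<lambda>t. \<rho> (rot i j t)) has_vector_derivative lie_act \<rho> i j) (at 0)"
  using rho_rot_derivative[of i j 0] by (simp add: rho_one)

lemma lie_act_swap: "lie_act \<rho> j i = - lie_act \<rho> i j"
proof -
  have "(((\<lambda>t. \<rho> (rot i j t)) \<circ> uminus) has_vector_derivative (-1) *\<^sub>R lie_act \<rho> i j) (at 0)"
    using rho_rot_derivative_0[of i j] by (intro vector_diff_chain_at) (auto intro!: derivative_eq_intros)
  then have "((\<lambda>t. \<rho> (rot j i t)) has_vector_derivative - lie_act \<rho> i j) (at 0)"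
    by (simp add: o_def rot_swap[of j i])
  then show ?thesis unfolding lie_act_def[of _ j i] by (rule vector_derivative_at)
qed

text \<open>The commutation of the two rotations is differentiated first in t and then in s, each
  time comparing two derivatives of one curve.\<close>

lemma lie_act_commute:
  assumes "distinct [i, j, k, l]"
  shows "lie_act \<rho> i j ** lie_act \<rho> k l = lie_act \<rho> k l ** lie_act \<rho> i j"
proof -
  have comm: "\<rho> (rot i j s) ** \<rho> (rot k l t) = \<rho> (rot k l t) ** \<rho> (rot i j s)" for s t
    using rot_commute[OF assms] by (simp add: rot_in_SO flip: rho_mult)
  have "\<rho> (rot i j s) ** lie_act \<rho> k l = lie_act \<rho> k l ** \<rho> (rot i j s)" for s
    using has_vector_derivative_mult_right[OF rho_rot_derivative_0[of k l], of "\<rho> (rot i j s)"]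
      has_vector_derivative_mult_left[OF rho_rot_derivative_0[of k l], of "\<rho> (rot i j s)"]
    unfolding comm by (rule vector_derivative_unique_at)
  then show ?thesis
    using has_vector_derivative_mult_left[OF rho_rot_derivative_0[of i j], of "lie_act \<rho> k l"]
      has_vector_derivative_mult_right[OF rho_rot_derivative_0[of i j], of "lie_act \<rho> k l"]
    by (simp add: vector_derivative_unique_at)
qed

lemma rho_rot_chain:
  assumes "(f has_real_derivative r) (at t)"
  shows "((\<lambda>t. \<rho> (rot i j (f t))) has_vector_derivative r *\<^sub>R (lie_act \<rho> i j ** \<rho> (rot i j (f t)))) (at t)"
  using vector_diff_chain_at[of f r t "\<lambda>u. \<rho> (rot i j u)", OF _ rho_rot_derivative] assms
  by (simp add: has_real_derivative_iff_has_vector_derivative o_def)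

lemma lie_act_bracket:
  assumes "distinct [i, j, k]"
  shows "lie_act \<rho> i j ** lie_act \<rho> i k = lie_act \<rho> i k ** lie_act \<rho> i j + lie_act \<rho> j k"
proof -
  let ?I = "{- pi / 2 <..< pi / 2}"
  have euler: "\<rho> (rot i j s) ** \<rho> (rot i k t) = \<rho> (rot i k (arctan (tan t * cos s))) **
      (\<rho> (rot j k (arcsin (sin t * sin s))) ** \<rho> (rot i j (arctan (tan s * cos t))))"
    if "s \<in> ?I" "t \<in> ?I" for s t
  proof -
    have "rot i j s ** rot i k t
      = rot i k (arctan (tan t * cos s)) ** (rot j k (arcsin (sin t * sin s)) ** rot i j (arctan (tan s * cos t)))"
      using that by (intro rot_euler[OF assms]) auto
    then show ?thesis
      by (simp add: rho_mult[symmetric] rot_in_SO SO_mult)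
  qed
  \<comment> \<open>At t = 0 the Euler angles have values 0, 0, s and derivatives cos s, sin s, 0.
    The result is the adjoint action of the rotation, sending X_ik to cos s X_ik + sin s
    X_jk.\<close>
  have first: "\<rho> (rot i j s) ** lie_act \<rho> i k
    = cos s *\<^sub>R (lie_act \<rho> i k ** \<rho> (rot i j s)) + sin s *\<^sub>R (lie_act \<rho> j k ** \<rho> (rot i j s))"
    if s: "s \<in> ?I" for s
  proof -
    have a0: "arctan (tan s) = s" using s by (intro arctan_tan) auto
    have A: "((\<lambda>t. \<rho> (rot i k (arctan (tan t * cos s)))) has_vector_derivative cos s *\<^sub>R lie_act \<rho> i k) (at 0)"
    proof -
      have "((\<lambda>t. arctan (tan t * cos s)) has_real_derivative cos s) (at 0)"
        by (auto intro!: derivative_eq_intros)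
      from rho_rot_chain[OF this, of i k] show ?thesis by (simp add: rho_one)
    qed
    have B: "((\<lambda>t. \<rho> (rot j k (arcsin (sin t * sin s)))) has_vector_derivative sin s *\<^sub>R lie_act \<rho> j k) (at 0)"
    proof -
      have "((\<lambda>t. arcsin (sin t * sin s)) has_real_derivative sin s) (at 0)"
        by (auto intro!: derivative_eq_intros)
      from rho_rot_chain[OF this, of j k] show ?thesis by (simp add: rho_one)
    qed
    have C: "((\<lambda>t. \<rho> (rot i j (arctan (tan s * cos t)))) has_vector_derivative 0) (at 0)"
    proof -
      have "((\<lambda>t. arctan (tan s * cos t)) has_real_derivative 0) (at 0)"
        by (auto intro!: derivative_eq_intros)
      from rho_rot_chain[OF this, of i j] show ?thesis by simp
    qed
    have "((\<lambda>t. \<rho> (rot i j s) ** \<rho> (rot i k t)) has_vector_derivative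
        cos s *\<^sub>R (lie_act \<rho> i k ** \<rho> (rot i j s)) + sin s *\<^sub>R (lie_act \<rho> j k ** \<rho> (rot i j s))) (at 0)"
    proof (rule has_vector_derivative_transform_within_open[of _ _ _ ?I])
      show "((\<lambda>t. \<rho> (rot i k (arctan (tan t * cos s))) **
          (\<rho> (rot j k (arcsin (sin t * sin s))) ** \<rho> (rot i j (arctan (tan s * cos t)))))
        has_vector_derivative
          cos s *\<^sub>R (lie_act \<rho> i k ** \<rho> (rot i j s)) + sin s *\<^sub>R (lie_act \<rho> j k ** \<rho> (rot i j s))) (at 0)"
        using has_vector_derivative_matrix_mult[OF A has_vector_derivative_matrix_mult[OF B C]]
        by (simp add: matrix_mult_linear rho_one a0 add.commute)
    qed (use euler s in auto)
    then show ?thesis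
      using has_vector_derivative_mult_right[OF rho_rot_derivative_0[of i k], of "\<rho> (rot i j s)"]
        vector_derivative_unique_at by blast
  qed
  have "((\<lambda>s. cos s *\<^sub>R (lie_act \<rho> i k ** \<rho> (rot i j s)) + sin s *\<^sub>R (lie_act \<rho> j k ** \<rho> (rot i j s)))
      has_vector_derivative lie_act \<rho> i k ** lie_act \<rho> i j + lie_act \<rho> j k) (at 0)"
    using has_vector_derivative_add[OF
        has_vector_derivative_scaleR[OF DERIV_cos[of 0] has_vector_derivative_mult_right[OF rho_rot_derivative_0[of i j], of "lie_act \<rho> i k"]]
        has_vector_derivative_scaleR[OF DERIV_sin[of 0] has_vector_derivative_mult_right[OF rho_rot_derivative_0[of i j], of "lie_act \<rho> j k"]]]
    by (simp add: rho_one)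
  moreover have "((\<lambda>s. cos s *\<^sub>R (lie_act \<rho> i k ** \<rho> (rot i j s)) + sin s *\<^sub>R (lie_act \<rho> j k ** \<rho> (rot i j s)))
      has_vector_derivative lie_act \<rho> i j ** lie_act \<rho> i k) (at 0)"
  proof (rule has_vector_derivative_transform_within_open)
    show "((\<lambda>s. \<rho> (rot i j s) ** lie_act \<rho> i k) has_vector_derivative lie_act \<rho> i j ** lie_act \<rho> i k) (at 0)"
      by (rule has_vector_derivative_mult_left[OF rho_rot_derivative_0])
    show "open ?I" "0 \<in> ?I" by auto
  qed (rule first)
  ultimately show ?thesis by (rule vector_derivative_unique_at[symmetric])
qed

end

section \<open>Generation of the special orthogonal group by plane rotations\<close>

inductive_set rotgen :: "(real^'n^'n) set" where
  rotgen_one: "mat 1 \<in> rotgen"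
| rotgen_step: "g \<in> rotgen \<Longrightarrow> rot i j t ** g \<in> rotgen"

lemma rotgen_SO: "g \<in> rotgen \<Longrightarrow> g \<in> SO"
  by (induction rule: rotgen.induct) (auto simp: SO_one SO_mult rot_in_SO)

text \<open>The second clause lets a matrix \<open>r\<close> be cancelled in proofs that a product is generated by rotations.\<close>

definition givens :: "'n set \<Rightarrow> real^'n^'n \<Rightarrow> bool" where
  "givens S r \<longleftrightarrow> r \<in> SO \<and> (\<forall>h. r ** h \<in> rotgen \<longrightarrow> h \<in> rotgen)
    \<and> (\<forall>i. i \<notin> S \<longrightarrow> r *v axis i 1 = axis i 1)"

lemma givens_one: "givens S (mat 1)"
  by (simp add: givens_def SO_one)

lemma givens_mult:
  assumes "givens S r" "givens S r'"
  shows "givens S (r ** r')"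
  unfolding givens_def
proof (intro conjI allI impI)
  show "r ** r' \<in> SO" using assms by (simp add: givens_def SO_mult)
  fix h assume "r ** r' ** h \<in> rotgen"
  then have "r ** (r' ** h) \<in> rotgen" by (simp only: matrix_mul_assoc)
  then show "h \<in> rotgen" using assms unfolding givens_def by blast
next
  fix i assume "i \<notin> S"
  then show "r ** r' *v axis i 1 = axis i 1"
    using assms unfolding givens_def matrix_vector_mul_assoc[symmetric] by metis
qed

lemma givens_mono: "S \<subseteq> S' \<Longrightarrow> givens S r \<Longrightarrow> givens S' r"
  unfolding givens_def by blast

lemma givens_rot:
  assumes "p \<in> S" "q \<in> S" "p \<noteq> q"
  shows "givens S (rot p q t)"
  unfolding givens_def
proof (intro conjI allI impI)
  fix h assume "rot p q t ** h \<in> rotgen"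
  then have "rot p q (- t) ** (rot p q t ** h) \<in> rotgen" by (rule rotgen_step)
  then show "h \<in> rotgen" by (simp add: matrix_mul_assoc flip: rot_add)
next
  fix i assume "i \<notin> S"
  then show "rot p q t *v axis i 1 = axis i 1"
    using assms by (auto simp: vec_eq_iff rot_mult_vec axis_def)
qed (rule rot_in_SO)

text \<open>Rotates (x, y) by minus its polar angle onto the nonnegative first axis. The polar form
  may have negative radius, which a half-turn corrects.\<close>

lemma plane_angle: "\<exists>t. sin t * x + cos t * y = 0 \<and> cos t * x - sin t * y \<ge> (0::real)"
proof -
  obtain r a where ra: "x = r * cos a" "y = r * sin a" using polar_Ex by blast
  have sq: "r * (cos a * cos a) + r * (sin a * sin a) = r"
    by (metis distrib_left mult.right_neutral power2_eq_square sin_cos_squared_add2)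
  show ?thesis
  proof (cases "r \<ge> 0")
    case True
    then show ?thesis using ra sq
      by (intro exI[of _ "- a"]) (simp add: algebra_simps)
  next
    case False
    then show ?thesis using ra sq
      by (intro exI[of _ "pi - a"]) (simp add: sin_diff cos_diff algebra_simps)
  qed
qed

text \<open>A rotation in the plane of p and q clears coordinate q. Keeping coordinate p nonnegative
  leaves no sign open at the end.\<close>

lemma givens_reduce:
  fixes w :: "real^'n"
  assumes "finite F" "p \<notin> F" "w $ p \<ge> 0" "\<And>i. i \<notin> insert p F \<Longrightarrow> w $ i = 0"
  shows "\<exists>r c. givens (insert p F) r \<and> c \<ge> 0 \<and> r *v w = axis p c"
  using assms
proof (induction F arbitrary: w rule: finite_induct)
  case empty
  have "w = axis p (w $ p)" using empty(3) by (auto simp: vec_eq_iff axis_def)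
  then show ?case using empty givens_one by (metis matrix_vector_mul_lid)
next
  case (insert q F)
  have pq: "p \<noteq> q" using insert by auto
  obtain t where t: "sin t * w $ p + cos t * w $ q = 0" "cos t * w $ p - sin t * w $ q \<ge> 0"
    using plane_angle by blast
  let ?w = "rot p q t *v w"
  have "?w $ p \<ge> 0" using t pq by (simp add: rot_mult_vec)
  moreover have "?w $ i = 0" if "i \<notin> insert p F" for i
    using t pq insert.prems that by (auto simp: rot_mult_vec)
  ultimately obtain r c where r: "givens (insert p F) r" "c \<ge> 0" "r *v ?w = axis p c"
    using insert.IH[of ?w] insert.prems(1) by blast
  have "givens (insert p (insert q F)) (r ** rot p q t)"
    using givens_mono[OF _ r(1)] givens_rot[OF _ _ pq] by (intro givens_mult) auto
  then show ?case using r by (metis matrix_vector_mul_assoc)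
qed

lemma matrix_eq_axis:
  fixes A B :: "real^'n^'m"
  assumes "\<And>i. A *v axis i 1 = B *v axis i 1"
  shows "A = B"
  using assms by (simp add: matrix_vector_mult_basis vec_eq_iff column_def)

lemma SO_inner:
  assumes "g \<in> SO"
  shows "(g *v x) \<bullet> (g *v y) = x \<bullet> y"
proof -
  have "orthogonal_transformation ((*v) g)"
    using assms by (simp add: SO_def orthogonal_transformation_matrix)
  then show ?thesis by (simp add: orthogonal_transformation_def)
qed

text \<open>\<open>F\<close> contains the axes that \<open>g\<close> may move. Rotations bring the
  image of axis \<open>p\<close> back to axis \<open>p\<close> without touching the axes outside,
  and the product moves one axis fewer.\<close>

lemma rotgen_complete_aux:
  fixes g :: "real^'n^'n"
  assumes "finite F" "g \<in> SO" "\<And>i. i \<notin> F \<Longrightarrow> g *v axis i 1 = axis i 1"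
  shows "g \<in> rotgen"
  using assms
proof (induction F arbitrary: g rule: finite_induct)
  case empty
  then have "g = mat 1" by (intro matrix_eq_axis) simp
  then show ?case by (simp add: rotgen_one)
next
  case (insert p F)
  define w where "w = g *v axis p 1"
  have w0: "w $ i = 0" if "i \<notin> insert p F" for i
  proof -
    have "w $ i = w \<bullet> axis i 1" by (simp add: inner_axis)
    also have "\<dots> = (g *v axis p 1) \<bullet> (g *v axis i 1)" using insert.prems that by (simp add: w_def)
    also have "\<dots> = axis p 1 \<bullet> (axis i 1 :: real^'n)" using SO_inner insert.prems by blast
    also have "\<dots> = 0" using that by (auto simp: inner_axis_axis)
    finally show ?thesis .
  qed
  have nw: "w \<bullet> w = 1"
    using SO_inner[OF insert.prems(1), of "axis p 1" "axis p 1"] by (simp add: w_def inner_axis_axis)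
  show ?case
  \<comment> \<open>With a single movable axis no rotation is available: \<open>g\<close> is
    diagonal with one open entry, and determinant 1 fixes it.\<close>
  proof (cases "F = {}")
    case True
    have w: "w = axis p (w $ p)" using w0 True by (auto simp: vec_eq_iff axis_def)
    have col: "g $ i $ j = (if j = p then w $ i else if i = j then 1 else 0)" for i j
    proof -
      have "g $ i $ j = (g *v axis j 1) $ i" by (simp add: matrix_vector_mult_basis column_def)
      then show ?thesis using insert.prems(2)[of j] True by (auto simp: w_def axis_def)
    qed
    have "det g = (\<Prod>i\<in>UNIV. g $ i $ i)"
      by (rule det_diagonal) (use col w0 True in auto)
    also have "\<dots> = g $ p $ p * (\<Prod>i\<in>UNIV - {p}. g $ i $ i)" by (simp add: prod.remove)
    also have "(\<Prod>i\<in>UNIV - {p}. g $ i $ i) = 1" by (rule prod.neutral) (simp add: col)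
    finally have "w $ p = 1" using insert.prems(1) col[of p p] by (simp add: SO_def)
    then have "g *v axis i 1 = axis i 1" for i
      using w insert.prems(2)[of i] True by (cases "i = p") (auto simp: w_def)
    then have "g = mat 1" by (intro matrix_eq_axis) simp
    then show ?thesis by (simp add: rotgen_one)
  next
    case False
    then obtain q where q: "q \<in> F" by blast
    then have pq: "p \<noteq> q" using insert by auto
    obtain r0 where r0: "givens (insert p F) r0" "(r0 *v w) $ p \<ge> 0"
      "\<And>i. i \<notin> insert p F \<Longrightarrow> (r0 *v w) $ i = 0"
    proof (cases "w $ p \<ge> 0")
      case True
      then show ?thesis using that[OF givens_one] w0 by simp
    next
      case False
      \<comment> \<open>A half-turn reverses the sign of coordinate p, which the reduction requires
        to be nonnegative.\<close>
      have "givens (insert p F) (rot p q pi)" using givens_rot[OF _ _ pq] q by blast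
      moreover have "(rot p q pi *v w) $ p \<ge> 0" using False pq by (simp add: rot_mult_vec)
      moreover have "(rot p q pi *v w) $ i = 0" if "i \<notin> insert p F" for i
        using pq q w0 that by (auto simp: rot_mult_vec)
      ultimately show ?thesis using that by blast
    qed
    obtain r c where r: "givens (insert p F) r" "c \<ge> 0" "r *v (r0 *v w) = axis p c"
      using givens_reduce[OF insert.hyps r0(2,3)] by blast
    let ?r = "r ** r0"
    have gr: "givens (insert p F) ?r" using r r0 by (intro givens_mult)
    then have rSO: "?r \<in> SO" by (simp add: givens_def)
    have rw: "?r *v w = axis p c" using r(3) by (simp add: matrix_vector_mul_assoc)
    have "axis p c \<bullet> axis p c = (1::real)" using SO_inner[OF rSO, of w w] nw by (simp add: rw)
    then have "c = 1" using r(2) by (simp add: inner_axis_axis abs_square_eq_1 flip: power2_eq_square)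
    have "?r ** g \<in> rotgen"
    proof (rule insert.IH)
      show "?r ** g \<in> SO" using SO_mult[OF rSO insert.prems(1)] .
      fix i assume "i \<notin> F"
      then show "?r ** g *v axis i 1 = axis i 1"
        using insert.prems(2)[of i] gr rw \<open>c = 1\<close> unfolding givens_def w_def
        by (cases "i = p") (auto simp: matrix_vector_mul_assoc[symmetric])
    qed
    then show ?thesis using gr unfolding givens_def by blast
  qed
qed

lemma SO_eq_rotgen: "SO = rotgen"
  using rotgen_complete_aux[of UNIV] rotgen_SO by auto

section \<open>From invariance under the Lie algebra to invariance under the group\<close>

text \<open>Gronwall's argument: if K bounds the operator \<open>Y\<close>, then exp(-2 K t) times
  the squared norm of \<psi> is nonincreasing, nonnegative and initially zero.\<close>

lemma linear_ode_zero:
  fixes \<psi> :: "real \<Rightarrow> complex^'m"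
  assumes d: "\<And>t. (\<psi> has_vector_derivative Y *v \<psi> t) (at t)" and "\<psi> 0 = 0" "t \<ge> 0"
  shows "\<psi> t = 0"
proof -
  obtain K where K: "\<And>x. norm (Y *v x) \<le> norm x * K"
    using bounded_linear.bounded[OF matrix_vector_mul_bounded_linear[of Y]] by blast
  define g where "g t = exp (- 2 * K * t) * (\<psi> t \<bullet> \<psi> t)" for t
  have g': "(g has_real_derivative exp (- 2 * K * t) * (2 * (\<psi> t \<bullet> (Y *v \<psi> t)) - 2 * K * (\<psi> t \<bullet> \<psi> t))) (at t)" for t
  proof -
    have "((\<lambda>t. \<psi> t \<bullet> \<psi> t) has_real_derivative 2 * (\<psi> t \<bullet> (Y *v \<psi> t))) (at t)"
      using bounded_bilinear.has_vector_derivative[OF bounded_bilinear_inner d d, of t]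
      by (simp add: has_real_derivative_iff_has_vector_derivative inner_commute)
    moreover have "((\<lambda>t. exp (- 2 * K * t)) has_real_derivative - 2 * K * exp (- 2 * K * t)) (at t)"
      by (auto intro!: derivative_eq_intros)
    ultimately have "(g has_real_derivative (- 2 * K * exp (- 2 * K * t)) * (\<psi> t \<bullet> \<psi> t)
        + 2 * (\<psi> t \<bullet> (Y *v \<psi> t)) * exp (- 2 * K * t)) (at t)"
      unfolding g_def by (intro DERIV_mult)
    then show ?thesis by (rule DERIV_cong) (simp add: right_diff_distrib)
  qed
  have neg: "exp (- 2 * K * t) * (2 * (\<psi> t \<bullet> (Y *v \<psi> t)) - 2 * K * (\<psi> t \<bullet> \<psi> t)) \<le> 0" for t
  proof -
    have "\<psi> t \<bullet> (Y *v \<psi> t) \<le> norm (\<psi> t) * (norm (\<psi> t) * K)"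
      by (rule order_trans[OF norm_cauchy_schwarz mult_left_mono[OF K]]) simp
    also have "\<dots> = K * (\<psi> t \<bullet> \<psi> t)"
      by (simp add: dot_square_norm power2_eq_square)
    finally show ?thesis by (simp add: mult_le_0_iff)
  qed
  have "g t \<le> g 0"
    by (rule DERIV_nonpos_imp_nonincreasing[OF \<open>t \<ge> 0\<close>]) (rule exI conjI g' neg)+
  then have "\<psi> t \<bullet> \<psi> t \<le> 0" using assms(2) by (simp add: g_def mult_le_0_iff)
  then show ?thesis by (metis inner_ge_zero inner_eq_zero_iff order_antisym)
qed

context so_representation
begin

text \<open>For a projection P onto \<open>W\<close> and Q = 1 - P, invariance gives Q X P = 0,
  hence Q X = (Q X) Q. So the component of the orbit outside \<open>W\<close> solves a linear
  equation with initial value zero.\<close>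

lemma rho_rot_invariant:
  assumes W: "vec.subspace W" "\<And>w. w \<in> W \<Longrightarrow> lie_act \<rho> i j *v w \<in> W" and "w \<in> W" "t \<ge> 0"
  shows "\<rho> (rot i j t) *v w \<in> W"
proof -
  obtain P where P: "range P \<subseteq> W" "Vector_Spaces.linear (*s) (*s) P" "\<And>v. v \<in> W \<Longrightarrow> P v = v"
    using vec.linear_exists_left_inverse_on[OF vec.linear_id W(1)] by auto
  define M where "M = matrix P"
  have M: "M *v x = P x" for x unfolding M_def by (rule matrix_works[OF P(2)])
  define X where "X = lie_act \<rho> i j"
  define Q where "Q = mat 1 - M"
  have Q: "Q *v x = x - P x" for x by (simp add: Q_def M matrix_vector_mult_diff_rdistrib)
  define \<psi> where "\<psi> t = Q *v (\<rho> (rot i j t) *v w)" for t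
  have QX: "Q *v (X *v u) = (Q ** X) *v (Q *v u)" for u
  proof -
    have "X *v P u \<in> W" using P(1) W(2) by (auto simp: X_def)
    then have "Q *v (X *v P u) = 0" using P(3) by (simp add: Q)
    moreover have "Q *v (X *v u) = Q *v (X *v (Q *v u)) + Q *v (X *v P u)"
      by (simp add: Q[of u] matrix_vector_mult_diff_distrib)
    ultimately show ?thesis by (simp add: matrix_vector_mul_assoc matrix_mul_assoc)
  qed
  have "(\<psi> has_vector_derivative (Q ** X) *v \<psi> t) (at t)" for t
  proof -
    have "((\<lambda>t. \<rho> (rot i j t) *v w) has_vector_derivative (X ** \<rho> (rot i j t)) *v w) (at t)"
      unfolding X_def
      by (rule bounded_linear.has_vector_derivative[OF
          bounded_bilinear.bounded_linear_left[OF bounded_bilinear_matrix_vector_mult] rho_rot_derivative])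
    then have "(\<psi> has_vector_derivative Q *v ((X ** \<rho> (rot i j t)) *v w)) (at t)"
      unfolding \<psi>_def
      by (rule bounded_linear.has_vector_derivative[OF matrix_vector_mul_bounded_linear])
    also have "Q *v ((X ** \<rho> (rot i j t)) *v w) = (Q ** X) *v \<psi> t"
      unfolding matrix_vector_mul_assoc[symmetric, of X] QX \<psi>_def ..
    finally show ?thesis .
  qed
  moreover have "\<psi> 0 = 0" using \<open>w \<in> W\<close> P(3) by (simp add: \<psi>_def rho_one Q)
  ultimately have "\<psi> t = 0" using \<open>t \<ge> 0\<close> by (rule linear_ode_zero)
  then have "\<rho> (rot i j t) *v w = P (\<rho> (rot i j t) *v w)" by (simp add: \<psi>_def Q)
  then show ?thesis using P(1) by (metis rangeI subsetD)
qed

lemma rho_invariant: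
  assumes W: "vec.subspace W" "\<And>i j w. w \<in> W \<Longrightarrow> lie_act \<rho> i j *v w \<in> W" and "g \<in> SO" "w \<in> W"
  shows "\<rho> g *v w \<in> W"
  using \<open>g \<in> SO\<close> unfolding SO_eq_rotgen
proof (induction rule: rotgen.induct)
  case rotgen_one
  then show ?case using \<open>w \<in> W\<close> by (simp add: rho_one)
next
  case (rotgen_step g i j t)
  have "\<rho> (rot i j t) *v (\<rho> g *v w) \<in> W"
  proof (cases "t \<ge> 0")
    case True
    then show ?thesis using rho_rot_invariant[OF W rotgen_step.IH] by blast
  next
    case False
    \<comment> \<open>A negative angle is a positive one with the two axes exchanged.\<close>
    then have "\<rho> (rot j i (- t)) *v (\<rho> g *v w) \<in> W"
      using rho_rot_invariant[OF W rotgen_step.IH] by simp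
    then show ?thesis using rot_swap[of j i "- t"] by simp
  qed
  then show ?case
    using rotgen_step.hyps by (simp add: rho_mult rot_in_SO rotgen_SO matrix_vector_mul_assoc)
qed

end

section \<open>From coefficient functions to polynomial functions\<close>

definition evalp :: "nat \<Rightarrow> (('n::finite \<Rightarrow> nat) \<Rightarrow> complex) \<Rightarrow> real^'n \<Rightarrow> complex" where
  "evalp N c x = (\<Sum>\<alpha>\<in>{\<alpha>. sum \<alpha> UNIV = N}. c \<alpha> * monomial \<alpha> x)"

lemma evalp_linear:
  "evalp N (c + d) x = evalp N c x + evalp N d x"
  "evalp N (c - d) x = evalp N c x - evalp N d x"
  "evalp N (cscale r c) x = r * evalp N c x"
  "evalp N 0 x = 0"
  by (simp_all add: evalp_def sum.distrib sum_subtractf sum_distrib_left algebra_simps)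

lemma evalp_sum: "evalp N (sum f A) x = (\<Sum>k\<in>A. evalp N (f k) x)"
  by (induction A rule: infinite_finite_induct)
     (simp_all only: sum.infinite sum.empty sum.insert evalp_linear not_False_eq_True)

lemma monomial_split:
  "monomial \<alpha> x = of_real (x $ i) ^ \<alpha> i * (\<Prod>k\<in>UNIV - {i}. of_real (x $ k) ^ \<alpha> k)"
  unfolding monomial_def by (simp add: prod.remove)

lemma monomial_upd:
  "monomial (\<alpha>(i := m)) x = of_real (x $ i) ^ m * (\<Prod>k\<in>UNIV - {i}. of_real (x $ k) ^ \<alpha> k)"
  unfolding monomial_split[of _ x i] by (auto intro!: prod.cong)

lemma monomial_curve:
  assumes "(y has_vector_derivative y') (at t)"
  shows "((\<lambda>t. monomial \<alpha> (y t)) has_vector_derivative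
    (\<Sum>i\<in>UNIV. of_real (y' $ i) * (of_nat (\<alpha> i) * monomial (\<alpha>(i := \<alpha> i - 1)) (y t)))) (at t)"
proof -
  have comp: "((\<lambda>t. complex_of_real (y t $ i) ^ \<alpha> i) has_derivative
      (\<lambda>h. of_nat (\<alpha> i) * (h *\<^sub>R of_real (y' $ i)) * of_real (y t $ i) ^ (\<alpha> i - 1))) (at t)" for i
  proof -
    have "((\<lambda>t. complex_of_real (y t $ i)) has_vector_derivative of_real (y' $ i)) (at t)"
      by (intro bounded_linear.has_vector_derivative[OF bounded_linear_of_real]
          bounded_linear.has_vector_derivative[OF bounded_linear_vec_nth] assms)
    then show ?thesis unfolding has_vector_derivative_def by (rule has_derivative_power)
  qed
  have "((\<lambda>t. monomial \<alpha> (y t)) has_derivative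
      (\<lambda>h. \<Sum>i\<in>UNIV. of_nat (\<alpha> i) * (h *\<^sub>R of_real (y' $ i)) * of_real (y t $ i) ^ (\<alpha> i - 1)
        * (\<Prod>k\<in>UNIV - {i}. of_real (y t $ k) ^ \<alpha> k))) (at t)"
    unfolding monomial_def by (rule has_derivative_prod) (rule comp)
  then show ?thesis
    unfolding has_vector_derivative_def monomial_upd
    by (simp add: scaleR_sum_right algebra_simps)
qed

lemma evalp_dd_sum:
  fixes c :: "('n::finite \<Rightarrow> nat) \<Rightarrow> complex"
  assumes "homog N c"
  shows "(\<Sum>\<alpha>\<in>{\<alpha>. sum \<alpha> UNIV = N}. c \<alpha> * (of_nat (\<alpha> i) * monomial (\<alpha>(i := \<alpha> i - 1)) x))
    = evalp (N - 1) (dd i c) x"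
proof (cases N)
  case 0
  then show ?thesis using assms dd_homog_0[of c i] by (simp add: evalp_def)
next
  case (Suc M)
  have "(\<Sum>\<alpha>\<in>{\<alpha>. sum \<alpha> UNIV = Suc M}. c \<alpha> * (of_nat (\<alpha> i) * monomial (\<alpha>(i := \<alpha> i - 1)) x))
      = (\<Sum>\<alpha>\<in>{\<alpha>. sum \<alpha> UNIV = Suc M \<and> \<alpha> i \<noteq> 0}. c \<alpha> * (of_nat (\<alpha> i) * monomial (\<alpha>(i := \<alpha> i - 1)) x))"
    by (rule sum.mono_neutral_right) (auto simp: finite_exponents)
  also have "\<dots> = evalp M (dd i c) x"
    unfolding evalp_def
  proof (rule sum.reindex_bij_witness[of _ "\<lambda>\<alpha>. \<alpha>(i := Suc (\<alpha> i))" "\<lambda>\<alpha>. \<alpha>(i := \<alpha> i - 1)"])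
    fix \<alpha> :: "'n \<Rightarrow> nat" assume "\<alpha> \<in> {\<alpha>. sum \<alpha> UNIV = Suc M \<and> \<alpha> i \<noteq> 0}"
    then show "\<alpha>(i := \<alpha> i - 1) \<in> {\<alpha>. sum \<alpha> UNIV = M}"
      using sum_fun_upd_pred[of \<alpha> i] by simp
  next
    fix \<alpha> :: "'n \<Rightarrow> nat" assume "\<alpha> \<in> {\<alpha>. sum \<alpha> UNIV = M}"
    then show "\<alpha>(i := Suc (\<alpha> i)) \<in> {\<alpha>. sum \<alpha> UNIV = Suc M \<and> \<alpha> i \<noteq> 0}"
      using sum_fun_upd_Suc[of \<alpha> i] by simp
  qed (auto simp: dd_def)
  finally show ?thesis using Suc by simp
qed

lemma evalp_mulx: "evalp (Suc M) (mulx i c) x = of_real (x $ i) * evalp M c x"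
proof -
  have "evalp (Suc M) (mulx i c) x
      = (\<Sum>\<alpha>\<in>{\<alpha>. sum \<alpha> UNIV = Suc M \<and> \<alpha> i \<noteq> 0}. mulx i c \<alpha> * monomial \<alpha> x)"
    unfolding evalp_def by (rule sum.mono_neutral_right) (auto simp: finite_exponents mulx_def)
  also have "\<dots> = (\<Sum>\<alpha>\<in>{\<alpha>. sum \<alpha> UNIV = M}. of_real (x $ i) * (c \<alpha> * monomial \<alpha> x))"
  proof (rule sum.reindex_bij_witness[of _ "\<lambda>\<alpha>. \<alpha>(i := Suc (\<alpha> i))" "\<lambda>\<alpha>. \<alpha>(i := \<alpha> i - 1)"])
    fix \<alpha> :: "'a \<Rightarrow> nat" assume "\<alpha> \<in> {\<alpha>. sum \<alpha> UNIV = Suc M \<and> \<alpha> i \<noteq> 0}"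
    then show "\<alpha>(i := \<alpha> i - 1) \<in> {\<alpha>. sum \<alpha> UNIV = M}"
      using sum_fun_upd_pred[of \<alpha> i] by simp
  next
    fix \<alpha> :: "'a \<Rightarrow> nat" assume "\<alpha> \<in> {\<alpha>. sum \<alpha> UNIV = M}"
    then show "\<alpha>(i := Suc (\<alpha> i)) \<in> {\<alpha>. sum \<alpha> UNIV = Suc M \<and> \<alpha> i \<noteq> 0}"
      using sum_fun_upd_Suc[of \<alpha> i] by simp
  next
    fix \<alpha> :: "'a \<Rightarrow> nat" assume "\<alpha> \<in> {\<alpha>. sum \<alpha> UNIV = Suc M \<and> \<alpha> i \<noteq> 0}"
    then have "\<alpha> i \<noteq> 0" by simp
    then have "of_real (x $ i) ^ \<alpha> i = complex_of_real (x $ i) * of_real (x $ i) ^ (\<alpha> i - 1)"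
      by (metis power_eq_if)
    then show "of_real (x $ i) * (c (\<alpha>(i := \<alpha> i - 1)) * monomial (\<alpha>(i := \<alpha> i - 1)) x) = mulx i c \<alpha> * monomial \<alpha> x"
      using \<open>\<alpha> i \<noteq> 0\<close> by (simp add: mulx_def monomial_upd monomial_split[of \<alpha> x i])
  qed auto
  finally show ?thesis by (simp add: evalp_def sum_distrib_left)
qed

text \<open>Stated for arbitrary curves because both straight lines, for \<open>pdiff\<close>, and
  rotation orbits are needed.\<close>

lemma evalp_curve:
  assumes "homog N c" "(y has_vector_derivative y') (at t)"
  shows "((\<lambda>t. evalp N c (y t)) has_vector_derivative
    (\<Sum>i\<in>UNIV. of_real (y' $ i) * evalp (N - 1) (dd i c) (y t))) (at t)"
proof -
  have "((\<lambda>t. evalp N c (y t)) has_vector_derivative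
    (\<Sum>\<alpha>\<in>{\<alpha>. sum \<alpha> UNIV = N}. c \<alpha> * (\<Sum>i\<in>UNIV. of_real (y' $ i) * (of_nat (\<alpha> i) * monomial (\<alpha>(i := \<alpha> i - 1)) (y t))))) (at t)"
    unfolding evalp_def
    by (intro has_vector_derivative_sum bounded_linear.has_vector_derivative[OF bounded_linear_mult_right]
        monomial_curve assms)
  also have "(\<Sum>\<alpha>\<in>{\<alpha>. sum \<alpha> UNIV = N}. c \<alpha> * (\<Sum>i\<in>UNIV. of_real (y' $ i) * (of_nat (\<alpha> i) * monomial (\<alpha>(i := \<alpha> i - 1)) (y t))))
    = (\<Sum>i\<in>UNIV. of_real (y' $ i) * (\<Sum>\<alpha>\<in>{\<alpha>. sum \<alpha> UNIV = N}. c \<alpha> * (of_nat (\<alpha> i) * monomial (\<alpha>(i := \<alpha> i - 1)) (y t))))"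
    unfolding sum_distrib_left by (subst sum.swap) (simp add: algebra_simps)
  finally show ?thesis unfolding evalp_dd_sum[OF assms(1)] .
qed

lemma pdiff_evalp:
  fixes c :: "('n::finite \<Rightarrow> nat) \<Rightarrow> complex"
  assumes "homog N c"
  shows "pdiff i (evalp N c) = evalp (N - 1) (dd i c)"
proof
  fix x :: "real^'n"
  have "((\<lambda>t. x + t *\<^sub>R axis i 1) has_vector_derivative axis i 1) (at 0)"
    by (auto intro!: derivative_eq_intros)
  from evalp_curve[OF assms this]
  have "((\<lambda>t. evalp N c (x + t *\<^sub>R axis i 1)) has_vector_derivative evalp (N - 1) (dd i c) x) (at 0)"
    by (simp add: axis_def if_distrib[where f = "\<lambda>r. of_real r * _"] cong: if_cong)
  then show "pdiff i (evalp N c) x = evalp (N - 1) (dd i c) x"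
    unfolding pdiff_def by (rule vector_derivative_at)
qed

lemma homog_dd_pred: "homog N c \<Longrightarrow> homog (N - 1) (dd i c)"
  by (cases N) (auto simp: dd_homog_0 homog_linear homog_dd)

text \<open>The truncated degree N - 1 - 1 is also correct for N < 2, where all second derivatives
  vanish.\<close>

lemma laplacian_evalp:
  assumes "homog N c"
  shows "laplacian (evalp N c) x = evalp (N - 1 - 1) (lap c) x"
  unfolding laplacian_def lap_def
  by (simp only: pdiff_evalp[OF assms] pdiff_evalp[OF homog_dd_pred[OF assms]] evalp_sum)

text \<open>The partial derivatives vanish as functions, so by induction each \<open>dd i c\<close>
  is zero. In positive degree every exponent vector has a positive entry i, and its coefficient
  reappears in \<open>dd i c\<close>.\<close>

lemma evalp_eq_0:
  assumes "homog N c" "\<And>x. evalp N c x = 0"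
  shows "c = 0"
  using assms
proof (induction N arbitrary: c)
  case 0
  have "{\<alpha> :: 'a \<Rightarrow> nat. sum \<alpha> UNIV = 0} = {\<lambda>_. 0}" by auto
  then have "c (\<lambda>_. 0) = 0" using "0.prems"(2)[of 0] by (simp add: evalp_def monomial_def)
  show ?case
  proof
    fix \<alpha>
    show "c \<alpha> = 0 \<alpha>"
    proof (cases "\<alpha> = (\<lambda>_. 0)")
      case False
      then have "sum \<alpha> UNIV \<noteq> 0" by (auto simp: fun_eq_iff)
      then show ?thesis using "0.prems"(1) by (auto simp: homog_def)
    qed (use \<open>c (\<lambda>_. 0) = 0\<close> in simp)
  qed
next
  case (Suc N)
  have "evalp (Suc N) c = (\<lambda>_. 0)" using Suc.prems(2) by auto
  then have "pdiff i (evalp (Suc N) c) x = 0" for i x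
    by (simp add: pdiff_def)
  then have dd0: "dd i c = 0" for i
    using pdiff_evalp[OF Suc.prems(1)] homog_dd[OF Suc.prems(1)] by (intro Suc.IH) auto
  show ?case
  proof
    fix \<alpha>
    show "c \<alpha> = 0 \<alpha>"
    proof (rule ccontr)
      assume nz: "c \<alpha> \<noteq> 0 \<alpha>"
      then have "sum \<alpha> UNIV = Suc N" using Suc.prems(1) by (auto simp: homog_def)
      then obtain i where i: "\<alpha> i \<noteq> 0" by (metis nat.distinct(1) sum.neutral)
      have "dd i c (\<alpha>(i := \<alpha> i - 1)) = 0" by (simp only: dd0 zero_fun_apply)
      then show False using i nz by (simp add: dd_def del: of_nat_Suc)
    qed
  qed
qed

lemma homog_sum:
  assumes "\<And>i. homog N (f i)"
  shows "homog N (sum f A)"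
  by (induction A rule: infinite_finite_induct)
     (simp_all only: sum.infinite sum.empty sum.insert homog_linear assms not_False_eq_True)

lemma homog_lap: "homog N c \<Longrightarrow> homog (N - 1 - 1) (lap c)"
  unfolding lap_def by (intro homog_sum homog_dd_pred)

lemma harmonic_hom_eq: "harmonic_hom N = evalp N ` (harm N :: (('n::finite \<Rightarrow> nat) \<Rightarrow> complex) set)"
proof (intro equalityI subsetI)
  fix f :: "real^'n \<Rightarrow> complex" assume "f \<in> harmonic_hom N"
  then obtain c where c: "f = (\<lambda>x. \<Sum>\<alpha>\<in>{\<alpha>. sum \<alpha> UNIV = N}. c \<alpha> * monomial \<alpha> x)"
    and h: "\<And>x. laplacian f x = 0"
    unfolding harmonic_hom_def by blast
  \<comment> \<open>\<open>harmonic_hom\<close> leaves the coefficients outside degree N arbitrary;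
    cutting them off gives the homogeneous representative.\<close>
  define d where "d \<alpha> = (if sum \<alpha> UNIV = N then c \<alpha> else 0)" for \<alpha>
  have hd: "homog N d" by (simp add: homog_def d_def)
  have f: "f = evalp N d" unfolding c evalp_def by (auto simp: d_def)
  have "lap d = 0"
    using h unfolding f laplacian_evalp[OF hd] by (intro evalp_eq_0[OF homog_lap[OF hd]])
  then show "f \<in> evalp N ` harm N" using f hd by (auto simp: harm_def)
next
  fix f :: "real^'n \<Rightarrow> complex" assume "f \<in> evalp N ` harm N"
  then obtain c :: "('n \<Rightarrow> nat) \<Rightarrow> complex" where c: "homog N c" "lap c = 0" "f = evalp N c"
    by (auto simp: harm_def)
  then have "laplacian f x = 0" for x by (simp only: laplacian_evalp evalp_linear)
  moreover have "f = (\<lambda>x. \<Sum>\<alpha>\<in>{\<alpha>. sum \<alpha> UNIV = N}. c \<alpha> * monomial \<alpha> x)"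
    unfolding c(3) by (rule ext) (simp add: evalp_def)
  ultimately show "f \<in> harmonic_hom N" unfolding harmonic_hom_def by blast
qed

lemma evalp_L:
  assumes "homog N c"
  shows "evalp N (L i j c) x = of_real (x $ j) * evalp (N - 1) (dd i c) x - of_real (x $ i) * evalp (N - 1) (dd j c) x"
proof (cases N)
  case 0
  then show ?thesis using assms by (simp add: L_def dd_homog_0 mulx_linear evalp_linear)
next
  case (Suc M)
  then show ?thesis by (simp add: L_def evalp_linear evalp_mulx)
qed

section \<open>The isomorphism as a graph\<close>

text \<open>Four indices split into two pairs in 3 ways, with 2 orders of the factors; by
  antisymmetry the 4 ways of swapping inside the pairs agree. This accounts for all 24
  permutations.\<close>

lemma antisymmetrization_4:
  fixes Y :: "nat \<Rightarrow> nat \<Rightarrow> complex^'m^'m"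
  assumes swap: "\<And>i j. Y j i = - Y i j"
  shows "(\<Sum>p\<in>{p. p permutes {0..<4::nat}}. of_int (sign p) *\<^sub>R (Y (p 0) (p 1) ** Y (p 2) (p 3)))
    = 4 *\<^sub>R (Y 0 1 ** Y 2 3 + Y 2 3 ** Y 0 1 - Y 0 2 ** Y 1 3 - Y 1 3 ** Y 0 2
      + Y 0 3 ** Y 1 2 + Y 1 2 ** Y 0 3)"
proof -
  have S: "{0..<4::nat} = {0, 1, 2, 3}" by auto
  have f1: "finite {1::nat, 2, 3}" "0 \<notin> {1::nat, 2, 3}" by auto
  have f2: "finite {2::nat, 3}" "1 \<notin> {2::nat, 3}" by auto
  have f3: "finite {3::nat}" "2 \<notin> {3::nat}" by auto
  have sw: "Y 1 0 = - Y 0 1" "Y 2 0 = - Y 0 2" "Y 3 0 = - Y 0 3" "Y 2 1 = - Y 1 2" "Y 3 1 = - Y 1 3" "Y 3 2 = - Y 2 3"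
    by (rule swap)+
  have four: "4 *\<^sub>R z = z + z + z + z" for z :: "complex^'m^'m"
    using scaleR_left_distrib[of 2 2 z] by (simp add: scaleR_2)
  show ?thesis
    unfolding S sum_over_permutations_insert[OF f1] sum_over_permutations_insert[OF f2]
      sum_over_permutations_insert[OF f3] permutes_sing four
    by (simp add: sign_swap_id permutation_swap_id sign_compose sign_id swap_id_eq permutation_compose
        sw sw[unfolded One_nat_def] matrix_mult_linear)
qed

context so_representation
begin

text \<open>The quadratic Pluecker expression, symmetrized in the order of the factors because
  operators sharing an index need not commute.\<close>

definition plucker :: "'n \<Rightarrow> 'n \<Rightarrow> 'n \<Rightarrow> 'n \<Rightarrow> complex^'m^'m" where
  "plucker i j k l = lie_act \<rho> i j ** lie_act \<rho> k l + lie_act \<rho> k l ** lie_act \<rho> i j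
    - lie_act \<rho> i k ** lie_act \<rho> j l - lie_act \<rho> j l ** lie_act \<rho> i k
    + lie_act \<rho> i l ** lie_act \<rho> j k + lie_act \<rho> j k ** lie_act \<rho> i l"

lemma simple_rep_iff: "simple_rep \<rho> \<longleftrightarrow> (\<forall>i j k l. plucker i j k l = 0)"
proof -
  have "(let idx = (\<lambda>n::nat. [i, j, k, l] ! n) in
     (\<Sum>p\<in>{p. p permutes {0..<4::nat}}.
        of_int (sign p) *\<^sub>R (lie_act \<rho> (idx (p 0)) (idx (p 1)) ** lie_act \<rho> (idx (p 2)) (idx (p 3)))))
     = 4 *\<^sub>R plucker i j k l" for i j k l
    unfolding Let_def
    using antisymmetrization_4[of "\<lambda>m n. lie_act \<rho> ([i, j, k, l] ! m) ([i, j, k, l] ! n)", OF lie_act_swap]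
    by (simp add: plucker_def numeral_2_eq_2 numeral_3_eq_3)
  then show ?thesis unfolding simple_rep_def by (simp add: Let_def)
qed

sublocale lie: so_action "(*s) :: complex \<Rightarrow> complex^'m \<Rightarrow> complex^'m" "\<lambda>i j v. lie_act \<rho> i j *v v"
proof unfold_locales
  fix i j k l :: 'n and u :: "complex^'m"
  show "lie_act \<rho> j i *v u = - (lie_act \<rho> i j *v u)"
    unfolding lie_act_swap[of j i] by (rule bounded_bilinear.minus_left[OF bounded_bilinear_matrix_vector_mult])
  show "lie_act \<rho> i j *v (lie_act \<rho> i k *v u) = lie_act \<rho> i k *v (lie_act \<rho> i j *v u) + lie_act \<rho> j k *v u"
    if "distinct [i, j, k]"
    using lie_act_bracket[OF that]
    by (simp add: matrix_vector_mul_assoc matrix_vector_mult_add_rdistrib)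
  show "lie_act \<rho> i j *v (lie_act \<rho> k l *v u) = lie_act \<rho> k l *v (lie_act \<rho> i j *v u)"
    if "distinct [i, j, k, l]"
    using lie_act_commute[OF that] by (simp add: matrix_vector_mul_assoc)
qed (simp_all add: matrix_vector_right_distrib vector_scalar_commute)

lemma irreducible_lie:
  assumes "irreducible_rep \<rho>" "lie.invariant W"
  shows "W = {0} \<or> W = UNIV"
proof -
  have "\<forall>g\<in>SO. \<forall>w\<in>W. \<rho> g *v w \<in> W"
    using assms(2) rho_invariant unfolding lie.invariant_def by blast
  then show ?thesis using assms unfolding irreducible_rep_def lie.invariant_def by blast
qed

end

lemma (in so_plane) generated_minimal:
  assumes T: "invariant T" "v \<in> T"
  shows "generated v \<subseteq> T"
proof -
  have sub: "subspace T" and X: "\<And>i j u. u \<in> T \<Longrightarrow> X i j u \<in> T" using T by (auto simp: invariant_def)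
  have "layer v r \<subseteq> T" for r
  proof (induction r)
    case 0
    then show ?case using T sub by (simp add: span_minimal)
  next
    case (Suc r)
    then have "(\<Union>k\<in>- {a, b}. raise k ` layer v r) \<subseteq> T"
      unfolding raise_def using sub X by (auto intro!: subspace_diff subspace_scale)
    then show ?case using sub by (simp add: span_minimal)
  qed
  then show ?thesis unfolding generated_def using sub by (intro span_minimal) auto
qed

definition prod_scale :: "complex \<Rightarrow> (complex^'m) \<times> ('a \<Rightarrow> complex) \<Rightarrow> (complex^'m) \<times> ('a \<Rightarrow> complex)" where
  "prod_scale r p = (r *s fst p, cscale r (snd p))"

context so_representation
begin

definition prod_X :: "'n \<Rightarrow> 'n \<Rightarrow> (complex^'m) \<times> (('n \<Rightarrow> nat) \<Rightarrow> complex) \<Rightarrow> (complex^'m) \<times> (('n \<Rightarrow> nat) \<Rightarrow> complex)" where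
  "prod_X i j p = (lie_act \<rho> i j *v fst p, L i j (snd p))"

sublocale pr: so_action prod_scale prod_X
proof unfold_locales
  fix i j k l :: 'n and u :: "(complex^'m) \<times> (('n \<Rightarrow> nat) \<Rightarrow> complex)"
  show "prod_X j i u = - prod_X i j u"
    by (simp add: prod_X_def lie.X_swap[of j i] coeffs.X_swap[of j i])
  show "prod_X i j (prod_X i k u) = prod_X i k (prod_X i j u) + prod_X j k u" if "distinct [i, j, k]"
    unfolding prod_X_def using lie.X_bracket[OF that] coeffs.X_bracket[OF that] by simp
  show "prod_X i j (prod_X k l u) = prod_X k l (prod_X i j u)" if "distinct [i, j, k, l]"
    unfolding prod_X_def using lie.X_commute[OF that] coeffs.X_commute[OF that] by simp
qed (simp_all add: prod_X_def prod_scale_def prod_eq_iff lie.X_add coeffs.X_add lie.X_scale coeffs.X_scale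
    vec.scale_right_distrib vec.scale_left_distrib cfun.scale_right_distrib cfun.scale_left_distrib)

end

locale simple_irreducible = so_representation \<rho> for \<rho> :: "real^'n^'n \<Rightarrow> complex^'m^'m" +
  fixes a b :: 'n
  assumes simple: "simple_rep \<rho>" and irr: "irreducible_rep \<rho>" and a_b: "a \<noteq> b"
    and D: "CARD('n) \<ge> 3"
begin

sublocale lp: so_plane "(*s)" "\<lambda>i j v. lie_act \<rho> i j *v v" a b
  by unfold_locales (rule a_b)

sublocale pp: so_plane prod_scale prod_X a b
  by unfold_locales (rule a_b)

sublocale harmonic_plane a b
  by unfold_locales (rule a_b)

text \<open>For distinct indices the factors commute, and the six-term expression is twice the
  three-term one.\<close>

lemma plucker_vec:
  assumes "distinct [i, j, k, l]"
  shows "lie_act \<rho> i j *v (lie_act \<rho> k l *v u) - lie_act \<rho> i k *v (lie_act \<rho> j l *v u)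
    + lie_act \<rho> i l *v (lie_act \<rho> j k *v u) = 0"
proof -
  let ?A = "lie_act \<rho> i j ** lie_act \<rho> k l - lie_act \<rho> i k ** lie_act \<rho> j l + lie_act \<rho> i l ** lie_act \<rho> j k"
  have d: "distinct [k, l, i, j]" "distinct [j, l, i, k]" "distinct [j, k, i, l]" using assms by auto
  have "plucker i j k l = ?A + ?A"
    unfolding plucker_def lie_act_commute[OF d(1)] lie_act_commute[OF d(2)] lie_act_commute[OF d(3)]
    by (simp add: algebra_simps)
  also have "\<dots> = 2 *\<^sub>R ?A" by (rule scaleR_2[symmetric])
  finally have "?A = 0" using simple simple_rep_iff by simp
  then have "?A *v u = 0" by simp
  then show ?thesis
    by (simp add: matrix_vector_mult_add_rdistrib matrix_vector_mult_diff_rdistrib matrix_vector_mul_assoc)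
qed

lemma lowest_weight_vector:
  "\<exists>v N. v \<noteq> 0 \<and> (\<forall>k. k \<notin> {a, b} \<longrightarrow> lp.lower k v = 0)
    \<and> (\<forall>k l. k \<notin> {a, b} \<longrightarrow> l \<notin> {a, b} \<longrightarrow> lie_act \<rho> k l *v v = 0)
    \<and> lp.E v = (- of_nat N) *s v"
proof -
  have "card {a, b} < CARD('n)" using D a_b by simp
  then obtain k0 where k0: "k0 \<notin> {a, b}"
    by (metis UNIV_eq_I less_irrefl)
  have "(axis undefined 1 :: complex^'m) \<noteq> 0" by (simp add: axis_eq_0_iff)
  then have "(UNIV :: (complex^'m) set) \<noteq> {0}" by blast
  then obtain v j where v: "v \<noteq> 0" "\<And>k. k \<notin> {a, b} \<Longrightarrow> lp.lower k v = 0"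
    "lp.E v = (- (of_nat j / 2)) *s v"
    using lp.lowest_vector[of UNIV cart_basis, OF _ _ finite_cart_basis _ k0]
    by (auto simp: lie.invariant_def)
  have Xab: "lie_act \<rho> a b *v v = (- \<i> * (of_nat j / 2)) *s v"
    using lp.X_ab[of v] v(3) by (simp add: vec.scale_scale)
  \<comment> \<open>The lowering equations give X_bk v = i X_ak v, which turns the last two Pluecker
    terms into a commutator equal to -i X_kl v. The first term is -i (j/2) X_kl v, as X_ab commutes
    with X_kl; and j/2 + 1 is not zero.\<close>
  have side: "lie_act \<rho> k l *v v = 0" if kl: "k \<notin> {a, b}" "l \<notin> {a, b}" for k l
  proof (cases "k = l")
    case True
    then show ?thesis using lie.X_diag by simp
  next
    case False
    then have d: "distinct [a, b, k, l]" using kl a_b by auto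
    have neg: "lie_act \<rho> b m *v v = \<i> *s (lie_act \<rho> a m *v v)" if "m \<notin> {a, b}" for m
    proof -
      have "\<i> *s (lie_act \<rho> a m *v v + \<i> *s (lie_act \<rho> b m *v v)) = 0"
        using v(2)[OF that] by (simp add: lp.lower_def)
      then show ?thesis by (simp add: vec.scale_right_distrib)
    qed
    let ?w = "lie_act \<rho> k l *v v"
    have 1: "lie_act \<rho> a b *v ?w = (- \<i> * (of_nat j / 2)) *s ?w"
      unfolding lie.X_commute[OF d] Xab by (rule vector_scalar_commute)
    have 2: "lie_act \<rho> a l *v (lie_act \<rho> b k *v v) - lie_act \<rho> a k *v (lie_act \<rho> b l *v v) = (- \<i>) *s ?w"
      unfolding neg[OF kl(1)] neg[OF kl(2)] vector_scalar_commute
      using lp.bracket_side(1)[OF kl False, of a v] by (simp add: vec.scale_right_distrib)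
    have "lie_act \<rho> a b *v ?w + (lie_act \<rho> a l *v (lie_act \<rho> b k *v v) - lie_act \<rho> a k *v (lie_act \<rho> b l *v v)) = 0"
      using plucker_vec[OF d, of v] by (simp add: algebra_simps)
    then have "(- \<i> * (of_nat j / 2)) *s ?w + (- \<i>) *s ?w = 0" unfolding 1 2 .
    then have "(- \<i> * (of_nat j / 2) + - \<i>) *s ?w = 0" by (simp only: vec.scale_left_distrib)
    moreover have "- \<i> * (of_nat j / 2) + - \<i> \<noteq> (0 :: complex)"
    proof
      assume "- \<i> * (of_nat j / 2) + - \<i> = (0 :: complex)"
      then have "Im (- \<i> * (of_nat j / 2) + - \<i>) = 0" by simp
      then show False by simp
    qed
    ultimately show ?thesis by (simp only: vec.scale_eq_0_iff) simp
  qed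
  define m where "m = - \<i> * (of_nat j / 2 :: complex)"
  \<comment> \<open>Both curves solve the equation with operator X_ab and agree at 0, so \<psi>
    vanishes. At angle 2 pi this yields exp(2 pi m) = 1, that is, \<open>j\<close> is even.\<close>
  define \<psi> where "\<psi> t = \<rho> (rot a b t) *v v - exp (of_real t * m) *s v" for t
  have "(\<psi> has_vector_derivative lie_act \<rho> a b *v \<psi> t) (at t)" for t
  proof -
    have 1: "((\<lambda>t. \<rho> (rot a b t) *v v) has_vector_derivative (lie_act \<rho> a b ** \<rho> (rot a b t)) *v v) (at t)"
      by (rule bounded_linear.has_vector_derivative[OF
          bounded_bilinear.bounded_linear_left[OF bounded_bilinear_matrix_vector_mult] rho_rot_derivative])
    have "((\<lambda>t. exp (of_real t * m)) has_vector_derivative exp (of_real t * m) * m) (at t)"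
      using exp_scaleR_has_vector_derivative_right[of m t] by (simp add: scaleR_conv_of_real)
    then have 2: "((\<lambda>t. exp (of_real t * m) *s v) has_vector_derivative (exp (of_real t * m) * m) *s v) (at t)"
      by (rule bounded_linear.has_vector_derivative[rotated])
         (auto intro!: linear_conv_bounded_linear[THEN iffD1] linearI simp: vec.scale_left_distrib vec_eq_iff)
    show ?thesis
      unfolding \<psi>_def lie.X_diff vector_scalar_commute Xab m_def[symmetric] matrix_vector_mul_assoc
      using has_vector_derivative_diff[OF 1 2] by simp
  qed
  moreover have "\<psi> 0 = 0" by (simp add: \<psi>_def rho_one)
  ultimately have "\<psi> (2 * pi) = 0" by (rule linear_ode_zero) simp
  then have "(1 - exp (of_real (2 * pi) * m)) *s v = 0"
    unfolding \<psi>_def rot_2pi rho_one by (simp add: vec.scale_left_diff_distrib)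
  then have "exp (of_real (2 * pi) * m) = 1"
    using v(1) by (simp only: vec.scale_eq_0_iff eq_iff_diff_eq_0[symmetric] eq_commute[of _ 1]) simp
  then obtain n :: int where "Im (of_real (2 * pi) * m) = of_int (2 * n) * pi"
    unfolding exp_eq_1 by blast
  then have "pi * (real j + 2 * real_of_int n) = 0" by (simp add: m_def algebra_simps)
  then have "real_of_int (int j) = real_of_int (- 2 * n)" by simp
  then have "int j = - 2 * n" by (simp only: of_int_eq_iff)
  then have "even j" by presburger
  then obtain N where "j = 2 * N" by blast
  then have "lp.E v = (- of_nat N) *s v" using v(3) by simp
  then show ?thesis using v(1,2) side by blast
qed

lemma graph:
  "\<exists>\<tau> N. (\<forall>u w. \<tau> (u + w) = \<tau> u + \<tau> w) \<and> (\<forall>r u. \<tau> (r *s u) = cscale r (\<tau> u))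
    \<and> (\<forall>i j u. \<tau> (lie_act \<rho> i j *v u) = L i j (\<tau> u)) \<and> inj \<tau> \<and> range \<tau> = harm N"
proof -
  obtain v N where v: "v \<noteq> 0" "\<And>k. k \<notin> {a, b} \<Longrightarrow> lp.lower k v = 0"
    "\<And>k l. k \<notin> {a, b} \<Longrightarrow> l \<notin> {a, b} \<Longrightarrow> lie_act \<rho> k l *v v = 0" "lp.E v = (- of_nat N) *s v"
    using lowest_weight_vector by blast
  define v0 where "v0 = (v, zpow N)"
  have low: "pp.lower k v0 = 0" if "k \<notin> {a, b}" for k
    using v(2)[OF that] lower_zpow[OF that, of N]
    by (simp add: pp.lower_def lp.lower_def hp.lower_def v0_def prod_X_def prod_scale_def zero_prod_def)
  have side: "prod_X k l v0 = 0" if "k \<notin> {a, b}" "l \<notin> {a, b}" for k l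
    using v(3)[OF that] L_zpow[OF that, of N] by (simp add: v0_def prod_X_def zero_prod_def)
  have E_pair: "pp.E (u, c) = (lp.E u, hp.E c)" for u c
    by (simp add: pp.E_def lp.E_def hp.E_def prod_X_def prod_scale_def)
  have weight: "pp.E v0 = prod_scale (- of_nat N) v0"
    unfolding v0_def E_pair v(4) E_zpow by (simp add: prod_scale_def)
  define U where "U = pp.generated v0"
  have inv: "pr.invariant U" unfolding U_def by (rule pp.invariant_generated[OF low side weight])
  have v0U: "v0 \<in> U"
    unfolding U_def using pp.layer_subset_generated[OF low side weight, of 0] pr.span_base[of v0 "{v0}"] by auto
  have lowest: "\<exists>c. p = prod_scale c v0" if "p \<in> U" "pp.E p = prod_scale (- of_nat N) p" for p
    using pp.generated_lowest[OF low side weight] that unfolding U_def by blast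
  have add: "(u + u', c + c') \<in> U" if "(u, c) \<in> U" "(u', c') \<in> U" for u u' c c'
    using inv that pr.subspace_add unfolding pr.invariant_def by fastforce
  have diff: "(u - u', c - c') \<in> U" if "(u, c) \<in> U" "(u', c') \<in> U" for u u' c c'
    using inv that pr.subspace_diff unfolding pr.invariant_def by fastforce
  have scale: "(r *s u, cscale r c) \<in> U" if "(u, c) \<in> U" for r u c
    using inv that pr.subspace_scale[of U "(u, c)" r] unfolding pr.invariant_def by (simp add: prod_scale_def)
  have zero: "(0, 0) \<in> U"
    using inv pr.subspace_0 unfolding pr.invariant_def zero_prod_def by blast
  have X: "(lie_act \<rho> i j *v u, L i j c) \<in> U" if "(u, c) \<in> U" for i j u c
    using inv that unfolding pr.invariant_def prod_X_def by force
  \<comment> \<open>Confines the second components to harmonic polynomials of degree N, where every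
    nonzero invariant subspace contains z^N.\<close>
  have "pr.invariant (UNIV \<times> harm N)"
    using invariant_harm[of N, where 'a = 'n]
    unfolding pr.invariant_def coeffs.invariant_def pr.subspace_def cfun.subspace_def
    by (auto simp: prod_X_def prod_scale_def zero_prod_def)
  moreover have "v0 \<in> UNIV \<times> harm N" using zpow_harm by (simp add: v0_def)
  ultimately have U_harm: "U \<subseteq> UNIV \<times> harm N" unfolding U_def by (rule pp.generated_minimal)
  \<comment> \<open>By irreducibility this kernel is zero or everything. In the second case (v, 0)
    lies in \<open>U\<close> and has weight -N, but is no multiple of (v, z^N).\<close>
  have K1: "{u. (u, 0) \<in> U} = {0}"
  proof -
    have "lie.invariant {u. (u, 0) \<in> U}"
      unfolding lie.invariant_def vec.subspace_def
      using zero add[where c = 0 and c' = 0] scale[where c = 0] X[where c = 0] by auto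
    then consider "{u. (u, 0) \<in> U} = {0}" | "(v, 0) \<in> U" using irreducible_lie[OF irr] by blast
    then show ?thesis
    proof cases
      case 2
      have "pp.E (v, 0) = prod_scale (- of_nat N) (v, 0)"
        unfolding E_pair v(4) by (simp add: prod_scale_def)
      then obtain c where "(v, 0) = prod_scale c v0" using lowest[OF 2] by blast
      then have "v = c *s v" "0 = cscale c (zpow N)" by (simp_all add: prod_scale_def v0_def)
      then have "c = 0" using zpow_neq_0[of N] by (metis cfun.scale_eq_0_iff)
      then show ?thesis using \<open>v = c *s v\<close> v(1) by simp
    qed
  qed
  \<comment> \<open>A nonzero kernel would contain z^N, and (0, z^N) has weight -N without being a
    multiple of (v, z^N).\<close>
  have K2: "{c. (0, c) \<in> U} = {0}"
  proof (rule ccontr)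
    assume ne: "{c. (0, c) \<in> U} \<noteq> {0}"
    have "coeffs.invariant {c. (0, c) \<in> U}"
      unfolding coeffs.invariant_def cfun.subspace_def
      using zero add[where u = 0 and u' = 0] scale[where u = 0] X[where u = 0] by auto
    then have "zpow N \<in> {c. (0, c) \<in> U}"
      by (rule zpow_in_invariant[OF _ _ ne D]) (use U_harm in auto)
    then have in_U: "(0, zpow N) \<in> U" by simp
    have "pp.E (0, zpow N) = prod_scale (- of_nat N) (0, zpow N)"
      unfolding E_pair E_zpow by (simp add: prod_scale_def)
    then obtain c where "(0, zpow N) = prod_scale c v0" using lowest[OF in_U] by blast
    then have "0 = c *s v" "zpow N = cscale c (zpow N)" by (simp_all add: prod_scale_def v0_def)
    then have "c = 0" using v(1) by (metis vec.scale_eq_0_iff)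
    then show False using \<open>zpow N = cscale c (zpow N)\<close> zpow_neq_0[of N] by simp
  qed
  have fstU: "fst ` U = {u. \<exists>c. (u, c) \<in> U}" and sndU: "snd ` U = {c. \<exists>u. (u, c) \<in> U}" by force+
  have "lie.invariant (fst ` U)"
    unfolding lie.invariant_def vec.subspace_def fstU mem_Collect_eq Ball_def
    by (intro conjI allI impI) (use zero add scale X in blast)+
  moreover have "v \<in> fst ` U" using v0U unfolding v0_def by force
  ultimately have dom: "fst ` U = UNIV" using irreducible_lie[OF irr] v(1) by blast
  have "coeffs.invariant (snd ` U)"
    unfolding coeffs.invariant_def cfun.subspace_def sndU mem_Collect_eq Ball_def
    by (intro conjI allI impI) (use zero add scale X in blast)+
  moreover have "zpow N \<in> snd ` U" using v0U unfolding v0_def by force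
  ultimately have ran: "snd ` U = harm N"
    using U_harm by (intro invariant_eq_harm D) auto
  \<comment> \<open>\<open>dom\<close> makes the relation \<open>U\<close> total and
    \<open>K2\<close> single-valued; \<open>K1\<close> gives injectivity and \<open>ran\<close> the
    image.\<close>
  have "\<forall>u. \<exists>c. (u, c) \<in> U" using dom by (metis UNIV_I imageE prod.collapse)
  then obtain \<tau> where \<tau>: "\<And>u. (u, \<tau> u) \<in> U" by metis
  have uniq: "\<tau> u = c" if "(u, c) \<in> U" for u c
  proof -
    have "(0, \<tau> u - c) \<in> U" using diff[OF \<tau>[of u] that] by (simp only: diff_self)
    then have "\<tau> u - c \<in> {0}" unfolding K2[symmetric] by blast
    then show ?thesis by (simp only: singleton_iff right_minus_eq)
  qed
  have "inj \<tau>"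
  proof
    fix u u' assume "\<tau> u = \<tau> u'"
    then have "(u - u', 0) \<in> U" using diff[OF \<tau>[of u] \<tau>[of u']] by (simp only: diff_self)
    then have "u - u' \<in> {0}" unfolding K1[symmetric] by blast
    then show "u = u'" by simp
  qed
  moreover have "range \<tau> = harm N"
  proof -
    have "range \<tau> = snd ` U" using \<tau> uniq by force
    then show ?thesis using ran by simp
  qed
  ultimately show ?thesis
    using uniq[OF add[OF \<tau> \<tau>]] uniq[OF scale[OF \<tau>]] uniq[OF X[OF \<tau>]] by blast
qed

end

section \<open>Equivariance and the converse\<close>

text \<open>The velocity is described only through its pairing with \<open>g\<close>, the form in
  which the chain rule uses it, with \<open>g\<close> as the gradient.\<close>

lemma rot_curve:
  fixes x :: "real^'n"
  shows "\<exists>y'. ((\<lambda>t. rot i j t *v x) has_vector_derivative y') (at t)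
    \<and> (\<forall>g. (\<Sum>a\<in>UNIV. of_real (y' $ a) * g a)
      = (of_real ((rot i j t *v x) $ i) * g j - of_real ((rot i j t *v x) $ j) * g i :: complex))"
proof (cases "i = j")
  case True
  then show ?thesis by (intro exI[of _ 0]) simp
next
  case False
  define u where "u = axis i (x $ i) + axis j (x $ j)"
  define v where "v = axis j (x $ i) - axis i (x $ j)"
  let ?y = "- sin t *\<^sub>R u + cos t *\<^sub>R v"
  have "rot i j t *v x = x + (cos t - 1) *\<^sub>R u + sin t *\<^sub>R v" for t
    using False by (auto simp: vec_eq_iff rot_mult_vec u_def v_def axis_def algebra_simps)
  moreover have "((\<lambda>t. x + (cos t - 1) *\<^sub>R u + sin t *\<^sub>R v) has_vector_derivative ?y) (at t)"
    by (auto intro!: derivative_eq_intros)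
  ultimately have "((\<lambda>t. rot i j t *v x) has_vector_derivative ?y) (at t)" by simp
  moreover have "(\<Sum>a\<in>UNIV. of_real (?y $ a) * g a)
      = of_real ((rot i j t *v x) $ i) * g j - of_real ((rot i j t *v x) $ j) * g i" for g :: "'n \<Rightarrow> complex"
  proof -
    have "(\<Sum>a\<in>UNIV. of_real (?y $ a) * g a) = (\<Sum>a\<in>{i, j}. of_real (?y $ a) * g a)"
      by (rule sum.mono_neutral_right) (auto simp: u_def v_def axis_def)
    then show ?thesis using False
      by (simp add: u_def v_def axis_def rot_mult_vec algebra_simps)
  qed
  ultimately show ?thesis by blast
qed

lemma matrix_inv_mult:
  assumes "g \<in> SO"
  shows "g ** matrix_inv g = mat 1" "matrix_inv g ** g = mat 1"
proof -
  have "g ** transpose g = mat 1 \<and> transpose g ** g = mat 1"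
    using assms by (simp add: SO_def orthogonal_matrix_def)
  then have "g ** matrix_inv g = mat 1 \<and> matrix_inv g ** g = mat 1"
    unfolding matrix_inv_def by (rule someI)
  then show "g ** matrix_inv g = mat 1" "matrix_inv g ** g = mat 1" by auto
qed

locale coefficient_map =
  fixes \<tau> :: "complex^'m \<Rightarrow> ('n::finite \<Rightarrow> nat) \<Rightarrow> complex" and N :: nat
  assumes tau_add: "\<tau> (u + w) = \<tau> u + \<tau> w" and tau_scale: "\<tau> (r *s u) = cscale r (\<tau> u)"
    and tau_homog: "homog N (\<tau> u)"
begin

text \<open>Reduces a curve of polynomials to the coordinates of a curve of vectors against finitely
  many fixed polynomials, so that no topology on coefficient functions is involved.\<close>

lemma tau_expansion: "\<tau> u = (\<Sum>k\<in>UNIV. cscale (u $ k) (\<tau> (axis k 1)))"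
proof -
  have "\<tau> 0 = 0" using tau_scale[of 0 0] by simp
  then have "\<tau> (sum f A) = (\<Sum>k\<in>A. \<tau> (f k))" for f :: "'m \<Rightarrow> complex^'m" and A
    by (induction A rule: infinite_finite_induct)
       (simp_all only: sum.infinite sum.empty sum.insert tau_add not_False_eq_True)
  from this[of "\<lambda>k. (u $ k) *s axis k 1" UNIV] show ?thesis
    by (simp only: basis_expansion tau_scale)
qed

lemma evalp_tau: "evalp N (\<tau> u) y = (\<Sum>k\<in>UNIV. u $ k * evalp N (\<tau> (axis k 1)) y)"
  by (subst tau_expansion) (simp only: evalp_sum evalp_linear)

lemma evalp_dd_tau: "evalp M (dd i (\<tau> u)) y = (\<Sum>k\<in>UNIV. u $ k * evalp M (dd i (\<tau> (axis k 1))) y)"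
  by (subst tau_expansion) (simp only: evalp_sum evalp_linear dd_sum dd_linear)

lemma evalp_tau_derivative:
  assumes w: "(w has_vector_derivative w') (at t)" and y: "(y has_vector_derivative y') (at t)"
  shows "((\<lambda>t. evalp N (\<tau> (w t)) (y t)) has_vector_derivative
    evalp N (\<tau> w') (y t) + (\<Sum>i\<in>UNIV. of_real (y' $ i) * evalp (N - 1) (dd i (\<tau> (w t))) (y t))) (at t)"
proof -
  have "((\<lambda>t. \<Sum>k\<in>UNIV. w t $ k * evalp N (\<tau> (axis k 1)) (y t)) has_vector_derivative
    (\<Sum>k\<in>UNIV. w t $ k * (\<Sum>i\<in>UNIV. of_real (y' $ i) * evalp (N - 1) (dd i (\<tau> (axis k 1))) (y t))
      + w' $ k * evalp N (\<tau> (axis k 1)) (y t))) (at t)"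
    by (intro has_vector_derivative_sum has_vector_derivative_mult evalp_curve tau_homog y
        bounded_linear.has_vector_derivative[OF bounded_linear_vec_nth] w)
  also have "(\<lambda>t. \<Sum>k\<in>UNIV. w t $ k * evalp N (\<tau> (axis k 1)) (y t)) = (\<lambda>t. evalp N (\<tau> (w t)) (y t))"
    unfolding evalp_tau[symmetric] ..
  also have "(\<Sum>k\<in>UNIV. w t $ k * (\<Sum>i\<in>UNIV. of_real (y' $ i) * evalp (N - 1) (dd i (\<tau> (axis k 1))) (y t))
      + w' $ k * evalp N (\<tau> (axis k 1)) (y t))
    = evalp N (\<tau> w') (y t) + (\<Sum>i\<in>UNIV. of_real (y' $ i) * evalp (N - 1) (dd i (\<tau> (w t))) (y t))"
  proof -
    have "(\<Sum>i\<in>UNIV. of_real (y' $ i) * evalp (N - 1) (dd i (\<tau> (w t))) (y t))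
      = (\<Sum>k\<in>UNIV. w t $ k * (\<Sum>i\<in>UNIV. of_real (y' $ i) * evalp (N - 1) (dd i (\<tau> (axis k 1))) (y t)))"
      unfolding evalp_dd_tau[of _ _ "w t"] sum_distrib_left
      by (subst sum.swap) (simp add: algebra_simps)
    then show ?thesis unfolding sum.distrib evalp_tau[of w'] by (simp add: add.commute)
  qed
  finally show ?thesis .
qed

end

locale lie_intertwiner = so_representation \<rho> + coefficient_map \<tau> N
  for \<rho> :: "real^'n^'n \<Rightarrow> complex^'m^'m" and \<tau> :: "complex^'m \<Rightarrow> ('n \<Rightarrow> nat) \<Rightarrow> complex" and N +
  assumes tau_lie: "\<tau> (lie_act \<rho> i j *v u) = L i j (\<tau> u)"
begin

text \<open>The derivative in t is zero: moving the vector contributes x_j \<open>dd i\<close> - x_i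
  \<open>dd j\<close> at the rotated point, and moving the point contributes the negative.\<close>

lemma evalp_rot_invariant: "evalp N (\<tau> (\<rho> (rot i j t) *v u)) (rot i j t *v x) = evalp N (\<tau> u) x"
proof -
  let ?F = "\<lambda>t. evalp N (\<tau> (\<rho> (rot i j t) *v u)) (rot i j t *v x)"
  have "(?F has_vector_derivative 0) (at t)" for t
  proof -
    define w where "w = \<rho> (rot i j t) *v u"
    have "((\<lambda>t. \<rho> (rot i j t) *v u) has_vector_derivative (lie_act \<rho> i j ** \<rho> (rot i j t)) *v u) (at t)"
      by (rule bounded_linear.has_vector_derivative[OF
          bounded_bilinear.bounded_linear_left[OF bounded_bilinear_matrix_vector_mult] rho_rot_derivative])
    then have w: "((\<lambda>t. \<rho> (rot i j t) *v u) has_vector_derivative lie_act \<rho> i j *v w) (at t)"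
      by (simp add: w_def matrix_vector_mul_assoc)
    obtain y' where y: "((\<lambda>t. rot i j t *v x) has_vector_derivative y') (at t)"
      and y': "\<And>g. (\<Sum>a\<in>UNIV. of_real (y' $ a) * g a)
        = (of_real ((rot i j t *v x) $ i) * g j - of_real ((rot i j t *v x) $ j) * g i :: complex)"
      using rot_curve[of i j x t] by blast
    show ?thesis
      using evalp_tau_derivative[OF w y] unfolding y' tau_lie evalp_L[OF tau_homog] w_def by simp
  qed
  then obtain c where "\<And>t. ?F t = c"
    using has_vector_derivative_zero_constant[of UNIV ?F] by auto
  from this[of t] this[of 0] show ?thesis by (simp add: rho_one)
qed

lemma evalp_SO_invariant:
  assumes "g \<in> SO"
  shows "evalp N (\<tau> (\<rho> g *v u)) (g *v x) = evalp N (\<tau> u) x"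
  using assms unfolding SO_eq_rotgen
proof (induction rule: rotgen.induct)
  case rotgen_one
  then show ?case by (simp add: rho_one)
next
  case (rotgen_step g i j t)
  then show ?case
    using evalp_rot_invariant[of i j t "\<rho> g *v u" "g *v x"]
    by (simp add: rho_mult rot_in_SO rotgen_SO matrix_vector_mul_assoc)
qed

lemma evalp_equivariant:
  assumes "g \<in> SO"
  shows "evalp N (\<tau> (\<rho> g *v u)) x = evalp N (\<tau> u) (matrix_inv g *v x)"
  using evalp_SO_invariant[OF assms, of u "matrix_inv g *v x"] matrix_inv_mult[OF assms]
  by (simp add: matrix_vector_mul_assoc)

end

lemma evalp_inj: "homog N c \<Longrightarrow> homog N d \<Longrightarrow> evalp N c = evalp N d \<Longrightarrow> c = d"
  using evalp_eq_0[OF homog_linear(2)[of N c d]] by (simp only: evalp_linear diff_self right_minus_eq)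

lemma (in simple_irreducible) equiv_harmonic: "\<exists>N. equiv_harmonic \<rho> N"
proof -
  obtain \<tau> N where add: "\<And>u w. \<tau> (u + w) = \<tau> u + \<tau> w" and scale: "\<And>r u. \<tau> (r *s u) = cscale r (\<tau> u)"
    and lie: "\<And>i j u. \<tau> (lie_act \<rho> i j *v u) = L i j (\<tau> u)" and inj: "inj \<tau>" and ran: "range \<tau> = harm N"
    using graph by blast
  have hom: "homog N (\<tau> u)" for u using ran by (auto simp: harm_def)
  interpret lie_intertwiner \<rho> \<tau> N
    by unfold_locales (rule add scale hom lie)+
  have "equiv_harmonic \<rho> N"
    unfolding equiv_harmonic_def
  proof (intro exI conjI allI ballI)
    show "inj (\<lambda>u. evalp N (\<tau> u))"
      by (rule injI) (use evalp_inj[OF hom hom] inj in \<open>auto dest: injD\<close>)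
    show "range (\<lambda>u. evalp N (\<tau> u)) = harmonic_hom N"
      unfolding harmonic_hom_eq ran[symmetric] by (simp add: image_image)
    show "evalp N (\<tau> (u + v)) = (\<lambda>x. evalp N (\<tau> u) x + evalp N (\<tau> v) x)" for u v
      by (rule ext) (simp only: add evalp_linear)
    show "evalp N (\<tau> (r *s u)) = (\<lambda>x. r * evalp N (\<tau> u) x)" for r u
      by (rule ext) (simp only: scale evalp_linear)
    show "evalp N (\<tau> (\<rho> g *v u)) = (\<lambda>x. evalp N (\<tau> u) (matrix_inv g *v x))" if "g \<in> SO" for g u
      by (rule ext) (rule evalp_equivariant[OF that])
  qed
  then show ?thesis ..
qed

text \<open>With a complex Kronecker symbol, the contributions of coinciding indices cancel by ring
  arithmetic, without case distinctions among four indices.\<close>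

definition delta :: "'n \<Rightarrow> 'n \<Rightarrow> complex" where
  "delta i j = (if i = j then 1 else 0)"

lemma delta_commute: "delta i j = delta j i"
  by (simp add: delta_def)

lemma dd_mulx_delta: "dd i (mulx j c) = mulx j (dd i c) + cscale (delta i j) c"
  by (simp add: dd_mulx delta_def)

lemma L_plucker:
  "L i j (L k l c) + L k l (L i j c) - L i k (L j l c) - L j l (L i k c) + L i l (L j k c) + L j k (L i l c) = 0"
  by (simp add: L_def mulx_linear dd_linear dd_mulx_delta fun_eq_iff algebra_simps
      mulx_commute dd_commute delta_commute)

text \<open>Equivariance is differentiated at t = 0 in two ways, through \<open>\<rho>\<close> and
  through the moving point. Hence the equivalence intertwines \<open>lie_act\<close> with
  \<open>L\<close>, and its injectivity transports the vanishing of the Pluecker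
  expressions.\<close>

lemma (in so_representation) equiv_harmonic_imp_simple:
  assumes "equiv_harmonic \<rho> N"
  shows "simple_rep \<rho>"
proof -
  obtain T where T: "inj T" "range T = harmonic_hom N"
    "\<And>u v. T (u + v) = (\<lambda>x. T u x + T v x)" "\<And>r u. T (r *s u) = (\<lambda>x. r * T u x)"
    "\<And>g u. g \<in> SO \<Longrightarrow> T (\<rho> g *v u) = (\<lambda>x. T u (matrix_inv g *v x))"
    using assms unfolding equiv_harmonic_def by blast
  have "\<forall>u. \<exists>c. homog N c \<and> T u = evalp N c"
    using T(2) unfolding harmonic_hom_eq harm_def by blast
  then obtain \<tau> where \<tau>: "\<And>u. homog N (\<tau> u)" "\<And>u. T u = evalp N (\<tau> u)" by metis
  interpret coefficient_map \<tau> N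
  proof
    fix u w :: "complex^'m" and r :: complex
    show "homog N (\<tau> u)" by (rule \<tau>)
    show "\<tau> (u + w) = \<tau> u + \<tau> w"
    proof (rule evalp_inj[OF \<tau>(1) homog_linear(1)[OF \<tau>(1) \<tau>(1)]])
      show "evalp N (\<tau> (u + w)) = evalp N (\<tau> u + \<tau> w)"
        using T(3)[of u w] unfolding \<tau>(2) by (simp add: fun_eq_iff evalp_linear)
    qed
    show "\<tau> (r *s u) = cscale r (\<tau> u)"
    proof (rule evalp_inj[OF \<tau>(1) homog_linear(3)[OF \<tau>(1)]])
      show "evalp N (\<tau> (r *s u)) = evalp N (cscale r (\<tau> u))"
        using T(4)[of r u] unfolding \<tau>(2) by (simp add: fun_eq_iff evalp_linear)
    qed
  qed
  have lie: "\<tau> (lie_act \<rho> i j *v u) = L i j (\<tau> u)" for i j u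
  proof (rule evalp_inj[OF \<tau>(1)])
    show "homog N (L i j (\<tau> u))" unfolding L_def by (intro homog_linear homog_mulx_dd \<tau>(1))
    show "evalp N (\<tau> (lie_act \<rho> i j *v u)) = evalp N (L i j (\<tau> u))"
    proof
      fix x :: "real^'n"
      have inv: "matrix_inv (rot i j t) = rot j i t" for t
      proof -
        have "rot j i t ** (rot i j t ** matrix_inv (rot i j t)) = rot j i t ** mat 1"
          using matrix_inv_mult[OF rot_in_SO] by metis
        then show ?thesis unfolding matrix_mul_assoc rot_swap[of j i] by (simp flip: rot_add)
      qed
      have eq: "evalp N (\<tau> (\<rho> (rot i j t) *v u)) x = evalp N (\<tau> u) (rot j i t *v x)" for t
        using fun_cong[OF T(5)[OF rot_in_SO, of i j t u], of x] unfolding \<tau>(2) inv .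
      have "((\<lambda>t. \<rho> (rot i j t) *v u) has_vector_derivative lie_act \<rho> i j *v u) (at 0)"
        by (rule bounded_linear.has_vector_derivative[OF
            bounded_bilinear.bounded_linear_left[OF bounded_bilinear_matrix_vector_mult] rho_rot_derivative_0])
      from evalp_tau_derivative[OF this has_vector_derivative_const[of x]]
      have 1: "((\<lambda>t. evalp N (\<tau> u) (rot j i t *v x)) has_vector_derivative
          evalp N (\<tau> (lie_act \<rho> i j *v u)) x) (at 0)"
        unfolding eq by simp
      obtain y' where y: "((\<lambda>t. rot j i t *v x) has_vector_derivative y') (at 0)"
        and y': "\<And>g. (\<Sum>a\<in>UNIV. of_real (y' $ a) * g a)
          = (of_real ((rot j i 0 *v x) $ j) * g i - of_real ((rot j i 0 *v x) $ i) * g j :: complex)"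
        using rot_curve[of j i x 0] by blast
      have "((\<lambda>t. evalp N (\<tau> u) (rot j i t *v x)) has_vector_derivative evalp N (L i j (\<tau> u)) x) (at 0)"
        using evalp_curve[OF \<tau>(1) y] unfolding y' evalp_L[OF \<tau>(1)] by simp
      then show "evalp N (\<tau> (lie_act \<rho> i j *v u)) x = evalp N (L i j (\<tau> u)) x"
        using 1 vector_derivative_unique_at by blast
    qed
  qed
  have tau_minus: "\<tau> (u - w) = \<tau> u - \<tau> w" for u w
    using tau_add[of "u - w" w] by (simp only: diff_add_cancel add_diff_cancel_right')
  have tau_inj: "u = w" if "\<tau> u = \<tau> w" for u w
    using T(1) that \<tau>(2) by (metis injD)
  have "plucker i j k l *v u = 0" for i j k l u
  proof (rule tau_inj)
    have "plucker i j k l *v u = lie_act \<rho> i j *v (lie_act \<rho> k l *v u) + lie_act \<rho> k l *v (lie_act \<rho> i j *v u)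
      - lie_act \<rho> i k *v (lie_act \<rho> j l *v u) - lie_act \<rho> j l *v (lie_act \<rho> i k *v u)
      + lie_act \<rho> i l *v (lie_act \<rho> j k *v u) + lie_act \<rho> j k *v (lie_act \<rho> i l *v u)"
      unfolding plucker_def
      by (simp only: matrix_vector_mult_add_rdistrib matrix_vector_mult_diff_rdistrib matrix_vector_mul_assoc)
    then have "\<tau> (plucker i j k l *v u) = 0"
      by (simp only: tau_add tau_minus lie L_plucker)
    also have "0 = \<tau> 0" using tau_scale[of 0 0] by simp
    finally show "\<tau> (plucker i j k l *v u) = \<tau> 0" .
  qed
  then have "plucker i j k l = 0" for i j k l by (simp add: matrix_eq)
  then show ?thesis unfolding simple_rep_iff by blast
qed

theorem theorem2:
  fixes \<rho> :: "real^'n^'n \<Rightarrow> complex^'m^'m"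
  assumes "CARD('n) \<ge> 4"
    and "so_rep \<rho>"
    and "irreducible_rep \<rho>"
  shows "simple_rep \<rho> \<longleftrightarrow> (\<exists>N::nat. equiv_harmonic \<rho> N)"
proof
  interpret so_representation \<rho> by unfold_locales (rule assms)
  show "simple_rep \<rho>" if "\<exists>N. equiv_harmonic \<rho> N"
    using that equiv_harmonic_imp_simple by blast
  assume simple: "simple_rep \<rho>"
  obtain a b :: 'n where "a \<noteq> b"
    using assms(1) card_le_Suc0_iff_eq[of "UNIV :: 'n set"] by auto
  then interpret simple_irreducible \<rho> a b
    using assms simple by unfold_locales auto
  show "\<exists>N. equiv_harmonic \<rho> N" by (rule equiv_harmonic)
qed

end
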